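(* Let $d\ge1$, $c\ge1$, let $\mu_0$ be a probability measure on $[1/c,c]$ and $\mu=\mu_0^{\otimes(\mathbb Z^d)^*}$. Then $\mu$-almost surely $$\lim_{N\to\infty}D_N(\xi)=D .$$
   Context: $(\mathbb Z^d)^*$ is the set of nearest neighbour bonds of $\mathbb Z^d$; $e_1,\dots,e_d$ are the unit coordinate vectors. The environment space is $\Omega=[1/c,c]^{(\mathbb Z^d)^*}$, and for $\xi\in\Omega$ we write $\xi_i(x)$ for the value $\xi(b)$ at the bond $b=(x,x+e_i)$. The measure $\mu=\mu_0^{\otimes(\mathbb Z^d)^*}$ is the product measure on $\Omega$, and $\mathbb E_\mu$ its expectation. For fixed $\xi\in\Omega$, $X(t,\xi)$ is the continuous time nearest neighbour random walk on $\mathbb Z^d$ that jumps across each bond $b$ (in either direction) at rate $\xi(b)$, i.e. with generator $f\mapsto\sum_{i=1}^d\{\xi_i(x)[f(x+e_i)-f(x)]+\xi_i(x-e_i)[f(x-e_i)-f(x)]\}$. $\mathbb E_x^\xi$ is expectation for the walk started at $x$. The (infinite volume, annealed) effective diffusion matrix $D$ is the symmetric $d\times d$ matrix with $$(Dv,v)=\lim_{t\to\infty}\frac1t\,\mathbb E_\mu\mathbb E_0^\xi\big[(X(t,\xi),v)^2\big],\quad v\in\mathbb R^d.$$ It is well known that the limit exists and that $(Dv,v)=2\inf_{f\in L^2(\mu)}\sum_{i=1}^d\mathbb E_\mu\big[\xi_i(0)(v_i+f(\tau_{-e_i}\xi)-f(\xi))^2\big]$, where $(\tau_y\xi)_i(x)=\xi_i(x-y)$.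 For a positive integer $N$ let $T_N=\mathbb Z^d/2N\mathbb Z^d$, identified with $\{-N,\dots,N-1\}^d$, and let $\pi_N\xi$ be the periodized environment $(\pi_N\xi)_i(x)=\xi_i(\dot x)$, where $\dot x\in\{-N,\dots,N-1\}^d$ and $x-\dot x\in 2N\mathbb Z^d$. For every $\xi\in\Omega$ the finite volume effective diffusion matrix $D_N(\xi)$ is the symmetric $d\times d$ matrix with $$(D_N(\xi)v,v)=\lim_{t\to\infty}\frac1t\,\mathbb E_0^{\pi_N\xi}\big[(X(t,\pi_N\xi),v)^2\big],\quad v\in\mathbb R^d.$$ The limit exists, and $(D_N(\xi)v,v)=2\inf_{f:T_N\to\mathbb R}\sum_{i=1}^d\frac1{|T_N|}\sum_{x\in T_N}(\pi_N\xi)_i(x)\,(v_i+f(x+e_i)-f(x))^2$, with addition on the torus. *)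

theory Defs
  imports "HOL-Probability.Probability"
begin

text \<open>
  The lattice is \<open>int ^ 'd\<close> with \<open>d = CARD('d)\<close>. Every nearest neighbour bond has exactly one
  representation \<open>(x, x + e\<^sub>i)\<close>, so bonds are indexed by the pairs \<open>(x, i)\<close>, and \<open>\<xi> (x, i)\<close> is the
  value written \<open>\<xi>\<^sub>i(x)\<close>.
\<close>

type_synonym 'd env = "(int ^ 'd) \<times> 'd \<Rightarrow> real"

definition env_space :: "real \<Rightarrow> 'd::finite env set" where
  "env_space c = {\<xi>. \<forall>b. \<xi> b \<in> {1/c..c}}"

definition env_measure :: "real measure \<Rightarrow> 'd::finite env measure" where
  "env_measure \<mu>0 = Pi\<^sub>M UNIV (\<lambda>_. \<mu>0)"

definition unit_vec :: "'d::finite \<Rightarrow> int ^ 'd" where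
  "unit_vec i = axis i 1"

definition walk_generator :: "'d::finite env \<Rightarrow> (int ^ 'd \<Rightarrow> real) \<Rightarrow> int ^ 'd \<Rightarrow> real" where
  "walk_generator \<xi> f x =
     (\<Sum>i\<in>UNIV. \<xi> (x, i) * (f (x + unit_vec i) - f x)
              + \<xi> (x - unit_vec i, i) * (f (x - unit_vec i) - f x))"

text \<open>
  \<open>P t x\<close> is the law at time \<open>t\<close> of the walk started at \<open>x\<close>. For \<open>\<xi>\<close> with values in \<open>[1/c, c]\<close> the
  generator is a bounded operator on the bounded functions, so all of these belong to its domain.
\<close>

definition transition_semigroup ::
    "'d::finite env \<Rightarrow> (real \<Rightarrow> int ^ 'd \<Rightarrow> (int ^ 'd) pmf) \<Rightarrow> bool" where
  "transition_semigroup \<xi> P \<longleftrightarrow>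
     (\<forall>x. P 0 x = return_pmf x) \<and>
     (\<forall>s\<ge>0. \<forall>t\<ge>0. \<forall>x. P (s + t) x = bind_pmf (P s x) (P t)) \<and>
     (\<forall>f x. bounded (range f) \<longrightarrow>
        ((\<lambda>t. (measure_pmf.expectation (P t x) f - f x) / t) \<longlongrightarrow> walk_generator \<xi> f x)
          (at_right 0))"

definition past :: "'w measure \<Rightarrow> (real \<Rightarrow> 'w \<Rightarrow> 'a) \<Rightarrow> real \<Rightarrow> 'w measure" where
  "past M X s = sigma (space M) {X u -` B \<inter> space M | u B. 0 \<le> u \<and> u \<le> s}"

text \<open>
  A random walk in the environment \<open>\<xi>\<close> started at \<open>x\<close>: a Markov process with piecewise constant
  right-continuous paths and generator \<open>walk_generator \<xi>\<close>.
\<close>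

definition random_walk ::
    "'d::finite env \<Rightarrow> int ^ 'd \<Rightarrow> 'w measure \<Rightarrow> (real \<Rightarrow> 'w \<Rightarrow> int ^ 'd) \<Rightarrow> bool" where
  "random_walk \<xi> x M X \<longleftrightarrow>
     prob_space M \<and>
     (\<forall>t\<ge>0. X t \<in> measurable M (count_space UNIV)) \<and>
     (AE \<omega> in M. X 0 \<omega> = x) \<and>
     (AE \<omega> in M. \<forall>t\<ge>0. (\<forall>\<^sub>F s in at_right t. X s \<omega> = X t \<omega>) \<and>
                         (t > 0 \<longrightarrow> (\<exists>y. \<forall>\<^sub>F s in at_left t. X s \<omega> = y))) \<and>
     (\<exists>P. transition_semigroup \<xi> P \<and>
        (\<forall>s\<ge>0. \<forall>t\<ge>0. \<forall>f. bounded (range f) \<longrightarrow>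
           (AE \<omega> in M. real_cond_exp M (past M X s) (\<lambda>\<omega>. f (X (s + t) \<omega>)) \<omega>
                        = measure_pmf.expectation (P t (X s \<omega>)) f)))"

definition real_vec :: "int ^ 'd \<Rightarrow> real ^ 'd" where
  "real_vec x = (\<chi> i. real_of_int (x $ i))"

text \<open>
  In the following definitions \<open>(W \<xi>, X \<xi>)\<close> is the walk in the environment \<open>\<xi>\<close> started at the origin.
\<close>

definition second_moment ::
    "('d::finite env \<Rightarrow> 'w measure) \<Rightarrow> ('d env \<Rightarrow> real \<Rightarrow> 'w \<Rightarrow> int ^ 'd) \<Rightarrow>
      'd env \<Rightarrow> real \<Rightarrow> real ^ 'd \<Rightarrow> real" where
  "second_moment W X \<xi> t v = (\<integral>\<omega>. (real_vec (X \<xi> t \<omega>) \<bullet> v)\<^sup>2 \<partial>W \<xi>)"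

definition diffusion_matrix :: "(real \<Rightarrow> real ^ 'd \<Rightarrow> real) \<Rightarrow> real ^ 'd ^ 'd::finite" where
  "diffusion_matrix m =
     (THE D. transpose D = D \<and> (\<forall>v. ((\<lambda>t. 1 / t * m t v) \<longlongrightarrow> (D *v v) \<bullet> v) at_top))"

definition eff_diffusion ::
    "('d::finite env \<Rightarrow> 'w measure) \<Rightarrow> ('d env \<Rightarrow> real \<Rightarrow> 'w \<Rightarrow> int ^ 'd) \<Rightarrow>
      'd env measure \<Rightarrow> real ^ 'd ^ 'd" where
  "eff_diffusion W X \<mu> = diffusion_matrix (\<lambda>t v. \<integral>\<xi>. second_moment W X \<xi> t v \<partial>\<mu>)"

text \<open>\<open>torus_rep N x\<close> is the representative of \<open>x\<close> modulo \<open>2N\<close> in \<open>{-N, \<dots>, N-1}\<^sup>d\<close>, for \<open>N > 0\<close>.\<close>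

definition torus_rep :: "nat \<Rightarrow> int ^ 'd \<Rightarrow> int ^ 'd" where
  "torus_rep N x = (\<chi> i. (x $ i + int N) mod (2 * int N) - int N)"

definition periodize :: "nat \<Rightarrow> 'd::finite env \<Rightarrow> 'd env" where
  "periodize N \<xi> = (\<lambda>(x, i). \<xi> (torus_rep N x, i))"

definition eff_diffusion_fin ::
    "('d::finite env \<Rightarrow> 'w measure) \<Rightarrow> ('d env \<Rightarrow> real \<Rightarrow> 'w \<Rightarrow> int ^ 'd) \<Rightarrow>
      nat \<Rightarrow> 'd env \<Rightarrow> real ^ 'd ^ 'd" where
  "eff_diffusion_fin W X N \<xi> = diffusion_matrix (second_moment W X (periodize N \<xi>))"

end

theory Submission
  imports Defs
begin

text \<open>
  With \<open>q \<ge> 4dc\<close> the operator \<open>K = 1 + L/q\<close> is a Markov kernel, and it is self-adjoint with spectrum in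
  \<open>[0, 1]\<close> for every shift-invariant mean of environments: the \<open>\<mu>\<close>-expectation as well as the average
  over the translates of a periodized environment. For the drift
  \<open>V = \<Sum>\<^sub>i v\<^sub>i (\<xi>\<^sub>i(0) - \<xi>\<^sub>i(-e\<^sub>i))\<close> the numbers \<open>s\<^sub>k = \<langle>V, K\<^sup>k V\<rangle>\<close> are therefore nonnegative, decreasing
  and summable, and both diffusion matrices are \<open>2 (\<langle>\<xi> v, v\<rangle> - (1/q) \<Sum>\<^sub>k s\<^sub>k)\<close> for the respective mean.
  All \<open>K\<^sup>k V\<close> are polynomials in finitely many bond variables, so the law of large numbers gives the almost
  sure convergence of every \<open>s\<^sub>k\<close>.

  It remains to bound the tails \<open>\<Sum>\<^sub>k\<^sub>\<ge>\<^sub>2\<^sub>n s\<^sub>k\<close> uniformly in \<open>N\<close>. They equal \<open>q \<langle>K\<^sup>n V, \<psi>\<rangle>\<close> for a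
  function \<open>\<psi>\<close> with bounded gradient. Since \<open>K\<^sup>n V\<close> is the divergence of the flux \<open>j\<^sub>n\<close> of the approximate
  corrector, replacing \<open>\<psi>\<close> by its average over a cube of side \<open>R\<close> costs at most \<open>R \<parallel>K\<^sup>n V\<parallel> \<parallel>\<nabla>\<psi>\<parallel>\<close>,
  and the averaged part is at most \<open>\<parallel>avg\<^sub>R j\<^sub>n - p\<parallel> \<parallel>\<nabla>\<psi>\<parallel>\<close> for every constant \<open>p\<close>. These
  bounds again involve only local quantities, and under \<open>\<mu>\<close> they vanish along \<open>n = R\<^sup>2\<close>, because
  \<open>n s\<^sub>2\<^sub>n \<rightarrow> 0\<close> and the fluxes are \<open>L\<^sup>2\<close>-Cauchy.
\<close>

section \<open>Shift-invariant means\<close>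

text \<open>The obstacle is the order of the limits in \<open>t\<close> and \<open>N\<close>. At
  fixed \<open>N\<close> the torus walk has a spectral gap, but the bound on it degenerates as
  \<open>N\<close> grows, so it serves only to send \<open>t\<close> to infinity at fixed
  \<open>N\<close>. Uniformity in \<open>N\<close> comes from a two-sided bound: the energy of the
  trial function \<open>corrector q (drift v) 0 n\<close> exceeds the effective form by exactly
  \<open>tail v (2 * n) / q\<close>, and this excess is controlled by finitely many means of local
  polynomials. For a given precision the cutoff is chosen under \<mu>; at that cutoff only finitely
  many means have to converge. Working with powers of K keeps the range finite, which neither the
  continuous-time semigroup nor a resolvent would do. The walk returns through uniformization: up to
  time \<open>t\<close> it makes a Poisson number of lazy steps with mean \<open>q * t\<close>. The
  total jump rate is at most 2dc, so q = 2dc would already make K Markov; the further factor 2 makes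
  K positive semidefinite.\<close>

definition shift :: "int ^ 'd \<Rightarrow> 'd::finite env \<Rightarrow> 'd env" where
  "shift y \<xi> = (\<lambda>(x, i). \<xi> (x + y, i))"

lemma shift_apply [simp]: "shift y \<xi> (x, i) = \<xi> (x + y, i)"
  by (simp add: shift_def)

lemma shift_shift [simp]: "shift x (shift y \<xi>) = shift (x + y) \<xi>"
  by (auto simp: shift_def fun_eq_iff ac_simps)

lemma shift_0 [simp]: "shift 0 \<xi> = \<xi>"
  by (auto simp: shift_def fun_eq_iff)

lemma shift_env_space [simp]: "\<xi> \<in> env_space c \<Longrightarrow> shift y \<xi> \<in> env_space c"
  by (auto simp: env_space_def shift_def)

lemma env_space_bounds:
  assumes "\<xi> \<in> env_space c" "c \<ge> 1"
  shows "1 / c \<le> \<xi> b" "\<xi> b \<le> c" "0 \<le> \<xi> b"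
proof -
  show *: "1 / c \<le> \<xi> b" "\<xi> b \<le> c"
    using assms(1) unfolding env_space_def mem_Collect_eq atLeastAtMost_iff by blast+
  have "0 \<le> 1 / c" using assms(2) by simp
  then show "0 \<le> \<xi> b" using * by linarith
qed

text \<open>A common domain for both means. It is closed under shifts, \<open>gen\<close>, averages
  and powers of \<open>lazy\<close>; its members depend on finitely many bonds and are bounded on
  \<open>env_space c\<close>, so no integrability or domain question arises and a law of large
  numbers holds for each of them.\<close>

inductive_set env_poly :: "('d::finite env \<Rightarrow> real) set" where
  const [simp, intro]: "(\<lambda>_. a) \<in> env_poly"
| coord [simp, intro]: "(\<lambda>\<xi>. \<xi> b) \<in> env_poly"
| add [simp, intro]: "F \<in> env_poly \<Longrightarrow> G \<in> env_poly \<Longrightarrow> (\<lambda>\<xi>. F \<xi> + G \<xi>) \<in> env_poly"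
| mult [simp, intro]: "F \<in> env_poly \<Longrightarrow> G \<in> env_poly \<Longrightarrow> (\<lambda>\<xi>. F \<xi> * G \<xi>) \<in> env_poly"

lemma env_poly_minus [simp, intro]:
  assumes "F \<in> env_poly" shows "(\<lambda>\<xi>. - F \<xi>) \<in> env_poly"
  using env_poly.mult[OF env_poly.const[of "-1"] assms] by simp

lemma env_poly_diff [simp, intro]:
  "F \<in> env_poly \<Longrightarrow> G \<in> env_poly \<Longrightarrow> (\<lambda>\<xi>. F \<xi> - G \<xi>) \<in> env_poly"
  using env_poly.add[of F "\<lambda>\<xi>. - G \<xi>"] by simp

lemma env_poly_divide [simp, intro]:
  "F \<in> env_poly \<Longrightarrow> (\<lambda>\<xi>. F \<xi> / a) \<in> env_poly"
  using env_poly.mult[OF env_poly.const[of "1/a"], of F] by simp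

lemma env_poly_power [simp, intro]:
  "F \<in> env_poly \<Longrightarrow> (\<lambda>\<xi>. F \<xi> ^ n) \<in> env_poly"
  by (induction n) auto

lemma env_poly_sum [simp, intro]:
  "(\<And>i. i \<in> I \<Longrightarrow> F i \<in> env_poly) \<Longrightarrow> (\<lambda>\<xi>. \<Sum>i\<in>I. F i \<xi>) \<in> env_poly"
  by (induction I rule: infinite_finite_induct) auto

lemma env_poly_shift [simp, intro]:
  "F \<in> env_poly \<Longrightarrow> (\<lambda>\<xi>. F (shift y \<xi>)) \<in> env_poly"
proof (induction rule: env_poly.induct)
  case (coord b)
  show ?case by (cases b) auto
qed auto

text \<open>Since \<open>shift y\<close> is \<tau>_{-y} in the notation of the variational formula,
  this is its gradient f(\<tau>_{-e_i} \<xi>) - f(\<xi>).\<close>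

definition grad :: "'d::finite \<Rightarrow> ('d env \<Rightarrow> real) \<Rightarrow> 'd env \<Rightarrow> real" where
  "grad i F = (\<lambda>\<xi>. F (shift (unit_vec i) \<xi>) - F \<xi>)"

text \<open>Generator of the environment seen from the walker.\<close>

definition gen :: "('d::finite env \<Rightarrow> real) \<Rightarrow> 'd env \<Rightarrow> real" where
  "gen F = (\<lambda>\<xi>. \<Sum>i\<in>UNIV. \<xi> (0, i) * (F (shift (unit_vec i) \<xi>) - F \<xi>)
              + \<xi> (- unit_vec i, i) * (F (shift (- unit_vec i) \<xi>) - F \<xi>))"

definition lazy :: "real \<Rightarrow> ('d::finite env \<Rightarrow> real) \<Rightarrow> 'd env \<Rightarrow> real" where
  "lazy q F = (\<lambda>\<xi>. F \<xi> + gen F \<xi> / q)"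

lemma env_poly_grad [simp, intro]: "F \<in> env_poly \<Longrightarrow> grad i F \<in> env_poly"
  by (simp add: grad_def)

lemma env_poly_gen [simp, intro]: "F \<in> env_poly \<Longrightarrow> gen F \<in> env_poly"
  by (simp add: gen_def)

lemma env_poly_lazy [simp, intro]: "F \<in> env_poly \<Longrightarrow> lazy q F \<in> env_poly"
  by (simp add: lazy_def)

lemma env_poly_lazy_pow [simp, intro]: "F \<in> env_poly \<Longrightarrow> (lazy q ^^ n) F \<in> env_poly"
  by (induction n) auto

lemma gen_add: "gen (\<lambda>\<xi>. F \<xi> + G \<xi>) = (\<lambda>\<xi>. gen F \<xi> + gen G \<xi>)"
  by (simp add: gen_def fun_eq_iff flip: sum.distrib) (simp add: algebra_simps)

lemma gen_cmult: "gen (\<lambda>\<xi>. a * F \<xi>) = (\<lambda>\<xi>. a * gen F \<xi>)"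
  by (simp add: gen_def sum_distrib_left algebra_simps)

lemma gen_const [simp]: "gen (\<lambda>_. a) = (\<lambda>_. 0)"
  by (simp add: gen_def)

lemma gen_sum: "gen (\<lambda>\<xi>. \<Sum>k\<in>I. F k \<xi>) = (\<lambda>\<xi>. \<Sum>k\<in>I. gen (F k) \<xi>)"
  by (induction I rule: infinite_finite_induct) (auto simp: gen_add)

text \<open>Partial Neumann sum for (-L)^(-1) K^n V: as -L = q (1 - K), the inverse is formally 1/q
  times the sum of all powers of K. The case n = 0 is the approximate corrector; general n gives the
  function against which tails are tested.\<close>

definition corrector :: "real \<Rightarrow> ('d::finite env \<Rightarrow> real) \<Rightarrow> nat \<Rightarrow> nat \<Rightarrow> 'd env \<Rightarrow> real" where
  "corrector q V n m = (\<lambda>\<xi>. 1 / q * (\<Sum>k<m. (lazy q ^^ (n + k)) V \<xi>))"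

lemma env_poly_corrector [simp, intro]: "V \<in> env_poly \<Longrightarrow> corrector q V n m \<in> env_poly"
  by (simp add: corrector_def)

lemma gen_corrector:
  assumes "q \<noteq> 0"
  shows "gen (corrector q V n m) = (\<lambda>\<xi>. (lazy q ^^ (n + m)) V \<xi> - (lazy q ^^ n) V \<xi>)"
proof -
  have *: "gen F \<xi> = q * (lazy q F \<xi> - F \<xi>)" for F :: "'a env \<Rightarrow> real" and \<xi>
    using assms by (simp add: lazy_def)
  have "gen (corrector q V n m) = (\<lambda>\<xi>. \<Sum>k<m. (lazy q ^^ (n + Suc k)) V \<xi> - (lazy q ^^ (n + k)) V \<xi>)"
    unfolding corrector_def gen_cmult gen_sum *
    using assms by (simp flip: sum_distrib_left)
  also have "\<dots> = (\<lambda>\<xi>. (lazy q ^^ (n + m)) V \<xi> - (lazy q ^^ n) V \<xi>)"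
    by (subst sum_lessThan_telescope[where f = "\<lambda>k. (lazy q ^^ (n + k)) V _"]) simp
  finally show ?thesis .
qed

lemma sum_lessThan_add: "(\<Sum>k<n + m. f k) = (\<Sum>k<n. f k) + (\<Sum>k<m. f (n + k))"
  for f :: "nat \<Rightarrow> real"
  by (induction m) (auto simp: add.assoc)

definition drift :: "real ^ 'd \<Rightarrow> 'd::finite env \<Rightarrow> real" where
  "drift v = (\<lambda>\<xi>. \<Sum>i\<in>UNIV. v $ i * (\<xi> (0, i) - \<xi> (- unit_vec i, i)))"

lemma env_poly_drift [simp, intro]: "drift v \<in> env_poly"
  by (simp add: drift_def)

definition flux :: "real \<Rightarrow> real ^ 'd \<Rightarrow> nat \<Rightarrow> 'd::finite \<Rightarrow> 'd env \<Rightarrow> real" where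
  "flux q v n i = (\<lambda>\<xi>. \<xi> (0, i) * (v $ i + grad i (corrector q (drift v) 0 n) \<xi>))"

lemma env_poly_flux [simp, intro]: "flux q v n i \<in> env_poly"
  by (simp add: flux_def)

text \<open>It has two roles: as an operator it smooths test functions and fluxes, and with
  \<open>B = cube N\<close>, evaluated at a periodized environment, it is the torus mean.\<close>

definition mollify :: "(int ^ 'd) set \<Rightarrow> ('d::finite env \<Rightarrow> real) \<Rightarrow> 'd env \<Rightarrow> real" where
  "mollify B F = (\<lambda>\<xi>. 1 / card B * (\<Sum>y\<in>B. F (shift y \<xi>)))"

lemma env_poly_mollify [simp, intro]: "F \<in> env_poly \<Longrightarrow> mollify B F \<in> env_poly"
  by (simp add: mollify_def)

text \<open>The properties shared by the \<mu>-expectation and the torus average, stated on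
  \<open>env_poly\<close> only. Positivity is tested on \<open>env_space c\<close>, where
  ellipticity holds. The resulting inner product is merely semidefinite: a torus average sees a
  single orbit.\<close>

locale stationary_mean =
  fixes c q :: real and E :: "('d::finite env \<Rightarrow> real) \<Rightarrow> real"
  assumes c_ge_1: "c \<ge> 1"
    and q_ge: "q \<ge> 4 * real CARD('d) * c"
    and E_add: "F \<in> env_poly \<Longrightarrow> G \<in> env_poly \<Longrightarrow> E (\<lambda>\<xi>. F \<xi> + G \<xi>) = E F + E G"
    and E_cmult: "F \<in> env_poly \<Longrightarrow> E (\<lambda>\<xi>. a * F \<xi>) = a * E F"
    and E_one: "E (\<lambda>_. 1) = 1"
    and E_nonneg: "F \<in> env_poly \<Longrightarrow> (\<And>\<xi>. \<xi> \<in> env_space c \<Longrightarrow> 0 \<le> F \<xi>) \<Longrightarrow> 0 \<le> E F"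
    and E_shift: "F \<in> env_poly \<Longrightarrow> E (\<lambda>\<xi>. F (shift y \<xi>)) = E F"
begin

lemma q_pos: "q > 0"
proof -
  have "0 < 4 * real CARD('d) * c" using c_ge_1 by simp
  then show ?thesis using q_ge by linarith
qed

lemma E_const [simp]: "E (\<lambda>_. a) = a"
  using E_cmult[of "\<lambda>_. 1" a] E_one by simp

lemma E_minus: "F \<in> env_poly \<Longrightarrow> E (\<lambda>\<xi>. - F \<xi>) = - E F"
  using E_cmult[of F "-1"] by simp

lemma E_diff: "F \<in> env_poly \<Longrightarrow> G \<in> env_poly \<Longrightarrow> E (\<lambda>\<xi>. F \<xi> - G \<xi>) = E F - E G"
  using E_add[of F "\<lambda>\<xi>. - G \<xi>"] by (simp add: E_minus)

lemma E_divide: "F \<in> env_poly \<Longrightarrow> E (\<lambda>\<xi>. F \<xi> / a) = E F / a"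
  using E_cmult[of F "1 / a"] by simp

lemma E_sum: "(\<And>i. i \<in> I \<Longrightarrow> F i \<in> env_poly) \<Longrightarrow> E (\<lambda>\<xi>. \<Sum>i\<in>I. F i \<xi>) = (\<Sum>i\<in>I. E (F i))"
  by (induction I rule: infinite_finite_induct) (auto simp: E_add)

lemma E_mono:
  assumes "F \<in> env_poly" "G \<in> env_poly" "\<And>\<xi>. \<xi> \<in> env_space c \<Longrightarrow> F \<xi> \<le> G \<xi>"
  shows "E F \<le> E G"
  using E_nonneg[of "\<lambda>\<xi>. G \<xi> - F \<xi>"] assms by (simp add: E_diff)

lemma E_square_nonneg: "F \<in> env_poly \<Longrightarrow> 0 \<le> E (\<lambda>\<xi>. (F \<xi>)\<^sup>2)"
  by (rule E_nonneg) auto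

lemma env_bounds: "\<xi> \<in> env_space c \<Longrightarrow> 1 / c \<le> \<xi> b \<and> \<xi> b \<le> c \<and> 0 \<le> \<xi> b"
  using env_space_bounds c_ge_1 by blast

lemma E_Cauchy_Schwarz:
  assumes [simp]: "F \<in> env_poly" "G \<in> env_poly"
  shows "\<bar>E (\<lambda>\<xi>. F \<xi> * G \<xi>)\<bar> \<le> sqrt (E (\<lambda>\<xi>. (F \<xi>)\<^sup>2)) * sqrt (E (\<lambda>\<xi>. (G \<xi>)\<^sup>2))"
proof -
  define f g h where "f = E (\<lambda>\<xi>. (F \<xi>)\<^sup>2)" and "g = E (\<lambda>\<xi>. (G \<xi>)\<^sup>2)" and "h = E (\<lambda>\<xi>. F \<xi> * G \<xi>)"
  have nn: "f \<ge> 0" "g \<ge> 0" by (simp_all add: f_def g_def E_square_nonneg)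
  have quad: "0 \<le> f + 2 * t * h + t\<^sup>2 * g" for t
  proof -
    have "0 \<le> E (\<lambda>\<xi>. (F \<xi> + t * G \<xi>)\<^sup>2)" by (simp add: E_square_nonneg)
    also have "(\<lambda>\<xi>. (F \<xi> + t * G \<xi>)\<^sup>2) = (\<lambda>\<xi>. (F \<xi>)\<^sup>2 + ((2 * t) * (F \<xi> * G \<xi>) + t\<^sup>2 * (G \<xi>)\<^sup>2))"
      by (simp add: power2_eq_square algebra_simps)
    also have "E \<dots> = f + 2 * t * h + t\<^sup>2 * g"
      by (simp add: E_add E_cmult f_def g_def h_def del: mult.assoc)
    finally show ?thesis .
  qed
  have "h\<^sup>2 \<le> f * g"
  \<comment> \<open>For \<open>g = 0\<close> the quadratic in \<open>t\<close> is affine and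
    nonnegative, hence constant: with \<open>h\<close> nonzero the witness below would give it the
    value -1. Otherwise its minimizer \<open>- h / g\<close> yields the discriminant bound.\<close>
  proof (cases "g = 0")
    case True
    have "h = 0"
    proof (rule ccontr)
      assume "h \<noteq> 0"
      then show False using quad[of "- (f + 1) / (2 * h)"] True nn by (simp add: field_simps)
    qed
    then show ?thesis using True by simp
  next
    case False
    then show ?thesis using quad[of "- h / g"] nn
      by (simp add: field_simps power2_eq_square)
  qed
  then have "\<bar>h\<bar> \<le> sqrt (f * g)"
    by (simp add: real_le_rsqrt)
  then show ?thesis by (simp add: f_def g_def h_def real_sqrt_mult)
qed

section \<open>The Dirichlet form and the spectrum of the lazy kernel\<close>

definition Dir :: "('d env \<Rightarrow> real) \<Rightarrow> ('d env \<Rightarrow> real) \<Rightarrow> real" where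
  "Dir F G = (\<Sum>i\<in>UNIV. E (\<lambda>\<xi>. \<xi> (0, i) * grad i F \<xi> * grad i G \<xi>))"

lemma Dir_commute: "Dir F G = Dir G F"
  by (simp add: Dir_def mult.assoc) (simp add: mult.commute)

lemma Dir_nonneg: "F \<in> env_poly \<Longrightarrow> 0 \<le> Dir F F"
  unfolding Dir_def by (intro sum_nonneg E_nonneg) (auto simp: mult.assoc env_bounds)

text \<open>Summation by parts. Shifting the backward jump by e_i moves it to the forward bond,
  where it combines with the forward jump into a product of two gradients. This is reversibility: a
  bond has the same rate in both directions.\<close>

lemma E_mult_gen:
  assumes [simp]: "F \<in> env_poly" "G \<in> env_poly"
  shows "E (\<lambda>\<xi>. F \<xi> * gen G \<xi>) = - Dir F G"
proof -
  have "E (\<lambda>\<xi>. F \<xi> * gen G \<xi>) =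
      E (\<lambda>\<xi>. \<Sum>i\<in>UNIV. F \<xi> * \<xi> (0, i) * grad i G \<xi>
              + F \<xi> * \<xi> (- unit_vec i, i) * (G (shift (- unit_vec i) \<xi>) - G \<xi>))"
    by (simp add: gen_def grad_def sum_distrib_left algebra_simps)
  also have "\<dots> = (\<Sum>i\<in>UNIV. E (\<lambda>\<xi>. F \<xi> * \<xi> (0, i) * grad i G \<xi>)
      + E (\<lambda>\<xi>. F \<xi> * \<xi> (- unit_vec i, i) * (G (shift (- unit_vec i) \<xi>) - G \<xi>)))"
    by (simp add: E_sum E_add)
  also have "\<dots> = (\<Sum>i\<in>UNIV. - E (\<lambda>\<xi>. \<xi> (0, i) * grad i F \<xi> * grad i G \<xi>))"
  proof (rule sum.cong[OF refl])
    fix i :: 'd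
    have "E (\<lambda>\<xi>. F \<xi> * \<xi> (- unit_vec i, i) * (G (shift (- unit_vec i) \<xi>) - G \<xi>))
        = E (\<lambda>\<xi>. F (shift (unit_vec i) \<xi>) * \<xi> (0, i) * - grad i G \<xi>)"
      by (subst E_shift[of _ "unit_vec i", symmetric]) (simp_all add: grad_def)
    then have "E (\<lambda>\<xi>. F \<xi> * \<xi> (0, i) * grad i G \<xi>)
      + E (\<lambda>\<xi>. F \<xi> * \<xi> (- unit_vec i, i) * (G (shift (- unit_vec i) \<xi>) - G \<xi>))
      = E (\<lambda>\<xi>. F \<xi> * \<xi> (0, i) * grad i G \<xi> + F (shift (unit_vec i) \<xi>) * \<xi> (0, i) * - grad i G \<xi>)"
      by (subst E_add) auto
    also have "\<dots> = E (\<lambda>\<xi>. - (\<xi> (0, i) * grad i F \<xi> * grad i G \<xi>))"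
      by (simp add: grad_def algebra_simps)
    finally show "E (\<lambda>\<xi>. F \<xi> * \<xi> (0, i) * grad i G \<xi>)
      + E (\<lambda>\<xi>. F \<xi> * \<xi> (- unit_vec i, i) * (G (shift (- unit_vec i) \<xi>) - G \<xi>))
      = - E (\<lambda>\<xi>. \<xi> (0, i) * grad i F \<xi> * grad i G \<xi>)"
      by (simp add: E_minus)
  qed
  finally show ?thesis by (simp add: Dir_def sum_negf)
qed

lemma E_gen: "F \<in> env_poly \<Longrightarrow> E (gen F) = 0"
  using E_mult_gen[of "\<lambda>_. 1" F] by (simp add: Dir_def grad_def)

lemma E_lazy: "F \<in> env_poly \<Longrightarrow> E (lazy q F) = E F"
  by (simp add: lazy_def E_add E_divide E_gen)

lemma E_lazy_pow: "F \<in> env_poly \<Longrightarrow> E ((lazy q ^^ n) F) = E F"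
  by (induction n) (auto simp: E_lazy)

text \<open>The origin of 4dc. Cauchy-Schwarz over the 2d neighbours gives 2d, the bound
  \<open>\<xi> b \<le> c\<close> gives c, and shift invariance identifies backward with forward
  energies, which doubles the sum. In spectral terms -L lies between 0 and q.\<close>

lemma E_gen_squared_le:
  assumes [simp]: "F \<in> env_poly"
  shows "E (\<lambda>\<xi>. (gen F \<xi>)\<^sup>2) \<le> q * Dir F F"
proof -
  let ?b = "\<lambda>i \<xi>. \<xi> (- unit_vec i, i) * (F (shift (- unit_vec i) \<xi>) - F \<xi>)\<^sup>2"
  let ?a = "\<lambda>i \<xi>. \<xi> (0, i) * (grad i F \<xi>)\<^sup>2"
  let ?C = "2 * real CARD('d) * c"
  have "(gen F \<xi>)\<^sup>2 \<le> ?C * (\<Sum>i\<in>UNIV. ?a i \<xi> + ?b i \<xi>)" if \<xi>: "\<xi> \<in> env_space c" for \<xi>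
  proof -
    have sq: "(\<xi> b * d)\<^sup>2 \<le> c * (\<xi> b * d\<^sup>2)" for b d
    proof -
      have "\<xi> b * (\<xi> b * d\<^sup>2) \<le> c * (\<xi> b * d\<^sup>2)"
        using env_bounds[OF \<xi>, of b] by (intro mult_right_mono) auto
      then show ?thesis by (simp add: power2_eq_square ac_simps)
    qed
    have "(gen F \<xi>)\<^sup>2 \<le> real CARD('d) *
        (\<Sum>i\<in>UNIV. (\<xi> (0, i) * grad i F \<xi> + \<xi> (- unit_vec i, i) * (F (shift (- unit_vec i) \<xi>) - F \<xi>))\<^sup>2)"
      unfolding gen_def grad_def
      using sum_squared_le_sum_of_squares[of "\<lambda>i. \<xi> (0, i) * (F (shift (unit_vec i) \<xi>) - F \<xi>) + \<xi> (- unit_vec i, i) * (F (shift (- unit_vec i) \<xi>) - F \<xi>)" UNIV]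
      by (simp add: mult.commute)
    also have "\<dots> \<le> real CARD('d) * (\<Sum>i\<in>UNIV. 2 * (c * ?a i \<xi>) + 2 * (c * ?b i \<xi>))"
    proof (intro mult_left_mono sum_mono)
      fix i :: 'd
      let ?x = "\<xi> (0, i) * grad i F \<xi>" and ?y = "\<xi> (- unit_vec i, i) * (F (shift (- unit_vec i) \<xi>) - F \<xi>)"
      have "(?x + ?y)\<^sup>2 \<le> 2 * ?x\<^sup>2 + 2 * ?y\<^sup>2"
        using zero_le_power2[of "?x - ?y"] by (simp add: power2_sum power2_diff)
      then show "(?x + ?y)\<^sup>2 \<le> 2 * (c * ?a i \<xi>) + 2 * (c * ?b i \<xi>)"
        using sq[of "(0, i)" "grad i F \<xi>"] sq[of "(- unit_vec i, i)" "F (shift (- unit_vec i) \<xi>) - F \<xi>"]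
        by linarith
    qed auto
    also have "\<dots> = ?C * (\<Sum>i\<in>UNIV. ?a i \<xi> + ?b i \<xi>)"
      by (simp add: sum_distrib_left algebra_simps)
    finally show ?thesis .
  qed
  then have "E (\<lambda>\<xi>. (gen F \<xi>)\<^sup>2) \<le> E (\<lambda>\<xi>. ?C * (\<Sum>i\<in>UNIV. ?a i \<xi> + ?b i \<xi>))"
    by (intro E_mono) auto
  also have "\<dots> = ?C * (\<Sum>i\<in>UNIV. E (?a i) + E (?b i))"
    by (subst E_cmult; simp add: E_sum E_add)
  also have "(\<Sum>i\<in>UNIV. E (?a i) + E (?b i)) = (\<Sum>i\<in>UNIV. 2 * E (?a i))"
  proof (rule sum.cong[OF refl])
    fix i :: 'd
    have "E (?b i) = E (?a i)"
      by (subst E_shift[of _ "unit_vec i", symmetric])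
         (simp_all add: grad_def power2_commute)
    then show "E (?a i) + E (?b i) = 2 * E (?a i)" by simp
  qed
  also have "\<dots> = 2 * Dir F F"
    by (simp add: Dir_def sum_distrib_left power2_eq_square mult.assoc)
  also have "?C * (2 * Dir F F) \<le> q * Dir F F"
    using mult_right_mono[OF q_ge Dir_nonneg[of F]] by (simp add: mult.assoc)
  finally show ?thesis .
qed

lemma E_mult_lazy:
  "F \<in> env_poly \<Longrightarrow> G \<in> env_poly \<Longrightarrow> E (\<lambda>\<xi>. F \<xi> * lazy q G \<xi>) = E (\<lambda>\<xi>. F \<xi> * G \<xi>) - Dir F G / q"
  by (simp add: lazy_def distrib_left E_add E_divide E_mult_gen)

lemma E_lazy_commute:
  assumes [simp]: "F \<in> env_poly" "G \<in> env_poly"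
  shows "E (\<lambda>\<xi>. lazy q F \<xi> * G \<xi>) = E (\<lambda>\<xi>. F \<xi> * lazy q G \<xi>)"
  using E_mult_lazy[of F G] E_mult_lazy[of G F] by (simp add: Dir_commute mult.commute)

definition corr :: "('d env \<Rightarrow> real) \<Rightarrow> nat \<Rightarrow> real" where
  "corr F k = E (\<lambda>\<xi>. F \<xi> * (lazy q ^^ k) F \<xi>)"

text \<open>Self-adjointness moves powers of K from one factor to the other.\<close>

lemma E_lazy_pow_mult:
  assumes [simp]: "F \<in> env_poly"
  shows "E (\<lambda>\<xi>. (lazy q ^^ j) F \<xi> * (lazy q ^^ k) F \<xi>) = corr F (j + k)"
proof (induction j arbitrary: k)
  case (Suc j)
  then show ?case
    using E_lazy_commute[of "(lazy q ^^ j) F" "(lazy q ^^ k) F"] Suc[of "Suc k"] by simp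
qed (simp add: corr_def)

text \<open>The operator inequality K^2 \<le> K, which expresses that the spectrum of K lies in
  [0, 1]. It follows from K^2 - K = L/q + L^2/q^2 and the preceding bound on L^2.\<close>

lemma E_lazy_squared_le:
  assumes [simp]: "F \<in> env_poly"
  shows "E (\<lambda>\<xi>. (lazy q F \<xi>)\<^sup>2) \<le> E (\<lambda>\<xi>. F \<xi> * lazy q F \<xi>)"
proof -
  have "E (\<lambda>\<xi>. (lazy q F \<xi>)\<^sup>2) = E (\<lambda>\<xi>. F \<xi> * lazy q F \<xi> + (F \<xi> * gen F \<xi> / q + (gen F \<xi>)\<^sup>2 / q\<^sup>2))"
    by (rule arg_cong[where f = E]) (simp add: lazy_def fun_eq_iff power2_eq_square algebra_simps add_divide_distrib)
  also have "\<dots> = E (\<lambda>\<xi>. F \<xi> * lazy q F \<xi>) + (- Dir F F / q + E (\<lambda>\<xi>. (gen F \<xi>)\<^sup>2) / q\<^sup>2)"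
    by (simp add: E_add E_divide E_mult_gen)
  also have "E (\<lambda>\<xi>. (gen F \<xi>)\<^sup>2) / q\<^sup>2 \<le> q * Dir F F / q\<^sup>2"
    by (intro divide_right_mono E_gen_squared_le) auto
  also have "\<dots> = Dir F F / q" using q_pos by (simp add: power2_eq_square)
  finally show ?thesis by simp
qed

lemma corr_even_nonneg: "F \<in> env_poly \<Longrightarrow> 0 \<le> corr F (2 * k)"
  using E_square_nonneg[of "(lazy q ^^ k) F"]
  by (simp add: power2_eq_square E_lazy_pow_mult mult_2)

text \<open>Splitting the power evenly between the two factors reduces even \<open>k\<close> to K
  \<le> 1, that is to nonnegativity of \<open>Dir\<close>, and odd \<open>k\<close> to K^2 \<le>
  K.\<close>

lemma corr_Suc_le:
  assumes [simp]: "F \<in> env_poly"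
  shows "corr F (Suc k) \<le> corr F k"
proof (cases "even k")
  case True
  then obtain j where k: "k = j + j" by (auto elim!: evenE simp: mult_2)
  have "E (\<lambda>\<xi>. (lazy q ^^ j) F \<xi> * (lazy q ^^ Suc j) F \<xi>) \<le> E (\<lambda>\<xi>. (lazy q ^^ j) F \<xi> * (lazy q ^^ j) F \<xi>)"
    using E_mult_lazy[of "(lazy q ^^ j) F" "(lazy q ^^ j) F"] Dir_nonneg[of "(lazy q ^^ j) F"] q_pos
    by simp
  then show ?thesis unfolding E_lazy_pow_mult[OF assms] by (simp add: k)
next
  case False
  then obtain j where k: "k = Suc (j + j)" by (auto elim!: oddE simp: mult_2)
  have "E (\<lambda>\<xi>. (lazy q ^^ Suc j) F \<xi> * (lazy q ^^ Suc j) F \<xi>) \<le> E (\<lambda>\<xi>. (lazy q ^^ j) F \<xi> * (lazy q ^^ Suc j) F \<xi>)"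
    using E_lazy_squared_le[of "(lazy q ^^ j) F"] by (simp add: power2_eq_square)
  then show ?thesis unfolding E_lazy_pow_mult[OF assms] by (simp add: k)
qed

lemma corr_antimono: "F \<in> env_poly \<Longrightarrow> j \<le> k \<Longrightarrow> corr F k \<le> corr F j"
  using lift_Suc_antimono_le[of "corr F"] corr_Suc_le by blast

text \<open>Correlations of even order are squares, and each one dominates a later one of even
  order.\<close>

lemma corr_nonneg: "F \<in> env_poly \<Longrightarrow> 0 \<le> corr F k"
  using corr_even_nonneg[of F k] corr_antimono[of F k "2 * k"] by simp

text \<open>The drift is the divergence of the field \<open>\<xi> (0, i) * v $ i\<close>; the shift
  by e_i is the same as in the summation by parts for \<open>gen\<close>.\<close>

lemma E_mult_drift:
  assumes [simp]: "F \<in> env_poly"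
  shows "E (\<lambda>\<xi>. F \<xi> * drift v \<xi>) = - (\<Sum>i\<in>UNIV. E (\<lambda>\<xi>. \<xi> (0, i) * v $ i * grad i F \<xi>))"
proof -
  have "E (\<lambda>\<xi>. F \<xi> * drift v \<xi>) = (\<Sum>i\<in>UNIV. v $ i * (E (\<lambda>\<xi>. F \<xi> * \<xi> (0, i)) - E (\<lambda>\<xi>. F \<xi> * \<xi> (- unit_vec i, i))))"
    by (subst E_diff[symmetric], simp_all, subst E_cmult[symmetric], simp_all, subst E_sum[symmetric], simp_all)
       (simp add: drift_def sum_distrib_left algebra_simps)
  also have "\<dots> = (\<Sum>i\<in>UNIV. - E (\<lambda>\<xi>. \<xi> (0, i) * v $ i * grad i F \<xi>))"
  proof (rule sum.cong[OF refl])
    fix i :: 'd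
    have "E (\<lambda>\<xi>. F \<xi> * \<xi> (- unit_vec i, i)) = E (\<lambda>\<xi>. F (shift (unit_vec i) \<xi>) * \<xi> (0, i))"
      by (subst E_shift[of _ "unit_vec i", symmetric]) simp_all
    then show "v $ i * (E (\<lambda>\<xi>. F \<xi> * \<xi> (0, i)) - E (\<lambda>\<xi>. F \<xi> * \<xi> (- unit_vec i, i)))
        = - E (\<lambda>\<xi>. \<xi> (0, i) * v $ i * grad i F \<xi>)"
      by (simp add: E_diff[symmetric] E_minus[symmetric] E_cmult[symmetric] grad_def algebra_simps)
  qed
  finally show ?thesis by (simp add: sum_negf)
qed

lemma E_corrector_mult:
  assumes [simp]: "V \<in> env_poly"
  shows "E (\<lambda>\<xi>. corrector q V n m \<xi> * (lazy q ^^ j) V \<xi>) = 1 / q * (\<Sum>k<m. corr V (n + k + j))"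
proof -
  have "E (\<lambda>\<xi>. corrector q V n m \<xi> * (lazy q ^^ j) V \<xi>)
      = E (\<lambda>\<xi>. 1 / q * (\<Sum>k<m. (lazy q ^^ (n + k)) V \<xi> * (lazy q ^^ j) V \<xi>))"
    by (simp add: corrector_def sum_distrib_right)
  also have "\<dots> = 1 / q * (\<Sum>k<m. corr V (n + k + j))"
    by (subst E_cmult; simp add: E_sum E_lazy_pow_mult)
  finally show ?thesis .
qed

text \<open>\<open>Dir\<close> is -L tested against the function itself, and L applied to the
  Neumann sum telescopes to two powers of K.\<close>

lemma Dir_corrector:
  assumes [simp]: "V \<in> env_poly"
  shows "Dir (corrector q V n m) (corrector q V n m)
      = 1 / q * (\<Sum>k<m. corr V (2 * n + k) - corr V (2 * n + m + k))"
proof -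
  let ?\<psi> = "corrector q V n m"
  have "Dir ?\<psi> ?\<psi> = - E (\<lambda>\<xi>. ?\<psi> \<xi> * (lazy q ^^ (n + m)) V \<xi> - ?\<psi> \<xi> * (lazy q ^^ n) V \<xi>)"
    using E_mult_gen[of ?\<psi> ?\<psi>] q_pos by (simp add: gen_corrector right_diff_distrib)
  also have "\<dots> = 1 / q * ((\<Sum>k<m. corr V (n + k + n)) - (\<Sum>k<m. corr V (n + k + (n + m))))"
    by (subst E_diff; simp add: E_corrector_mult right_diff_distrib)
  finally show ?thesis
    unfolding sum_subtractf mult_2 by (simp add: ac_simps)
qed

section \<open>Green-Kubo sums and energies of trial functions\<close>

definition drift_corr :: "real ^ 'd \<Rightarrow> nat \<Rightarrow> real" where
  "drift_corr v = corr (drift v)"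

definition mean_energy :: "real ^ 'd \<Rightarrow> real" where
  "mean_energy v = (\<Sum>i\<in>UNIV. (v $ i)\<^sup>2 * E (\<lambda>\<xi>. \<xi> (0, i)))"

definition energy :: "real ^ 'd \<Rightarrow> nat \<Rightarrow> real" where
  "energy v n = (\<Sum>i\<in>UNIV. E (\<lambda>\<xi>. \<xi> (0, i) * (v $ i + grad i (corrector q (drift v) 0 n) \<xi>)\<^sup>2))"

lemma energy_nonneg: "0 \<le> energy v n"
  unfolding energy_def by (intro sum_nonneg E_nonneg) (auto simp: env_bounds)

text \<open>A corrector with \<open>n\<close> terms reaches \<open>2 * n\<close> correlations: the
  cross term removes the first \<open>n\<close> of them twice, and the Dirichlet term restores them
  once while removing the next \<open>n\<close>.\<close>

lemma energy_eq: "energy v n = mean_energy v - 1 / q * (\<Sum>k<2 * n. drift_corr v k)"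
proof -
  let ?\<phi> = "corrector q (drift v) 0 n"
  have "energy v n = (\<Sum>i\<in>UNIV. E (\<lambda>\<xi>. (v $ i)\<^sup>2 * \<xi> (0, i)
      + (2 * (\<xi> (0, i) * v $ i * grad i ?\<phi> \<xi>) + \<xi> (0, i) * grad i ?\<phi> \<xi> * grad i ?\<phi> \<xi>)))"
    unfolding energy_def by (intro sum.cong arg_cong[where f = E]) (auto simp: power2_eq_square algebra_simps)
  also have "\<dots> = (\<Sum>i\<in>UNIV. (v $ i)\<^sup>2 * E (\<lambda>\<xi>. \<xi> (0, i))
      + (2 * E (\<lambda>\<xi>. \<xi> (0, i) * v $ i * grad i ?\<phi> \<xi>) + E (\<lambda>\<xi>. \<xi> (0, i) * grad i ?\<phi> \<xi> * grad i ?\<phi> \<xi>)))"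
    by (intro sum.cong refl, (subst E_add; simp), (subst E_add; simp), (subst E_cmult; simp), (subst E_cmult; simp))
  also have "\<dots> = mean_energy v - 2 * E (\<lambda>\<xi>. ?\<phi> \<xi> * drift v \<xi>) + Dir ?\<phi> ?\<phi>"
    by (simp add: sum.distrib mean_energy_def Dir_def E_mult_drift flip: sum_distrib_left)
  also have "\<dots> = mean_energy v - 1 / q * ((\<Sum>k<n. drift_corr v k) + (\<Sum>k<n. drift_corr v (n + k)))"
    using E_corrector_mult[of "drift v" 0 n 0]
    by (simp add: Dir_corrector sum_subtractf drift_corr_def diff_divide_distrib add_divide_distrib)
  also have "(\<Sum>k<n. drift_corr v k) + (\<Sum>k<n. drift_corr v (n + k)) = (\<Sum>k<n + n. drift_corr v k)"
    by (rule sum_lessThan_add[symmetric])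
  finally show ?thesis by (simp add: mult_2)
qed

lemma drift_corr_nonneg: "0 \<le> drift_corr v k"
  by (simp add: drift_corr_def corr_nonneg)

text \<open>Summability of the correlations comes from nonnegativity of the trial energies. Passing
  to \<open>2 * n\<close> terms matches the even number of terms in the energy formula.\<close>

lemma sum_drift_corr_le: "(\<Sum>k<n. drift_corr v k) \<le> q * mean_energy v"
proof -
  have "(\<Sum>k<n. drift_corr v k) \<le> (\<Sum>k<2 * n. drift_corr v k)"
    by (intro sum_mono2) (auto simp: drift_corr_nonneg)
  also have "\<dots> \<le> q * mean_energy v"
    using energy_nonneg[of v n] q_pos by (simp add: energy_eq field_simps)
  finally show ?thesis .
qed

lemma summable_drift_corr: "summable (drift_corr v)"
  by (rule summableI_nonneg_bounded[OF drift_corr_nonneg sum_drift_corr_le])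

text \<open>Half of the diffusion form in direction \<open>v\<close>, given by the Green-Kubo
  formula.\<close>

definition eff :: "real ^ 'd \<Rightarrow> real" where
  "eff v = mean_energy v - 1 / q * suminf (drift_corr v)"

definition tail :: "real ^ 'd \<Rightarrow> nat \<Rightarrow> real" where
  "tail v n = (\<Sum>k. drift_corr v (k + n))"

lemma tail_nonneg: "0 \<le> tail v n"
  unfolding tail_def
  by (intro suminf_nonneg) (auto simp: drift_corr_nonneg summable_drift_corr summable_ignore_initial_segment)

lemma sum_le_tail: "(\<Sum>k<m. drift_corr v (n + k)) \<le> tail v n"
  unfolding tail_def
  by (simp add: add.commute[of n], rule sum_le_suminf)
     (auto simp: drift_corr_nonneg summable_drift_corr summable_ignore_initial_segment)

text \<open>The excess of a trial energy over the effective form is a tail of the correlation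
  series, so an upper bound on the tail is a lower bound on \<open>eff\<close>.\<close>

lemma energy_eff: "energy v n = eff v + 1 / q * tail v (2 * n)"
  using suminf_split_initial_segment[OF summable_drift_corr[of v], of "2 * n"]
  by (simp add: energy_eq eff_def tail_def algebra_simps add_divide_distrib)

lemma tail_tendsto_0: "tail v \<longlonglongrightarrow> 0"
  unfolding tail_def[abs_def] by (rule suminf_exist_split2[OF summable_drift_corr])

lemma tail_le: "tail v n \<le> q * mean_energy v"
proof -
  have "(\<Sum>k. drift_corr v (k + n)) \<le> suminf (drift_corr v)"
    using suminf_split_initial_segment[OF summable_drift_corr[of v], of n]
      sum_nonneg[of "{..<n}" "drift_corr v"] by (simp add: drift_corr_nonneg)
  also have "\<dots> \<le> q * mean_energy v"
    by (rule suminf_le_const[OF summable_drift_corr sum_drift_corr_le])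
  finally show ?thesis by (simp add: tail_def)
qed

text \<open>By monotonicity each of the \<open>n\<close> terms with index in [n, 2n) is at least the
  one at \<open>2 * n\<close>. This improves decay of the correlations to decay faster than
  1/n.\<close>

lemma n_drift_corr_le_tail: "real n * drift_corr v (2 * n) \<le> tail v n"
proof -
  have "real n * drift_corr v (2 * n) = (\<Sum>k<n. drift_corr v (2 * n))" by simp
  also have "\<dots> \<le> (\<Sum>k<n. drift_corr v (n + k))"
    by (intro sum_mono) (auto simp: drift_corr_def intro!: corr_antimono)
  finally show ?thesis using sum_le_tail[of v n n] by linarith
qed

text \<open>The bound does not depend on \<open>m\<close>, so test functions reaching arbitrarily
  far into the series have uniformly bounded gradients.\<close>

lemma Dir_corrector_le_tail:
  "Dir (corrector q (drift v) n m) (corrector q (drift v) n m) \<le> 1 / q * tail v (2 * n)"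
proof -
  have "(\<Sum>k<m. drift_corr v (2 * n + k) - drift_corr v (2 * n + m + k)) \<le> (\<Sum>k<m. drift_corr v (2 * n + k))"
    by (intro sum_mono) (simp add: drift_corr_nonneg)
  then have "1 / q * (\<Sum>k<m. drift_corr v (2 * n + k) - drift_corr v (2 * n + m + k)) \<le> 1 / q * tail v (2 * n)"
    using sum_le_tail[of v "2 * n" m] q_pos by (intro mult_left_mono) auto
  then show ?thesis by (simp add: Dir_corrector drift_corr_def)
qed

section \<open>Norms, increments and spatial averages\<close>

definition nrm :: "('d env \<Rightarrow> real) \<Rightarrow> real" where
  "nrm F = sqrt (E (\<lambda>\<xi>. (F \<xi>)\<^sup>2))"

lemma nrm_nonneg [simp]: "F \<in> env_poly \<Longrightarrow> 0 \<le> nrm F"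
  by (simp add: nrm_def E_square_nonneg)

lemma nrm_square: "F \<in> env_poly \<Longrightarrow> (nrm F)\<^sup>2 = E (\<lambda>\<xi>. (F \<xi>)\<^sup>2)"
  by (simp add: nrm_def E_square_nonneg)

lemma E_mult_le_nrm: "F \<in> env_poly \<Longrightarrow> G \<in> env_poly \<Longrightarrow> \<bar>E (\<lambda>\<xi>. F \<xi> * G \<xi>)\<bar> \<le> nrm F * nrm G"
  unfolding nrm_def by (rule E_Cauchy_Schwarz)

lemma nrm_add_le:
  assumes [simp]: "F \<in> env_poly" "G \<in> env_poly"
  shows "nrm (\<lambda>\<xi>. F \<xi> + G \<xi>) \<le> nrm F + nrm G"
proof (rule power2_le_imp_le)
  have "(nrm (\<lambda>\<xi>. F \<xi> + G \<xi>))\<^sup>2 = E (\<lambda>\<xi>. (F \<xi>)\<^sup>2 + (2 * (F \<xi> * G \<xi>) + (G \<xi>)\<^sup>2))"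
    by (simp add: nrm_square power2_sum algebra_simps)
  also have "\<dots> = (nrm F)\<^sup>2 + (2 * E (\<lambda>\<xi>. F \<xi> * G \<xi>) + (nrm G)\<^sup>2)"
    by (subst E_add, simp, simp, subst E_add, simp, simp, subst E_cmult) (simp_all add: nrm_square)
  also have "\<dots> \<le> (nrm F + nrm G)\<^sup>2"
    using E_mult_le_nrm[of F G] by (simp add: power2_sum)
  finally show "(nrm (\<lambda>\<xi>. F \<xi> + G \<xi>))\<^sup>2 \<le> (nrm F + nrm G)\<^sup>2" .
qed simp

lemma nrm_cmult: "F \<in> env_poly \<Longrightarrow> nrm (\<lambda>\<xi>. a * F \<xi>) = \<bar>a\<bar> * nrm F"
  by (simp add: nrm_def power_mult_distrib E_cmult real_sqrt_mult)

lemma nrm_shift: "F \<in> env_poly \<Longrightarrow> nrm (\<lambda>\<xi>. F (shift y \<xi>)) = nrm F"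
  using E_shift[of "\<lambda>\<xi>. (F \<xi>)\<^sup>2" y] by (simp add: nrm_def)

lemma nrm_sum_le:
  "(\<And>i. i \<in> I \<Longrightarrow> F i \<in> env_poly) \<Longrightarrow> nrm (\<lambda>\<xi>. \<Sum>i\<in>I. F i \<xi>) \<le> (\<Sum>i\<in>I. nrm (F i))"
proof (induction I rule: infinite_finite_induct)
  case (insert x I)
  then have "nrm (\<lambda>\<xi>. F x \<xi> + (\<Sum>i\<in>I. F i \<xi>)) \<le> nrm (F x) + nrm (\<lambda>\<xi>. \<Sum>i\<in>I. F i \<xi>)"
    by (intro nrm_add_le) auto
  then show ?case using insert by fastforce
qed (auto simp: nrm_def)

lemma nrm_mollify_le:
  assumes [simp]: "F \<in> env_poly" and "finite B" "B \<noteq> {}"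
  shows "nrm (mollify B F) \<le> nrm F"
proof -
  have "nrm (mollify B F) \<le> 1 / card B * (\<Sum>y\<in>B. nrm (\<lambda>\<xi>. F (shift y \<xi>)))"
    unfolding mollify_def by (subst nrm_cmult) (auto intro!: mult_left_mono nrm_sum_le divide_right_mono)
  also have "\<dots> = nrm F" using assms by (simp add: nrm_shift)
  finally show ?thesis .
qed

definition increment :: "('d env \<Rightarrow> real) \<Rightarrow> int ^ 'd \<Rightarrow> real" where
  "increment F y = nrm (\<lambda>\<xi>. F (shift y \<xi>) - F \<xi>)"

lemma increment_add:
  assumes [simp]: "F \<in> env_poly"
  shows "increment F (x + y) \<le> increment F x + increment F y"
proof -
  have "increment F (x + y) = nrm (\<lambda>\<xi>. (F (shift x (shift y \<xi>)) - F (shift y \<xi>)) + (F (shift y \<xi>) - F \<xi>))"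
    by (simp add: increment_def)
  also have "\<dots> \<le> nrm (\<lambda>\<xi>. (\<lambda>\<eta>. F (shift x \<eta>) - F \<eta>) (shift y \<xi>)) + nrm (\<lambda>\<xi>. F (shift y \<xi>) - F \<xi>)"
    by (intro nrm_add_le) auto
  also have "\<dots> = increment F x + increment F y"
    unfolding increment_def by (subst nrm_shift) auto
  finally show ?thesis .
qed

lemma increment_uminus:
  assumes [simp]: "F \<in> env_poly"
  shows "increment F (- y) = increment F y"
proof -
  have "increment F (- y) = nrm (\<lambda>\<xi>. (\<lambda>\<eta>. F (shift (- y) \<eta>) - F \<eta>) (shift y \<xi>))"
    unfolding increment_def by (subst nrm_shift) auto
  also have "\<dots> = nrm (\<lambda>\<xi>. (-1) * (F (shift y \<xi>) - F \<xi>))" by simp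
  also have "\<dots> = increment F y" by (subst nrm_cmult) (auto simp: increment_def)
  finally show ?thesis .
qed

text \<open>The translation by \<open>y\<close> is decomposed into unit steps along the axes.
  Increments are subadditive and even in \<open>y\<close>, so each step costs at most one gradient
  norm.\<close>

lemma increment_le:
  assumes [simp]: "F \<in> env_poly" and g: "\<And>i. nrm (grad i F) \<le> g"
  shows "increment F y \<le> (\<Sum>i\<in>UNIV. real_of_int \<bar>y $ i\<bar>) * g"
proof -
  have nat: "increment F (axis i (int k)) \<le> real k * g" for i k
  proof (induction k)
    case 0
    have "axis i (int 0) = (0 :: int ^ 'd)" by (simp add: axis_def vec_eq_iff)
    then show ?case by (simp only:) (simp add: increment_def nrm_def)
  next
    case (Suc k)
    have "axis i (int (Suc k)) = axis i (int k) + unit_vec i"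
      by (simp add: axis_def unit_vec_def vec_eq_iff)
    then have "increment F (axis i (int (Suc k))) \<le> increment F (axis i (int k)) + increment F (unit_vec i)"
      using increment_add by simp
    also have "\<dots> \<le> real k * g + g"
      using g[of i] Suc by (simp add: increment_def grad_def)
    finally show ?case by (simp add: algebra_simps)
  qed
  have int: "increment F (axis i z) \<le> real_of_int \<bar>z\<bar> * g" for i z
  proof (cases "z \<ge> 0")
    case True
    then show ?thesis using nat[of i "nat z"] by simp
  next
    case False
    have "axis i (- z) = - axis i z" by (simp add: axis_def vec_eq_iff)
    then show ?thesis using nat[of i "nat (- z)"] False increment_uminus[of F "axis i z"] by simp
  qed
  have "increment F (\<Sum>i\<in>I. axis i (y $ i)) \<le> (\<Sum>i\<in>I. real_of_int \<bar>y $ i\<bar>) * g" for I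
  proof (induction I rule: infinite_finite_induct)
    case (insert x I)
    have "increment F (\<Sum>i\<in>insert x I. axis i (y $ i)) \<le> increment F (axis x (y $ x)) + increment F (\<Sum>i\<in>I. axis i (y $ i))"
      using increment_add insert by simp
    then show ?case using insert int[of x "y $ x"] by (simp add: distrib_right)
  qed (auto simp: increment_def nrm_def)
  moreover have "(\<Sum>i\<in>UNIV. axis i (y $ i)) = y"
    by (simp add: vec_eq_iff axis_def)
  ultimately show ?thesis by metis
qed

lemma mean_energy_nonneg: "0 \<le> mean_energy v"
  unfolding mean_energy_def by (intro sum_nonneg mult_nonneg_nonneg E_nonneg) (auto simp: env_bounds)

text \<open>Here the lower ellipticity bound \<open>1 / c \<le> \<xi> b\<close> turns the weighted
  energy into a bound on the plain gradient.\<close>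

lemma nrm_grad_le:
  assumes [simp]: "F \<in> env_poly"
  shows "nrm (grad i F) \<le> sqrt (c * Dir F F)"
proof -
  have "E (\<lambda>\<xi>. (grad i F \<xi>)\<^sup>2) \<le> E (\<lambda>\<xi>. c * (\<xi> (0, i) * grad i F \<xi> * grad i F \<xi>))"
  proof (rule E_mono)
    fix \<xi> :: "'d env" assume "\<xi> \<in> env_space c"
    then have "1 \<le> c * \<xi> (0, i)" using env_bounds[of \<xi> "(0, i)"] c_ge_1 by (simp add: field_simps)
    then have "1 * (grad i F \<xi>)\<^sup>2 \<le> c * \<xi> (0, i) * (grad i F \<xi>)\<^sup>2"
      by (rule mult_right_mono) simp
    then show "(grad i F \<xi>)\<^sup>2 \<le> c * (\<xi> (0, i) * grad i F \<xi> * grad i F \<xi>)"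
      by (simp add: power2_eq_square mult.assoc)
  qed auto
  also have "\<dots> = c * E (\<lambda>\<xi>. \<xi> (0, i) * grad i F \<xi> * grad i F \<xi>)" by (subst E_cmult) auto
  also have "\<dots> \<le> c * Dir F F"
    unfolding Dir_def using c_ge_1
    by (intro mult_left_mono member_le_sum) (auto intro!: E_nonneg simp: mult.assoc env_bounds)
  finally show ?thesis by (simp add: nrm_def)
qed

text \<open>Since K^n V = V + L \<phi> for the corrector \<phi> with \<open>n\<close> terms, adding
  the weak forms of the two summands exhibits K^n V as the divergence of
  \<open>flux q v n\<close>.\<close>

lemma E_lazy_pow_drift_mult:
  assumes [simp]: "F \<in> env_poly"
  shows "E (\<lambda>\<xi>. F \<xi> * (lazy q ^^ n) (drift v) \<xi>) = - (\<Sum>i\<in>UNIV. E (\<lambda>\<xi>. flux q v n i \<xi> * grad i F \<xi>))"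
proof -
  let ?\<phi> = "corrector q (drift v) 0 n"
  have "(lazy q ^^ n) (drift v) = (\<lambda>\<xi>. drift v \<xi> + gen ?\<phi> \<xi>)"
    using q_pos by (simp add: gen_corrector)
  then have "E (\<lambda>\<xi>. F \<xi> * (lazy q ^^ n) (drift v) \<xi>) = E (\<lambda>\<xi>. F \<xi> * drift v \<xi>) + E (\<lambda>\<xi>. F \<xi> * gen ?\<phi> \<xi>)"
    by (simp add: distrib_left E_add)
  also have "\<dots> = - (\<Sum>i\<in>UNIV. E (\<lambda>\<xi>. \<xi> (0, i) * v $ i * grad i F \<xi>) + E (\<lambda>\<xi>. \<xi> (0, i) * grad i F \<xi> * grad i ?\<phi> \<xi>))"
    by (simp add: E_mult_drift E_mult_gen Dir_def sum.distrib)
  also have "\<dots> = - (\<Sum>i\<in>UNIV. E (\<lambda>\<xi>. flux q v n i \<xi> * grad i F \<xi>))"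
    by (subst E_add[symmetric]) (auto simp: flux_def algebra_simps)
  finally show ?thesis .
qed

text \<open>The adjoint of a translation is the inverse translation, so the adjoint of averaging
  over \<open>B\<close> is averaging over the reflected set.\<close>

lemma E_mult_mollify:
  assumes [simp]: "F \<in> env_poly" "G \<in> env_poly"
  shows "E (\<lambda>\<xi>. F \<xi> * mollify (uminus ` B) G \<xi>) = E (\<lambda>\<xi>. mollify B F \<xi> * G \<xi>)"
proof -
  have *: "E (\<lambda>\<xi>. F \<xi> * G (shift (- y) \<xi>)) = E (\<lambda>\<xi>. F (shift y \<xi>) * G \<xi>)" for y
    by (subst E_shift[of _ y, symmetric]) auto
  have inj: "inj_on uminus B" by auto
  have "E (\<lambda>\<xi>. F \<xi> * mollify (uminus ` B) G \<xi>) = E (\<lambda>\<xi>. 1 / card B * (\<Sum>y\<in>B. F \<xi> * G (shift (- y) \<xi>)))"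
    by (simp add: mollify_def card_image[OF inj] sum.reindex[OF inj] sum_distrib_left)
  also have "\<dots> = 1 / card B * (\<Sum>y\<in>B. E (\<lambda>\<xi>. F \<xi> * G (shift (- y) \<xi>)))"
    by (subst E_cmult) (auto simp: E_sum)
  also have "\<dots> = E (\<lambda>\<xi>. 1 / card B * (\<Sum>y\<in>B. F (shift y \<xi>) * G \<xi>))"
    unfolding * by (subst E_cmult) (auto simp: E_sum)
  finally show ?thesis by (simp add: mollify_def sum_distrib_right)
qed

lemma grad_mollify: "grad i (mollify B F) = mollify B (grad i F)"
  by (simp add: mollify_def grad_def sum_subtractf add.commute right_diff_distrib)

lemma nrm_diff_mollify_le:
  assumes [simp]: "F \<in> env_poly" and B: "finite B" "B \<noteq> {}" and le: "\<And>y. y \<in> B \<Longrightarrow> increment F y \<le> C"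
  shows "nrm (\<lambda>\<xi>. F \<xi> - mollify B F \<xi>) \<le> C"
proof -
  have "nrm (\<lambda>\<xi>. F \<xi> - mollify B F \<xi>) = nrm (\<lambda>\<xi>. (- 1 / card B) * (\<Sum>y\<in>B. F (shift y \<xi>) - F \<xi>))"
    using B by (simp add: mollify_def sum_subtractf diff_divide_distrib)
  also have "\<dots> = 1 / card B * nrm (\<lambda>\<xi>. \<Sum>y\<in>B. F (shift y \<xi>) - F \<xi>)"
    by (subst nrm_cmult) auto
  also have "\<dots> \<le> 1 / card B * (\<Sum>y\<in>B. nrm (\<lambda>\<xi>. F (shift y \<xi>) - F \<xi>))"
    by (intro mult_left_mono nrm_sum_le) auto
  also have "\<dots> \<le> 1 / card B * (\<Sum>y\<in>B. C)"
    using le by (intro mult_left_mono sum_mono) (auto simp: increment_def)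
  also have "\<dots> = C" using B by simp
  finally show ?thesis .
qed

text \<open>The estimate is made for each partial sum, where the test function is a polynomial; its
  right-hand side is free of \<open>m\<close>, so it passes to the series. Every constant
  \<open>p\<close> is allowed because gradients have mean zero. This freedom matters: the torus is
  later compared with the flux mean under \<mu> instead of its own.\<close>

lemma tail_bound:
  fixes p :: "'d \<Rightarrow> real"
  assumes B: "finite B" "B \<noteq> {}" and r: "\<And>y. y \<in> B \<Longrightarrow> (\<Sum>i\<in>UNIV. real_of_int \<bar>y $ i\<bar>) \<le> r"
  shows "1 / q * tail v (2 * n) \<le>
    (r * sqrt (drift_corr v (2 * n)) + (\<Sum>i\<in>UNIV. nrm (\<lambda>\<xi>. mollify B (flux q v n i) \<xi> - p i)))
    * sqrt (c * mean_energy v)"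
    (is "_ \<le> (r * ?s + ?J) * ?g")
proof -
  have scale: "1 / q * S \<le> X \<longleftrightarrow> S \<le> q * X" for S X
    using q_pos by (simp add: field_simps)
  have distr: "r * x * y + z * x = (r * y + z) * x" for x y z :: real
    by (simp add: algebra_simps)
  have r0: "0 \<le> r"
    using B r by (metis (no_types, lifting) abs_ge_zero ex_in_conv of_int_0_le_iff order_trans sum_nonneg)
  have "1 / q * (\<Sum>k<m. drift_corr v (k + 2 * n)) \<le> (r * ?s + ?J) * ?g" for m
  proof -
    let ?\<psi> = "corrector q (drift v) n m" and ?V = "(lazy q ^^ n) (drift v)"
    \<comment> \<open>The reflected set is chosen so that the adjoint average, which falls on the
      flux, is over \<open>B\<close> itself.\<close>
    let ?m = "mollify (uminus ` B) ?\<psi>"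
    have g: "nrm (grad i ?\<psi>) \<le> ?g" for i
    proof -
      have "Dir ?\<psi> ?\<psi> \<le> mean_energy v"
      proof -
        have "1 / q * tail v (2 * n) \<le> 1 / q * (q * mean_energy v)"
          using tail_le[of v "2 * n"] q_pos by (intro mult_left_mono) auto
        then show ?thesis using Dir_corrector_le_tail[of v n m] q_pos by simp
      qed
      then have *: "sqrt (c * Dir ?\<psi> ?\<psi>) \<le> ?g" using c_ge_1 by simp
      show ?thesis by (rule order_trans[OF nrm_grad_le *]) simp
    qed
    have g0: "0 \<le> ?g" using mean_energy_nonneg[of v] c_ge_1 by simp
    define \<psi> V mo where "\<psi> = ?\<psi>" and "V = ?V" and "mo = ?m"
    have [simp]: "\<psi> \<in> env_poly" "V \<in> env_poly" "mo \<in> env_poly"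
      by (simp_all add: \<psi>_def V_def mo_def)
    have "1 / q * (\<Sum>k<m. drift_corr v (k + 2 * n)) = E (\<lambda>\<xi>. \<psi> \<xi> * V \<xi>)"
    proof -
      have "n + k + n = k + 2 * n" for k by simp
      then show ?thesis unfolding \<psi>_def V_def by (simp only: E_corrector_mult env_poly_drift drift_corr_def)
    qed
    also have "\<dots> = E (\<lambda>\<xi>. (\<psi> \<xi> - mo \<xi>) * V \<xi> + mo \<xi> * V \<xi>)"
      by (simp add: algebra_simps)
    also have "\<dots> = E (\<lambda>\<xi>. (\<psi> \<xi> - mo \<xi>) * V \<xi>) + E (\<lambda>\<xi>. mo \<xi> * V \<xi>)"
      by (rule E_add) auto
    also have "E (\<lambda>\<xi>. (\<psi> \<xi> - mo \<xi>) * V \<xi>) \<le> nrm (\<lambda>\<xi>. \<psi> \<xi> - mo \<xi>) * nrm V"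
      by (rule order_trans[OF abs_ge_self E_mult_le_nrm]) auto
    also have "\<dots> \<le> (r * ?g) * ?s"
    proof (intro mult_mono)
      show "nrm (\<lambda>\<xi>. \<psi> \<xi> - mo \<xi>) \<le> r * ?g"
        unfolding mo_def \<psi>_def
      proof (intro nrm_diff_mollify_le, unfold \<psi>_def[symmetric])
        fix y assume "y \<in> uminus ` B"
        then obtain z where z: "z \<in> B" "y = - z" by auto
        have "increment \<psi> y \<le> (\<Sum>i\<in>UNIV. real_of_int \<bar>z $ i\<bar>) * ?g"
          using increment_le[OF _ g, of z] by (simp add: z increment_uminus \<psi>_def)
        also have "\<dots> \<le> r * ?g" using r[OF z(1)] g0 by (intro mult_right_mono) auto
        finally show "increment \<psi> y \<le> r * ?g" .
      qed (use B in auto)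
      show "nrm V \<le> ?s"
        using E_lazy_pow_mult[of "drift v" n n] unfolding V_def nrm_def power2_eq_square drift_corr_def mult_2 by simp
    qed (use r0 g0 in auto)
    also have "E (\<lambda>\<xi>. mo \<xi> * V \<xi>) = - (\<Sum>i\<in>UNIV. E (\<lambda>\<xi>. (mollify B (flux q v n i) \<xi> - p i) * grad i \<psi> \<xi>))"
    proof -
      have "E (\<lambda>\<xi>. flux q v n i \<xi> * grad i mo \<xi>) = E (\<lambda>\<xi>. (mollify B (flux q v n i) \<xi> - p i) * grad i \<psi> \<xi>)" for i
      proof -
        \<comment> \<open>This is what permits subtracting the constant \<open>p i\<close> from the
          averaged flux.\<close>
        have 0: "E (grad i \<psi>) = 0" unfolding grad_def by (subst E_diff) (auto simp: E_shift)
        have "E (\<lambda>\<xi>. (mollify B (flux q v n i) \<xi> - p i) * grad i \<psi> \<xi>)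
          = E (\<lambda>\<xi>. mollify B (flux q v n i) \<xi> * grad i \<psi> \<xi>) - E (\<lambda>\<xi>. p i * grad i \<psi> \<xi>)"
          unfolding left_diff_distrib by (rule E_diff) auto
        also have "\<dots> = E (\<lambda>\<xi>. mollify B (flux q v n i) \<xi> * grad i \<psi> \<xi>)"
          by (subst E_cmult) (auto simp: 0)
        also have "\<dots> = E (\<lambda>\<xi>. flux q v n i \<xi> * grad i mo \<xi>)"
          unfolding mo_def \<psi>_def grad_mollify by (rule E_mult_mollify[symmetric]) auto
        finally show ?thesis by simp
      qed
      then show ?thesis unfolding V_def by (simp add: E_lazy_pow_drift_mult)
    qed
    also have "\<dots> \<le> (\<Sum>i\<in>UNIV. \<bar>E (\<lambda>\<xi>. (mollify B (flux q v n i) \<xi> - p i) * grad i \<psi> \<xi>)\<bar>)"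
      by (rule order_trans[OF abs_ge_self]) simp
    also have "\<dots> \<le> (\<Sum>i\<in>UNIV. nrm (\<lambda>\<xi>. mollify B (flux q v n i) \<xi> - p i) * ?g)"
      using g by (intro sum_mono order_trans[OF E_mult_le_nrm] mult_left_mono) (auto simp: \<psi>_def)
    also have "\<dots> = ?J * ?g" by (rule sum_distrib_right[symmetric])
    also have "(r * ?g) * ?s + ?J * ?g = (r * ?s + ?J) * ?g" by (rule distr)
    finally show ?thesis by simp
  qed
  then have "(\<Sum>k<m. drift_corr v (k + 2 * n)) \<le> q * ((r * ?s + ?J) * ?g)" for m
    unfolding scale .
  then have "tail v (2 * n) \<le> q * ((r * ?s + ?J) * ?g)"
    unfolding tail_def
    by (intro suminf_le_const summable_ignore_initial_segment summable_drift_corr)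
  then show ?thesis unfolding scale .
qed

end

section \<open>Second moments of the lazy chain\<close>

text \<open>Transition operator of the lazy chain in a fixed environment. Its range is finite, so it
  also acts on the unbounded function (x . v)^2.\<close>

definition step :: "real \<Rightarrow> 'd::finite env \<Rightarrow> (int ^ 'd \<Rightarrow> real) \<Rightarrow> int ^ 'd \<Rightarrow> real" where
  "step q \<xi> f = (\<lambda>x. f x + walk_generator \<xi> f x / q)"

lemma step_add: "step q \<xi> (\<lambda>x. f x + g x) = (\<lambda>x. step q \<xi> f x + step q \<xi> g x)"
proof -
  have "walk_generator \<xi> (\<lambda>x. f x + g x) x = walk_generator \<xi> f x + walk_generator \<xi> g x" for x
    unfolding walk_generator_def sum.distrib[symmetric] by (rule sum.cong) (auto simp: algebra_simps)
  then show ?thesis by (simp add: step_def add_divide_distrib fun_eq_iff)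
qed

lemma step_cmult: "step q \<xi> (\<lambda>x. a * f x) = (\<lambda>x. a * step q \<xi> f x)"
proof -
  have "walk_generator \<xi> (\<lambda>x. a * f x) x = a * walk_generator \<xi> f x" for x
    unfolding walk_generator_def sum_distrib_left by (rule sum.cong) (auto simp: algebra_simps)
  then show ?thesis by (simp add: step_def distrib_left)
qed

lemma step_pow_add: "(step q \<xi> ^^ n) (\<lambda>x. f x + g x) = (\<lambda>x. (step q \<xi> ^^ n) f x + (step q \<xi> ^^ n) g x)"
  by (induction n) (auto simp: step_add)

lemma step_pow_cmult: "(step q \<xi> ^^ n) (\<lambda>x. a * f x) = (\<lambda>x. a * (step q \<xi> ^^ n) f x)"
  by (induction n) (auto simp: step_cmult)

lemma step_pow_sum: "(step q \<xi> ^^ n) (\<lambda>x. \<Sum>k\<in>I. f k x) = (\<lambda>x. \<Sum>k\<in>I. (step q \<xi> ^^ n) (f k) x)"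
proof (induction I rule: infinite_finite_induct)
  case (insert x I)
  then show ?case by (simp add: step_pow_add)
qed (use step_pow_cmult[where a = 0] in auto)

text \<open>The bridge between the chain in one environment and the operators on functions of the
  environment.\<close>

lemma step_field: "step q \<xi> (\<lambda>x. F (shift x \<xi>)) = (\<lambda>x. lazy q F (shift x \<xi>))"
  by (simp add: step_def lazy_def walk_generator_def gen_def add.commute)

lemma step_pow_field: "(step q \<xi> ^^ n) (\<lambda>x. F (shift x \<xi>)) = (\<lambda>x. (lazy q ^^ n) F (shift x \<xi>))"
  by (induction n) (auto simp: step_field)

section \<open>Duhamel expansion of the second moment\<close>

definition proj :: "real ^ 'd \<Rightarrow> int ^ 'd \<Rightarrow> real" where
  "proj v x = real_vec x \<bullet> (v :: real ^ 'd::finite)"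

lemma proj_0 [simp]: "proj v 0 = 0"
  by (simp add: proj_def real_vec_def inner_vec_def)

lemma proj_add: "proj v (x + y) = proj v x + proj v y"
  by (simp add: proj_def real_vec_def inner_vec_def algebra_simps sum.distrib)

lemma proj_diff: "proj v (x - y) = proj v x - proj v y"
  by (simp add: proj_def real_vec_def inner_vec_def algebra_simps sum_subtractf)

lemma proj_unit_vec [simp]: "proj v (unit_vec i) = v $ i"
proof -
  have "real_vec (unit_vec i) = axis i 1"
    by (simp add: real_vec_def unit_vec_def axis_def vec_eq_iff)
  then show ?thesis by (simp add: proj_def inner_axis' )
qed

text \<open>The correction in the product rule for the generator applied to (x . v) F: neighbouring
  values of \<open>F\<close>, weighted by jump rate and displacement.\<close>

definition twist :: "real ^ 'd \<Rightarrow> ('d::finite env \<Rightarrow> real) \<Rightarrow> 'd env \<Rightarrow> real" where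
  "twist v F = (\<lambda>\<xi>. \<Sum>i\<in>UNIV. v $ i * (\<xi> (0, i) * F (shift (unit_vec i) \<xi>))
                - v $ i * (\<xi> (- unit_vec i, i) * F (shift (- unit_vec i) \<xi>)))"

lemma env_poly_twist [simp, intro]: "F \<in> env_poly \<Longrightarrow> twist v F \<in> env_poly"
  by (simp add: twist_def)

definition sq_field :: "real ^ 'd \<Rightarrow> 'd::finite env \<Rightarrow> real" where
  "sq_field v = (\<lambda>\<xi>. \<Sum>i\<in>UNIV. (v $ i)\<^sup>2 * (\<xi> (0, i) + \<xi> (- unit_vec i, i)))"

lemma env_poly_sq_field [simp, intro]: "sq_field v \<in> env_poly"
  by (simp add: sq_field_def)

lemma step_proj_field:
  "step q \<xi> (\<lambda>x. proj v x * F (shift x \<xi>))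
    = (\<lambda>x. proj v x * lazy q F (shift x \<xi>) + (1 / q * twist v F (shift x \<xi>)))"
proof
  fix x
  have "walk_generator \<xi> (\<lambda>x. proj v x * F (shift x \<xi>)) x
      = proj v x * gen F (shift x \<xi>) + twist v F (shift x \<xi>)"
    unfolding walk_generator_def gen_def twist_def sum_distrib_left sum.distrib[symmetric]
    by (rule sum.cong) (auto simp: proj_add proj_diff algebra_simps)
  then show "step q \<xi> (\<lambda>x. proj v x * F (shift x \<xi>)) x
      = proj v x * lazy q F (shift x \<xi>) + (1 / q * twist v F (shift x \<xi>))"
    by (simp add: step_def lazy_def algebra_simps add_divide_distrib)
qed

text \<open>Duhamel expansion: at each step the linear factor survives or is consumed by one
  \<open>twist\<close>, after which only powers of \<open>lazy\<close> act.\<close>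

lemma step_pow_proj_field:
  "(step q \<xi> ^^ n) (\<lambda>x. proj v x * F (shift x \<xi>))
    = (\<lambda>x. proj v x * (lazy q ^^ n) F (shift x \<xi>)
        + 1 / q * (\<Sum>k<n. (lazy q ^^ (n - Suc k)) (twist v ((lazy q ^^ k) F)) (shift x \<xi>)))"
proof (induction n arbitrary: F)
  case (Suc n)
  have "(step q \<xi> ^^ Suc n) (\<lambda>x. proj v x * F (shift x \<xi>))
     = (step q \<xi> ^^ n) (\<lambda>x. proj v x * lazy q F (shift x \<xi>) + 1 / q * twist v F (shift x \<xi>))"
    by (simp only: funpow_Suc_right o_apply step_proj_field)
  also have "\<dots> = (\<lambda>x. (proj v x * (lazy q ^^ n) (lazy q F) (shift x \<xi>)
        + 1 / q * (\<Sum>k<n. (lazy q ^^ (n - Suc k)) (twist v ((lazy q ^^ k) (lazy q F))) (shift x \<xi>)))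
        + 1 / q * (lazy q ^^ n) (twist v F) (shift x \<xi>))"
    by (simp only: step_pow_add step_pow_cmult step_pow_field Suc)
  also have "\<dots> = (\<lambda>x. proj v x * (lazy q ^^ Suc n) F (shift x \<xi>)
        + 1 / q * (\<Sum>k<Suc n. (lazy q ^^ (Suc n - Suc k)) (twist v ((lazy q ^^ k) F)) (shift x \<xi>)))"
    unfolding sum.lessThan_Suc_shift
    by (simp only: funpow_Suc_right o_apply distrib_left diff_Suc_Suc diff_zero funpow_0 add_ac)
  finally show ?case .
qed simp

definition moment :: "real \<Rightarrow> real ^ 'd \<Rightarrow> nat \<Rightarrow> 'd::finite env \<Rightarrow> real" where
  "moment q v n \<xi> = (step q \<xi> ^^ n) (\<lambda>x. (proj v x)\<^sup>2) 0"

lemma moment_0 [simp]: "moment q v 0 = (\<lambda>_. 0)"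
  by (simp add: moment_def fun_eq_iff)

lemma step_proj_squared:
  "step q \<xi> (\<lambda>x. (proj v x)\<^sup>2)
    = (\<lambda>x. (proj v x)\<^sup>2 + 1 / q * (2 * (proj v x * drift v (shift x \<xi>)) + sq_field v (shift x \<xi>)))"
proof
  fix x
  have "walk_generator \<xi> (\<lambda>x. (proj v x)\<^sup>2) x = 2 * (proj v x * drift v (shift x \<xi>)) + sq_field v (shift x \<xi>)"
    unfolding walk_generator_def drift_def sq_field_def sum_distrib_left sum.distrib[symmetric]
    by (rule sum.cong) (auto simp: proj_add proj_diff algebra_simps power2_eq_square)
  then show "step q \<xi> (\<lambda>x. (proj v x)\<^sup>2) x
      = (proj v x)\<^sup>2 + 1 / q * (2 * (proj v x * drift v (shift x \<xi>)) + sq_field v (shift x \<xi>))"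
    by (simp add: step_def)
qed

text \<open>For a chain started at the origin the term proportional to \<open>proj v\<close> drops
  out, so the increment of the second moment is a local polynomial in the environment.\<close>

definition moment_incr :: "real \<Rightarrow> real ^ 'd \<Rightarrow> nat \<Rightarrow> 'd::finite env \<Rightarrow> real" where
  "moment_incr q v n = (\<lambda>\<xi>. 1 / q * (2 * (1 / q * (\<Sum>k<n. (lazy q ^^ (n - Suc k)) (twist v ((lazy q ^^ k) (drift v))) \<xi>))
      + (lazy q ^^ n) (sq_field v) \<xi>))"

lemma env_poly_moment_incr [simp, intro]: "moment_incr q v n \<in> env_poly"
  by (simp add: moment_incr_def)

lemma moment_Suc: "moment q v (Suc n) = (\<lambda>\<xi>. moment q v n \<xi> + moment_incr q v n \<xi>)"
proof
  fix \<xi>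
  have "moment q v (Suc n) \<xi> = (step q \<xi> ^^ n) (\<lambda>x. (proj v x)\<^sup>2 + 1 / q * (2 * (proj v x * drift v (shift x \<xi>)) + sq_field v (shift x \<xi>))) 0"
    by (simp only: moment_def funpow_Suc_right o_apply step_proj_squared)
  also have "\<dots> = moment q v n \<xi> + moment_incr q v n \<xi>"
    unfolding step_pow_add step_pow_cmult step_pow_field step_pow_proj_field moment_incr_def moment_def
    by (simp only: proj_0 shift_0 mult_zero_left add_0_left)
  finally show "moment q v (Suc n) \<xi> = moment q v n \<xi> + moment_incr q v n \<xi>" .
qed

lemma env_poly_moment [simp, intro]: "moment q v n \<in> env_poly"
  by (induction n) (simp_all only: moment_0 moment_Suc env_poly.const env_poly.add env_poly_moment_incr)

text \<open>Cesaro's theorem applied to the increments of a sequence.\<close>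

lemma increments_imp_mean_tendsto:
  fixes a :: "nat \<Rightarrow> real"
  assumes "(\<lambda>n. a (Suc n) - a n) \<longlonglongrightarrow> L"
  shows "(\<lambda>n. a n / n) \<longlonglongrightarrow> L"
proof (rule LIMSEQ_I)
  fix e :: real assume e: "e > 0"
  obtain N where N: "\<And>n. n \<ge> N \<Longrightarrow> \<bar>a (Suc n) - a n - L\<bar> < e / 2"
    using LIMSEQ_D[OF assms, of "e/2"] e by auto
  have lin: "\<bar>a (N + k) - a N - k * L\<bar> \<le> k * (e / 2)" for k
  proof (induction k)
    case (Suc k)
    have "a (N + Suc k) - a N - Suc k * L = (a (N + k) - a N - k * L) + (a (Suc (N + k)) - a (N + k) - L)"
      by (simp add: algebra_simps)
    moreover have "\<bar>a (Suc (N + k)) - a (N + k) - L\<bar> < e / 2" by (rule N) simp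
    moreover have "real (Suc k) * (e / 2) = k * (e / 2) + e / 2" by (simp add: algebra_simps)
    ultimately show ?case using Suc by linarith
  qed simp
  define M where "M = \<bar>a N\<bar> + real N * \<bar>L\<bar>"
  obtain K :: nat where K: "real K > 2 * M / e" using reals_Archimedean2 by blast
  show "\<exists>n0. \<forall>n\<ge>n0. norm (a n / n - L) < e"
  proof (intro exI allI impI)
    fix n assume n: "n \<ge> Suc (N + K)"
    define k where "k = n - N"
    have nk: "n = N + k" using n by (simp add: k_def)
    have "\<bar>a n - n * L\<bar> \<le> \<bar>a (N + k) - a N - k * L\<bar> + \<bar>a N\<bar> + \<bar>real N * L\<bar>"
      unfolding nk by (simp add: algebra_simps abs_if split: if_splits)
    also have "\<dots> \<le> k * (e / 2) + M" using lin[of k] by (simp add: M_def abs_mult)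
    also have "\<dots> \<le> n * (e / 2) + M" using e by (simp add: nk)
    also have "\<dots> < n * e"
    proof -
      have "2 * M < real K * e" using K e by (simp add: field_simps)
      also have "\<dots> \<le> real n * e" using n e by simp
      finally show ?thesis by simp
    qed
    finally have "\<bar>a n - n * L\<bar> / n < e" using n by (simp add: divide_less_eq mult.commute)
    moreover have "a n / n - L = (a n - n * L) / n" using n by (simp add: field_simps)
    ultimately show "norm (a n / n - L) < e" by simp
  qed
qed

context stationary_mean
begin

lemma E_twist:
  assumes [simp]: "F \<in> env_poly"
  shows "E (twist v F) = - E (\<lambda>\<xi>. F \<xi> * drift v \<xi>)"
proof -
  have "E (twist v F) = (\<Sum>i\<in>UNIV. v $ i * E (\<lambda>\<xi>. \<xi> (0, i) * F (shift (unit_vec i) \<xi>))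
       - v $ i * E (\<lambda>\<xi>. \<xi> (- unit_vec i, i) * F (shift (- unit_vec i) \<xi>)))"
    unfolding twist_def by (subst E_sum, simp, subst E_diff) (auto simp: E_cmult)
  also have "\<dots> = (\<Sum>i\<in>UNIV. E (\<lambda>\<xi>. \<xi> (0, i) * v $ i * grad i F \<xi>))"
  proof (rule sum.cong[OF refl])
    fix i :: 'd
    have "E (\<lambda>\<xi>. \<xi> (- unit_vec i, i) * F (shift (- unit_vec i) \<xi>)) = E (\<lambda>\<xi>. \<xi> (0, i) * F \<xi>)"
      by (subst E_shift[of _ "unit_vec i", symmetric]) auto
    then show "v $ i * E (\<lambda>\<xi>. \<xi> (0, i) * F (shift (unit_vec i) \<xi>))
       - v $ i * E (\<lambda>\<xi>. \<xi> (- unit_vec i, i) * F (shift (- unit_vec i) \<xi>)) = E (\<lambda>\<xi>. \<xi> (0, i) * v $ i * grad i F \<xi>)"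
      by (simp add: E_diff[symmetric] E_cmult[symmetric] grad_def algebra_simps)
  qed
  finally show ?thesis by (simp add: E_mult_drift)
qed

lemma E_sq_field: "E (sq_field v) = 2 * mean_energy v"
proof -
  have "E (\<lambda>\<xi>. \<xi> (- unit_vec i, i)) = E (\<lambda>\<xi>. \<xi> (0, i))" for i
    by (subst E_shift[of _ "unit_vec i", symmetric]) auto
  then show ?thesis
    by (simp add: sq_field_def mean_energy_def E_sum E_cmult E_add sum_distrib_left ac_simps)
qed

text \<open>Green-Kubo for the lazy chain: \<open>lazy\<close> preserves means, so the Duhamel term
  of index \<open>k\<close> contributes the mean of one twist, which is minus the correlation at
  \<open>k\<close>.\<close>

lemma E_moment_incr: "E (moment_incr q v n) = 2 / q * (mean_energy v - 1 / q * (\<Sum>k<n. drift_corr v k))"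
proof -
  have "E (\<lambda>\<xi>. \<Sum>k<n. (lazy q ^^ (n - Suc k)) (twist v ((lazy q ^^ k) (drift v))) \<xi>) = (\<Sum>k<n. - drift_corr v k)"
    by (subst E_sum) (auto simp: E_lazy_pow E_twist drift_corr_def corr_def mult.commute)
  then have "E (\<lambda>\<xi>. 2 * (1 / q * (\<Sum>k<n. (lazy q ^^ (n - Suc k)) (twist v ((lazy q ^^ k) (drift v))) \<xi>))) = - 2 / q * (\<Sum>k<n. drift_corr v k)"
    by (subst E_cmult, simp, subst E_cmult) (auto simp: sum_negf)
  then show ?thesis
    unfolding moment_incr_def by (subst E_cmult, simp, subst E_add) (auto simp: E_lazy_pow E_sq_field algebra_simps)
qed

lemma E_moment_incr_tendsto: "(\<lambda>n. E (moment_incr q v n)) \<longlonglongrightarrow> 2 / q * eff v"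
  unfolding E_moment_incr eff_def
  by (intro tendsto_intros summable_LIMSEQ summable_drift_corr)

lemma E_moment_tendsto: "(\<lambda>n. E (moment q v n) / n) \<longlonglongrightarrow> 2 / q * eff v"
  by (rule increments_imp_mean_tendsto)
     (use E_moment_incr_tendsto in \<open>simp add: moment_Suc E_add\<close>)

lemma nrm_mult_coord_le:
  assumes [simp]: "F \<in> env_poly"
  shows "nrm (\<lambda>\<xi>. \<xi> b * F \<xi>) \<le> c * nrm F"
proof -
  have "E (\<lambda>\<xi>. (\<xi> b * F \<xi>)\<^sup>2) \<le> E (\<lambda>\<xi>. c\<^sup>2 * (F \<xi>)\<^sup>2)"
    by (rule E_mono) (auto simp: power_mult_distrib env_bounds intro!: mult_right_mono power_mono)
  also have "\<dots> = c\<^sup>2 * E (\<lambda>\<xi>. (F \<xi>)\<^sup>2)" by (rule E_cmult) auto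
  finally have "nrm (\<lambda>\<xi>. \<xi> b * F \<xi>) \<le> \<bar>c\<bar> * nrm F"
    unfolding nrm_def real_sqrt_abs[symmetric] real_sqrt_mult[symmetric] by (rule real_sqrt_le_mono)
  then show ?thesis using c_ge_1 by simp
qed

lemma nrm_twist_le:
  assumes [simp]: "F \<in> env_poly"
  shows "nrm (twist v F) \<le> (2 * c * (\<Sum>i\<in>UNIV. \<bar>v $ i\<bar>)) * nrm F"
proof -
  have "nrm (twist v F) \<le> (\<Sum>i\<in>UNIV. nrm (\<lambda>\<xi>. v $ i * (\<xi> (0, i) * F (shift (unit_vec i) \<xi>))
                + (- v $ i) * (\<xi> (- unit_vec i, i) * F (shift (- unit_vec i) \<xi>))))"
    unfolding twist_def by (rule order_trans[OF _ nrm_sum_le]) auto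
  also have "\<dots> \<le> (\<Sum>i\<in>UNIV. \<bar>v $ i\<bar> * (c * nrm F) + \<bar>v $ i\<bar> * (c * nrm F))"
  proof (rule sum_mono)
    fix i :: 'd
    have *: "nrm (\<lambda>\<xi>. a * (\<xi> b * F (shift y \<xi>))) \<le> \<bar>a\<bar> * (c * nrm F)" for a b y
      using nrm_mult_coord_le[of "\<lambda>\<xi>. F (shift y \<xi>)" b]
      by (subst nrm_cmult) (auto simp: nrm_shift intro!: mult_left_mono)
    show "nrm (\<lambda>\<xi>. v $ i * (\<xi> (0, i) * F (shift (unit_vec i) \<xi>))
                + (- v $ i) * (\<xi> (- unit_vec i, i) * F (shift (- unit_vec i) \<xi>)))
        \<le> \<bar>v $ i\<bar> * (c * nrm F) + \<bar>v $ i\<bar> * (c * nrm F)"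
      using *[of "v $ i" "(0, i)" "unit_vec i"] *[of "- v $ i" "(- unit_vec i, i)" "- unit_vec i"]
      by (intro order_trans[OF nrm_add_le add_mono]) (simp_all only: abs_minus_cancel env_poly_shift
          env_poly.const env_poly.mult env_poly.coord assms)
  qed
  also have "\<dots> = (2 * c * (\<Sum>i\<in>UNIV. \<bar>v $ i\<bar>)) * nrm F"
    by (simp add: sum_distrib_right sum_distrib_left algebra_simps)
  finally show ?thesis .
qed

end

lemma lazy_diff_const: "lazy q (\<lambda>\<xi>. F \<xi> - a) = (\<lambda>\<xi>. lazy q F \<xi> - a)"
  using gen_add[of F "\<lambda>_. - a"] by (simp add: lazy_def fun_eq_iff)

lemma lazy_pow_diff_const: "(lazy q ^^ n) (\<lambda>\<xi>. F \<xi> - a) = (\<lambda>\<xi>. (lazy q ^^ n) F \<xi> - a)"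
  by (induction n) (auto simp: lazy_diff_const)

text \<open>\<open>E\<close> is the mean over the translates of a periodic environment \<open>\<xi>0\<close> with period cell \<open>B\<close>.\<close>

locale periodic_mean = stationary_mean c q E
  for c q and E :: "('d::finite env \<Rightarrow> real) \<Rightarrow> real" +
  fixes \<xi>0 :: "'d env" and B :: "(int ^ 'd) set"
  assumes finite_B: "finite B" and zero_in_B: "0 \<in> B"
    and E_eq_mollify: "F \<in> env_poly \<Longrightarrow> E F = mollify B F (shift x \<xi>0)"
begin

lemma E_cong_orbit:
  assumes "F \<in> env_poly" "G \<in> env_poly" "\<And>y. F (shift y \<xi>0) = G (shift y \<xi>0)"
  shows "E F = E G"
  using assms E_eq_mollify[of F 0] E_eq_mollify[of G 0] by (simp add: mollify_def)

text \<open>The orbit is covered by the finite cell \<open>B\<close>, so point values are bounded by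
  the norm. This allows passing from averaged to quenched statements on a torus.\<close>

lemma abs_le_nrm:
  assumes [simp]: "F \<in> env_poly"
  shows "\<bar>F \<xi>0\<bar> \<le> sqrt (card B) * nrm F"
proof -
  have cB: "card B > 0" using finite_B zero_in_B by (auto simp: card_gt_0_iff)
  have "(F \<xi>0)\<^sup>2 \<le> (\<Sum>y\<in>B. (F (shift y \<xi>0))\<^sup>2)"
    using member_le_sum[of 0 B "\<lambda>y. (F (shift y \<xi>0))\<^sup>2"] finite_B zero_in_B by simp
  also have "\<dots> = card B * E (\<lambda>\<xi>. (F \<xi>)\<^sup>2)"
    using cB by (subst E_eq_mollify[of _ 0]) (auto simp: mollify_def)
  finally have "sqrt ((F \<xi>0)\<^sup>2) \<le> sqrt (card B * E (\<lambda>\<xi>. (F \<xi>)\<^sup>2))"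
    by (rule real_sqrt_le_mono)
  then show ?thesis by (simp add: real_sqrt_mult nrm_def)
qed

text \<open>On the orbit a mean-zero function equals its deviation from its average over
  \<open>B\<close>, so the increment bound becomes a Poincare inequality. The resulting rate depends
  on the period.\<close>

lemma spectral_gap:
  "\<exists>\<rho>. 0 \<le> \<rho> \<and> \<rho> < 1 \<and> (\<forall>F\<in>env_poly. E F = 0 \<longrightarrow> nrm (lazy q F) \<le> \<rho> * nrm F)"
proof -
  \<comment> \<open>A crude bound on the l1 length of every point of \<open>B\<close>; no control in
    the period is sought.\<close>
  define r where "r = (\<Sum>y\<in>B. \<Sum>i\<in>UNIV. real_of_int \<bar>y $ i\<bar>)"
  have r: "(\<Sum>i\<in>UNIV. real_of_int \<bar>y $ i\<bar>) \<le> r" if "y \<in> B" for y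
    unfolding r_def using finite_B that by (intro member_le_sum[where f = "\<lambda>y. \<Sum>i\<in>UNIV. real_of_int \<bar>y $ i\<bar>"]) (auto intro!: sum_nonneg)
  have r0: "r \<ge> 0" unfolding r_def by (auto intro!: sum_nonneg)
  \<comment> \<open>The second summand is the Poincare constant in units of
    \<open>Dir F F / q\<close>; the summand 1 ensures that \<open>1 - 1 / C\<close> lies in [0,
    1).\<close>
  define C where "C = 1 + q * (r\<^sup>2 * c)"
  have C: "C \<ge> 1" using q_pos c_ge_1 by (simp add: C_def)
  have gap: "(nrm (lazy q F))\<^sup>2 \<le> (1 - 1 / C) * (nrm F)\<^sup>2" if [simp]: "F \<in> env_poly" and "E F = 0" for F
  proof -
    have "nrm F = nrm (\<lambda>\<xi>. F \<xi> - mollify B F \<xi>)"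
      unfolding nrm_def
      by (intro arg_cong[where f = sqrt] E_cong_orbit) (use \<open>E F = 0\<close> in \<open>auto simp: E_eq_mollify[symmetric]\<close>)
    also have "\<dots> \<le> r * sqrt (c * Dir F F)"
    proof (rule nrm_diff_mollify_le)
      fix y assume "y \<in> B"
      have "increment F y \<le> (\<Sum>i\<in>UNIV. real_of_int \<bar>y $ i\<bar>) * sqrt (c * Dir F F)"
        by (intro increment_le nrm_grad_le) auto
      also have "\<dots> \<le> r * sqrt (c * Dir F F)"
        using r[OF \<open>y \<in> B\<close>] Dir_nonneg[of F] c_ge_1 by (intro mult_right_mono) auto
      finally show "increment F y \<le> r * sqrt (c * Dir F F)" .
    qed (use finite_B zero_in_B in auto)
    finally have "(nrm F)\<^sup>2 \<le> (r * sqrt (c * Dir F F))\<^sup>2" by (rule power_mono) simp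
    also have "\<dots> = r\<^sup>2 * c * Dir F F" using c_ge_1 Dir_nonneg[of F] by (simp add: power_mult_distrib)
    also have "\<dots> \<le> C * (Dir F F / q)"
    proof -
      have "r\<^sup>2 * c = q * (r\<^sup>2 * c) * (1 / q)" using q_pos by simp
      also have "\<dots> \<le> C * (1 / q)" using q_pos by (intro mult_right_mono) (auto simp: C_def)
      finally show ?thesis using mult_right_mono[OF _ Dir_nonneg[of F]] by fastforce
    qed
    finally have "(nrm F)\<^sup>2 / C \<le> Dir F F / q" using C by (simp add: field_simps)
    moreover have "(nrm (lazy q F))\<^sup>2 \<le> (nrm F)\<^sup>2 - Dir F F / q"
      using E_lazy_squared_le[of F] E_mult_lazy[of F F] nrm_square[of F] nrm_square[of "lazy q F"] by (simp add: power2_eq_square[of "F _"] power2_eq_square[of "lazy q F _"])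
    ultimately show ?thesis by (simp add: algebra_simps)
  qed
  show ?thesis
  proof (intro exI conjI ballI impI)
    show "0 \<le> sqrt (1 - 1 / C)" "sqrt (1 - 1 / C) < 1" using C by auto
    fix F :: "'d env \<Rightarrow> real" assume F: "F \<in> env_poly" "E F = 0"
    have "sqrt ((nrm (lazy q F))\<^sup>2) \<le> sqrt ((1 - 1 / C) * (nrm F)\<^sup>2)"
      using gap[OF F] by (rule real_sqrt_le_mono)
    then show "nrm (lazy q F) \<le> sqrt (1 - 1 / C) * nrm F"
      using F by (simp add: real_sqrt_mult)
  qed
qed

text \<open>The torus matrix is defined by a walk from the origin, not by an average over starting
  points. The spectral gap makes the difference disappear: the increments of the moment at
  \<open>\<xi>0\<close> approach their means.\<close>

lemma moment_periodic_tendsto: "(\<lambda>n. moment q v n \<xi>0 / n) \<longlonglongrightarrow> 2 / q * eff v"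
proof (rule increments_imp_mean_tendsto)
  obtain \<rho> where \<rho>: "0 \<le> \<rho>" "\<rho> < 1"
    and gap: "\<And>F. F \<in> env_poly \<Longrightarrow> E F = 0 \<Longrightarrow> nrm (lazy q F) \<le> \<rho> * nrm F"
    using spectral_gap by blast
  have pow: "nrm ((lazy q ^^ n) F) \<le> \<rho> ^ n * nrm F" if "F \<in> env_poly" "E F = 0" for n F
  proof (induction n)
    case (Suc n)
    have "nrm ((lazy q ^^ Suc n) F) \<le> \<rho> * nrm ((lazy q ^^ n) F)"
      using gap[of "(lazy q ^^ n) F"] that by (simp add: E_lazy_pow)
    also have "\<dots> \<le> \<rho> * (\<rho> ^ n * nrm F)" using Suc \<rho> by (intro mult_left_mono) auto
    finally show ?case by (simp add: mult.assoc)
  qed simp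
  let ?b = "sqrt (card B)"
  have decay: "\<bar>(lazy q ^^ n) F \<xi>0 - E F\<bar> \<le> ?b * (\<rho> ^ n * (2 * nrm F))" if [simp]: "F \<in> env_poly" for n F
  proof -
    have "\<bar>E F\<bar> \<le> nrm F"
      using E_mult_le_nrm[of F "\<lambda>_. 1"] by (simp add: nrm_def)
    then have "nrm (\<lambda>\<xi>. F \<xi> + (- E F)) \<le> nrm F + nrm F"
      by (intro order_trans[OF nrm_add_le]) (auto simp: nrm_def)
    then have n2: "nrm (\<lambda>\<xi>. F \<xi> - E F) \<le> 2 * nrm F" by simp
    have "\<bar>(lazy q ^^ n) F \<xi>0 - E F\<bar> = \<bar>(lazy q ^^ n) (\<lambda>\<xi>. F \<xi> - E F) \<xi>0\<bar>"
      by (simp add: lazy_pow_diff_const)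
    also have "\<dots> \<le> ?b * nrm ((lazy q ^^ n) (\<lambda>\<xi>. F \<xi> - E F))"
      by (rule abs_le_nrm) auto
    also have "\<dots> \<le> ?b * (\<rho> ^ n * nrm (\<lambda>\<xi>. F \<xi> - E F))"
      by (intro mult_left_mono pow) (auto simp: E_diff)
    also have "\<dots> \<le> ?b * (\<rho> ^ n * (2 * nrm F))"
      using \<rho> n2 by (intro mult_left_mono) auto
    finally show ?thesis .
  qed
  define A where "A = 2 * c * (\<Sum>i\<in>UNIV. \<bar>v $ i\<bar>)"
  have A: "A \<ge> 0" using c_ge_1 by (simp add: A_def sum_nonneg)
  define M where "M = ?b * (2 * (A * nrm (drift v)))"
  have E_drift: "E (drift v) = 0"
    using E_mult_drift[of "\<lambda>_. 1" v] by (simp add: grad_def)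
  \<comment> \<open>Contraction acts on both sides of the twist: \<open>k\<close> times on the
    mean-zero drift and \<open>n - Suc k\<close> times on the centred twist. Each of the
    \<open>n\<close> terms is thus of order \<open>\<rho> ^ (n - 1)\<close>, and their sum still
    vanishes.\<close>
  have summand: "\<bar>(lazy q ^^ (n - Suc k)) (twist v ((lazy q ^^ k) (drift v))) \<xi>0 - E (twist v ((lazy q ^^ k) (drift v)))\<bar>
      \<le> M * \<rho> ^ (n - 1)" if "k < n" for k n
  proof -
    have "\<rho> ^ (n - Suc k) * \<rho> ^ k = \<rho> ^ (n - 1)" using that by (simp flip: power_add)
    moreover have "nrm (twist v ((lazy q ^^ k) (drift v))) \<le> A * (\<rho> ^ k * nrm (drift v))"
      using mult_left_mono[OF pow[of "drift v" k] A] E_drift nrm_twist_le[of "(lazy q ^^ k) (drift v)" v]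
      by (auto simp: A_def[symmetric])
    then have "?b * (\<rho> ^ (n - Suc k) * (2 * nrm (twist v ((lazy q ^^ k) (drift v)))))
       \<le> ?b * (\<rho> ^ (n - Suc k) * (2 * (A * (\<rho> ^ k * nrm (drift v)))))"
      using \<rho> by (intro mult_left_mono) auto
    moreover have "?b * (\<rho> ^ (n - Suc k) * (2 * (A * (\<rho> ^ k * nrm (drift v)))))
       = M * (\<rho> ^ (n - Suc k) * \<rho> ^ k)"
      by (simp add: M_def)
    ultimately show ?thesis
      using decay[of "twist v ((lazy q ^^ k) (drift v))" "n - Suc k"] by simp
  qed
  have "(\<lambda>n. moment_incr q v n \<xi>0 - E (moment_incr q v n)) \<longlonglongrightarrow> 0"
  proof (rule tendsto_rabs_zero_cancel, rule tendsto_sandwich[OF _ _ tendsto_const])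
    let ?T = "\<lambda>n k. (lazy q ^^ (n - Suc k)) (twist v ((lazy q ^^ k) (drift v)))"
    let ?U = "\<lambda>n. 2 / q\<^sup>2 * (real n * (M * \<rho> ^ (n - 1))) + 1 / q * (?b * (\<rho> ^ n * (2 * nrm (sq_field v))))"
    show "\<forall>\<^sub>F n in sequentially. 0 \<le> \<bar>moment_incr q v n \<xi>0 - E (moment_incr q v n)\<bar>" by simp
    show "\<forall>\<^sub>F n in sequentially. \<bar>moment_incr q v n \<xi>0 - E (moment_incr q v n)\<bar> \<le> ?U n"
    proof (rule always_eventually, rule allI)
      fix n
      have "E (moment_incr q v n) = 1 / q * (2 * (1 / q * (\<Sum>k<n. E (?T n k))) + E ((lazy q ^^ n) (sq_field v)))"
        unfolding moment_incr_def
        by (subst E_cmult, simp, subst E_add, simp, simp, subst E_cmult, simp, subst E_cmult, simp, subst E_sum) auto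
      then have eq: "moment_incr q v n \<xi>0 - E (moment_incr q v n)
         = 2 / q\<^sup>2 * (\<Sum>k<n. ?T n k \<xi>0 - E (?T n k)) + 1 / q * ((lazy q ^^ n) (sq_field v) \<xi>0 - E (sq_field v))"
        using q_pos by (simp add: moment_incr_def sum_subtractf E_lazy_pow field_simps power2_eq_square)
      have "\<bar>moment_incr q v n \<xi>0 - E (moment_incr q v n)\<bar> \<le> 2 / q\<^sup>2 * \<bar>\<Sum>k<n. ?T n k \<xi>0 - E (?T n k)\<bar> + 1 / q * \<bar>(lazy q ^^ n) (sq_field v) \<xi>0 - E (sq_field v)\<bar>"
        unfolding eq using q_pos by (intro order_trans[OF abs_triangle_ineq]) (auto simp: abs_mult)
      moreover have "2 / q\<^sup>2 * \<bar>\<Sum>k<n. ?T n k \<xi>0 - E (?T n k)\<bar> \<le> 2 / q\<^sup>2 * (\<Sum>k<n. M * \<rho> ^ (n - 1))"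
      proof (rule mult_left_mono)
        show "\<bar>\<Sum>k<n. ?T n k \<xi>0 - E (?T n k)\<bar> \<le> (\<Sum>k<n. M * \<rho> ^ (n - 1))"
        proof -
        define z where "z k = ?T n k \<xi>0 - E (?T n k)" for k
        have "\<bar>z k\<bar> \<le> M * \<rho> ^ (n - 1)" if "k < n" for k
          using summand[OF that]
          by (simp only: z_def E_lazy_pow env_poly_twist env_poly_lazy_pow env_poly_drift)
        then have "(\<Sum>k<n. \<bar>z k\<bar>) \<le> (\<Sum>k<n. M * \<rho> ^ (n - 1))" by (intro sum_mono) simp
        then have "\<bar>\<Sum>k<n. z k\<bar> \<le> (\<Sum>k<n. M * \<rho> ^ (n - 1))"
          using sum_abs[of z "{..<n}"] by linarith
        then show ?thesis unfolding z_def .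
        qed
      qed simp
      moreover have "1 / q * \<bar>(lazy q ^^ n) (sq_field v) \<xi>0 - E (sq_field v)\<bar> \<le> 1 / q * (?b * (\<rho> ^ n * (2 * nrm (sq_field v))))"
        using decay[of "sq_field v" n] q_pos by (intro mult_left_mono) auto
      ultimately show "\<bar>moment_incr q v n \<xi>0 - E (moment_incr q v n)\<bar> \<le> ?U n"
        by (simp only: sum_constant card_lessThan)
    qed
    have "(\<lambda>n. real n * \<rho> ^ (n - 1)) \<longlonglongrightarrow> 0"
    proof -
      have "(\<lambda>n. of_nat (Suc n) * \<rho> ^ n) \<longlonglongrightarrow> 0"
        using tendsto_add[OF powser_times_n_limit_0[of \<rho>] LIMSEQ_power_zero[of \<rho>]] \<rho>
        by (simp add: algebra_simps)
      then show ?thesis by (subst filterlim_sequentially_Suc[symmetric]) simp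
    qed
    then have "(\<lambda>n. 2 / q\<^sup>2 * (M * (real n * \<rho> ^ (n - 1))) + 1 / q * (?b * (\<rho> ^ n * (2 * nrm (sq_field v)))))
       \<longlonglongrightarrow> 2 / q\<^sup>2 * (M * 0) + 1 / q * (?b * (0 * (2 * nrm (sq_field v))))"
      using \<rho> by (intro tendsto_intros LIMSEQ_power_zero) auto
    then show "?U \<longlonglongrightarrow> 0" by (simp add: mult_ac)
  qed
  from tendsto_add[OF this E_moment_incr_tendsto[of v]]
  show "(\<lambda>n. moment q v (Suc n) \<xi>0 - moment q v n \<xi>0) \<longlonglongrightarrow> 2 / q * eff v"
    by (simp add: moment_Suc)
qed

end

section \<open>From the walk to the lazy chain\<close>

text \<open>The total rate of leaving \<open>x\<close> is at most 2dc, hence at most q/2, and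
  nonnegative values at the neighbours only help.\<close>

lemma walk_generator_lower:
  assumes "c \<ge> 1" "\<xi> \<in> env_space c" "q \<ge> 4 * real CARD('d) * c" "f x \<ge> 0" "\<And>y. y \<noteq> x \<Longrightarrow> f y \<ge> 0"
  shows "walk_generator \<xi> f (x :: int ^ 'd::finite) \<ge> - (q / 2) * f x"
proof -
  note \<xi> = env_space_bounds[OF assms(2,1)]
  have f: "f y \<ge> 0" for y using assms(4,5) by (cases "y = x") auto
  have one: "\<xi> b * (f y - f x) \<ge> - c * f x" for b y
  proof -
    have "\<xi> b * f y \<ge> 0" "\<xi> b * f x \<le> c * f x"
      using \<xi>(2,3)[of b] f[of x] f[of y] by (auto intro: mult_right_mono)
    then show ?thesis by (simp add: algebra_simps)
  qed
  have "walk_generator \<xi> f x \<ge> (\<Sum>i\<in>(UNIV :: 'd set). - c * f x + - c * f x)"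
    unfolding walk_generator_def by (intro sum_mono add_mono one)
  also have "(\<Sum>i\<in>(UNIV :: 'd set). - c * f x + - c * f x) = - (2 * real CARD('d) * c) * f x"
    by simp
  also have "\<dots> \<ge> - (q / 2) * f x"
    using assms(3,4) by (intro mult_right_mono) auto
  finally show ?thesis by simp
qed

section \<open>Poisson mixtures\<close>

definition pois :: "real \<Rightarrow> nat \<Rightarrow> real" where
  "pois s n = exp (- s) * s ^ n / fact n"

text \<open>Expectation of \<open>a\<close> at a Poisson variable of parameter \<open>s\<close>;
  with \<open>s = q * t\<close> it turns powers of \<open>step\<close> into the semigroup at time
  \<open>t\<close>.\<close>

definition mix :: "real \<Rightarrow> (nat \<Rightarrow> real) \<Rightarrow> real" where
  "mix s a = (\<Sum>n. pois s n * a n)"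

lemma summable_pois_geometric: "summable (\<lambda>n. pois s n * (C * A ^ n))"
proof -
  have "summable (\<lambda>n. (exp (- s) * C) * (inverse (fact n) * (s * A) ^ n))"
    by (intro summable_mult summable_exp)
  then show ?thesis by (simp add: pois_def field_simps power_mult_distrib)
qed

lemma summable_pois:
  assumes "s \<ge> 0" "\<And>n. \<bar>a n\<bar> \<le> C * A ^ n"
  shows "summable (\<lambda>n. pois s n * a n)"
proof (rule summable_comparison_test'[OF summable_pois_geometric[of s C A], of 0])
  fix n
  show "norm (pois s n * a n) \<le> pois s n * (C * A ^ n)"
    using assms by (simp add: abs_mult pois_def mult_left_mono divide_right_mono)
qed

lemma pois_nonneg [simp]: "s \<ge> 0 \<Longrightarrow> 0 \<le> pois s n"
  by (simp add: pois_def)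

lemma pois_sums_1: "pois s sums 1"
proof -
  have "(\<lambda>n. exp (- s) * (inverse (fact n) * s ^ n)) sums (exp (- s) * exp s)"
    using exp_converges[of s] by (intro sums_mult) (simp add: field_simps)
  then show ?thesis by (simp add: pois_def[abs_def] field_simps exp_minus)
qed

lemma pois_mean_sums: "(\<lambda>n. pois s n * real n) sums s"
proof -
  have "(\<lambda>n. s * pois s n) sums (s * 1)" by (intro sums_mult pois_sums_1)
  moreover have "s * pois s n = pois s (Suc n) * real (Suc n)" for n
    by (simp add: pois_def field_simps del: of_nat_Suc)
  ultimately have "(\<lambda>n. pois s (Suc n) * real (Suc n)) sums s" by simp
  then show ?thesis by (subst (asm) sums_Suc_iff) simp
qed

lemma mix_0 [simp]: "mix 0 a = a 0"
proof -
  have "(\<lambda>n. pois 0 n * a n) = (\<lambda>n. if n = 0 then a 0 else 0)"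
    by (auto simp: pois_def fun_eq_iff)
  then show ?thesis unfolding mix_def using sums_single[of 0 "\<lambda>_. a 0"] by (simp add: sums_iff)
qed

lemma mix_deriv:
  assumes "\<And>n. \<bar>a n\<bar> \<le> B" "s \<ge> 0"
  shows "((\<lambda>s. mix s a) has_real_derivative mix s (\<lambda>n. a (Suc n)) - mix s a) (at s)"
proof -
  define u where "u n = a n / fact n" for n
  have su: "summable (\<lambda>n. u n * y ^ n)" for y
  proof (rule summable_comparison_test'[of "\<lambda>n. B * (inverse (fact n) * \<bar>y\<bar> ^ n)" 0])
    show "summable (\<lambda>n. B * (inverse (fact n) * \<bar>y\<bar> ^ n))" by (intro summable_mult summable_exp)
    fix n
    show "norm (u n * y ^ n) \<le> B * (inverse (fact n) * \<bar>y\<bar> ^ n)"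
      using mult_right_mono[OF assms(1)[of n], of "inverse (fact n) * \<bar>y\<bar> ^ n"]
      by (simp add: u_def abs_mult power_abs field_simps)
  qed
  have mix_eq: "mix s a = exp (- s) * (\<Sum>n. u n * s ^ n)" for s
    unfolding mix_def using suminf_mult[OF su, of "exp (- s)" s] by (simp add: pois_def u_def field_simps)
  have mix_Suc: "mix s (\<lambda>n. a (Suc n)) = exp (- s) * (\<Sum>n. diffs u n * s ^ n)"
  proof -
    have "diffs u = (\<lambda>n. a (Suc n) / fact n)"
      by (simp add: diffs_def u_def fun_eq_iff field_simps del: of_nat_Suc)
    then have "(\<lambda>n. pois s n * a (Suc n)) = (\<lambda>n. exp (- s) * (diffs u n * s ^ n))"
      by (simp add: pois_def fun_eq_iff)
    moreover have "summable (\<lambda>n. diffs u n * s ^ n)"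
      using termdiff_converges_all[of u s] su by auto
    ultimately show ?thesis unfolding mix_def using suminf_mult[of "\<lambda>n. diffs u n * s ^ n" "exp (- s)"] by simp
  qed
  have "((\<lambda>s. exp (- s) * (\<Sum>n. u n * s ^ n)) has_real_derivative
      exp (- s) * (- 1) * (\<Sum>n. u n * s ^ n) + (\<Sum>n. diffs u n * s ^ n) * exp (- s)) (at s)"
    by (intro DERIV_mult termdiffs_strong_converges_everywhere su derivative_eq_intros refl) auto
  then show ?thesis
    unfolding mix_eq mix_Suc by (rule DERIV_cong) (simp add: algebra_simps)
qed

text \<open>A Poisson variable of parameter \<open>s\<close> has mean \<open>s\<close>, so an affine
  bound in \<open>n\<close> integrates to the same bound in \<open>s\<close>. With
  \<open>g = e = 0\<close> it is the plain bound for bounded sequences.\<close>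

lemma mix_linear_growth:
  assumes s: "s \<ge> 0" and a: "\<And>n. \<bar>a n - n * g\<bar> \<le> n * e + C"
  shows "\<bar>mix s a - s * g\<bar> \<le> s * e + C"
proof -
  have 1: "(\<lambda>n. pois s n * (n * e + C)) sums (s * e + 1 * C)"
    using sums_add[OF sums_mult2[OF pois_mean_sums[of s], of e] sums_mult2[OF pois_sums_1[of s], of C]]
    by (simp add: algebra_simps)
  have bd: "norm (pois s n * (a n - n * g)) \<le> pois s n * (n * e + C)" for n
    using a[of n] s by (auto simp: abs_mult intro!: mult_left_mono)
  have 2: "summable (\<lambda>n. norm (pois s n * (a n - n * g)))"
    by (rule summable_comparison_test'[OF sums_summable[OF 1], of 0]) (use bd in auto)
  have "(\<lambda>n. pois s n * (a n - n * g) + pois s n * n * g) sums ((\<Sum>n. pois s n * (a n - n * g)) + s * g)"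
    using sums_add[OF summable_sums[OF summable_norm_cancel[OF 2]] sums_mult2[OF pois_mean_sums[of s], of g]] .
  then have "mix s a = (\<Sum>n. pois s n * (a n - n * g)) + s * g"
    unfolding mix_def by (simp add: sums_iff algebra_simps)
  moreover have "\<bar>\<Sum>n. pois s n * (a n - n * g)\<bar> \<le> (\<Sum>n. norm (pois s n * (a n - n * g)))"
    using summable_norm[OF 2] by simp
  moreover have "(\<Sum>n. norm (pois s n * (a n - n * g))) \<le> s * e + C"
    using suminf_le[OF bd 2 sums_summable[OF 1]] sums_unique[OF 1] by simp
  ultimately show ?thesis by simp
qed

lemma mix_tendsto:
  assumes "(\<lambda>n. a n / n) \<longlonglongrightarrow> g" "q > 0"
  shows "((\<lambda>t. 1 / t * mix (q * t) a) \<longlongrightarrow> q * g) at_top"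
proof (rule tendstoI)
  fix e :: real assume e: "e > 0"
  \<comment> \<open>Half of the error goes to the linear term \<open>q * t * e'\<close>; the other
    half absorbs \<open>C / t\<close> for large \<open>t\<close>, where \<open>C\<close> covers the
    finitely many early indices.\<close>
  define e' where "e' = e / (2 * q)"
  have e': "e' > 0" using e assms(2) by (simp add: e'_def)
  obtain N where N: "\<And>n. n \<ge> N \<Longrightarrow> \<bar>a n / n - g\<bar> < e'"
    using LIMSEQ_D[OF assms(1) e'] by auto
  define C where "C = (\<Sum>n\<le>N. \<bar>a n - n * g\<bar>)"
  have C: "C \<ge> 0" by (simp add: C_def sum_nonneg)
  have lin: "\<bar>a n - n * g\<bar> \<le> n * e' + C" for n
  proof (cases "n \<le> N")
    case True
    then have "\<bar>a n - n * g\<bar> \<le> C"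
      unfolding C_def by (intro member_le_sum) auto
    then show ?thesis using e' by (simp add: add_increasing)
  next
    case False
    then have "\<bar>(a n - n * g) / n\<bar> < e'" using N[of n] by (simp add: diff_divide_distrib)
    then have "\<bar>a n - n * g\<bar> < n * e'" using False by (simp add: divide_less_eq mult.commute)
    then show ?thesis using C by simp
  qed
  show "\<forall>\<^sub>F t in at_top. dist (1 / t * mix (q * t) a) (q * g) < e"
    using eventually_gt_at_top[of "2 * C / e"] eventually_gt_at_top[of 0]
  proof eventually_elim
    case (elim t)
    have "\<bar>mix (q * t) a - q * t * g\<bar> \<le> q * t * e' + C"
      using elim assms(2) by (intro mix_linear_growth lin) auto
    also have "\<dots> = t * (e / 2) + C" using assms(2) by (simp add: e'_def)
    also have "\<dots> < t * e" using elim e by (simp add: field_simps)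
    finally have "\<bar>mix (q * t) a - q * t * g\<bar> / t < e" using elim by (simp add: divide_less_eq mult.commute)
    moreover have "1 / t * mix (q * t) a - q * g = (mix (q * t) a - q * t * g) / t"
      using elim by (simp add: field_simps)
    ultimately show ?case using elim by (simp add: dist_real_def)
  qed
qed

text \<open>Mean value inequality for one-sided derivatives. If it failed, the last \<open>t\<close>
  with \<open>g t \<le> 0\<close> would lie before \<open>b\<close>, and the negative right
  derivative of \<open>g\<close> there would push this set further to the right.\<close>

lemma right_derivative_upper:
  fixes f :: "real \<Rightarrow> real"
  assumes "a \<le> b" "continuous_on {a..b} f"
    and d: "\<And>t. a \<le> t \<Longrightarrow> t < b \<Longrightarrow> ((\<lambda>h. (f (t + h) - f t) / h) \<longlongrightarrow> f' t) (at_right 0)"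
    and M: "\<And>t. a \<le> t \<Longrightarrow> t < b \<Longrightarrow> f' t < M"
  shows "f b - f a \<le> M * (b - a)"
proof (rule ccontr)
  assume neg: "\<not> ?thesis"
  define g where "g t = f t - f a - M * (t - a)" for t
  have cont: "continuous_on {a..b} g"
    unfolding g_def by (intro continuous_intros assms)
  define S where "S = {t \<in> {a..b}. g t \<le> 0}"
  have "compact S"
    unfolding S_def using continuous_on_closed_Collect_le[OF cont continuous_on_const closed_atLeastAtMost]
    by (auto simp: compact_eq_bounded_closed intro: bounded_subset[of "{a..b}"])
  moreover have "a \<in> S" using assms(1) by (simp add: S_def g_def)
  ultimately obtain t where t: "t \<in> S" "\<And>s. s \<in> S \<Longrightarrow> s \<le> t"
    using compact_attains_sup[of S] by blast
  have tb: "a \<le> t" "t < b" "g t \<le> 0"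
    using t(1) neg by (auto simp: S_def g_def le_less)
  have "((\<lambda>h. (f (t + h) - f t) / h) \<longlongrightarrow> f' t) (at_right 0)" using d tb by simp
  then have "\<forall>\<^sub>F h in at_right 0. (f (t + h) - f t) / h < M"
    using M[OF tb(1,2)] by (rule order_tendstoD)
  moreover have "\<forall>\<^sub>F h in at_right 0. h < b - t" "\<forall>\<^sub>F h in at_right (0::real). 0 < h"
    using tb by (auto intro: eventually_at_right_real eventually_at_rightI[of 0 "b - t"] eventually_at_rightI[of 0 1])
  ultimately have "\<forall>\<^sub>F h in at_right (0::real). False"
  proof eventually_elim
    case (elim h)
    have "g (t + h) - g t < 0"
      using elim by (simp add: g_def divide_less_eq algebra_simps)
    then have "t + h \<in> S" using tb elim by (simp add: S_def)
    then show ?case using t(2)[of "t + h"] elim by simp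
  qed
  then show False by (simp add: trivial_limit_at_right_real)
qed

lemma right_derivative_bound:
  fixes f :: "real \<Rightarrow> real"
  assumes "a \<le> b" "continuous_on {a..b} f"
    and d: "\<And>t. a \<le> t \<Longrightarrow> t < b \<Longrightarrow> ((\<lambda>h. (f (t + h) - f t) / h) \<longlongrightarrow> f' t) (at_right 0)"
    and M: "\<And>t. a \<le> t \<Longrightarrow> t < b \<Longrightarrow> \<bar>f' t\<bar> \<le> M"
  shows "\<bar>f b - f a\<bar> \<le> M * (b - a)"
proof (rule field_le_epsilon)
  fix e :: real assume e: "e > 0"
  \<comment> \<open>The upper bound needs a strict inequality on the derivative, hence
    \<open>M + e'\<close>; adding 1 in the denominator covers \<open>a = b\<close>.\<close>
  define e' where "e' = e / (b - a + 1)"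
  have e': "e' > 0" "e' * (b - a) \<le> e" using assms(1) e by (auto simp: e'_def field_simps)
  have "f b - f a \<le> (M + e') * (b - a)"
    using M e' by (intro right_derivative_upper[OF assms(1,2) d]) (force simp: abs_le_iff)+
  moreover have "(- f b) - (- f a) \<le> (M + e') * (b - a)"
  proof (rule right_derivative_upper[OF assms(1)])
    show "continuous_on {a..b} (\<lambda>t. - f t)" by (intro continuous_intros assms)
    show "((\<lambda>h. (- f (t + h) - - f t) / h) \<longlongrightarrow> - f' t) (at_right 0)" if "a \<le> t" "t < b" for t
      using tendsto_minus[OF d[OF that]] by (simp add: minus_divide_left)
    show "- f' t < M + e'" if "a \<le> t" "t < b" for t using M[OF that] e' by linarith
  qed
  ultimately show "\<bar>f b - f a\<bar> \<le> M * (b - a) + e" using e' by (simp add: abs_le_iff algebra_simps)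
qed

section \<open>The walk in one fixed environment\<close>

locale walk_env =
  fixes c q :: real and \<xi> :: "'d::finite env"
  assumes c_ge_1: "c \<ge> 1" and q_ge: "q \<ge> 4 * real CARD('d) * c" and \<xi>: "\<xi> \<in> env_space c"
begin

lemma q_pos: "q > 0"
proof -
  have "0 < 4 * real CARD('d) * c" using c_ge_1 by simp
  then show ?thesis using q_ge by linarith
qed

lemma step_nonneg:
  assumes "\<And>x. 0 \<le> f x"
  shows "0 \<le> step q \<xi> f x"
proof -
  have "walk_generator \<xi> f x / q \<ge> (- (q / 2) * f x) / q"
    using walk_generator_lower[OF c_ge_1 \<xi> q_ge, of f x] assms q_pos by (intro divide_right_mono) auto
  then show ?thesis using assms[of x] q_pos by (simp add: step_def)
qed

lemma step_diff: "step q \<xi> (\<lambda>x. f x - g x) = (\<lambda>x. step q \<xi> f x - step q \<xi> g x)"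
  using step_add[of q \<xi> f "\<lambda>x. (-1) * g x"] unfolding step_cmult by simp

lemma step_mono: "(\<And>x. f x \<le> g x) \<Longrightarrow> step q \<xi> f x \<le> step q \<xi> g x"
  using step_nonneg[of "\<lambda>x. g x - f x" x] by (simp add: step_diff)

lemma step_pow_mono: "(\<And>x. f x \<le> g x) \<Longrightarrow> (step q \<xi> ^^ n) f x \<le> (step q \<xi> ^^ n) g x"
  by (induction n arbitrary: x) (auto intro: step_mono)

lemma step_const: "step q \<xi> (\<lambda>_. a) = (\<lambda>_. a)"
  by (simp add: step_def walk_generator_def)

lemma step_pow_const: "(step q \<xi> ^^ n) (\<lambda>_. a) = (\<lambda>_. a)"
  by (induction n) (auto simp: step_const)

lemma step_pow_bounded:
  assumes "\<And>x. \<bar>f x\<bar> \<le> B"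
  shows "\<bar>(step q \<xi> ^^ n) f x\<bar> \<le> B"
proof -
  have "f x \<le> B" "- B \<le> f x" for x using assms[of x] by auto
  then have "(step q \<xi> ^^ n) f x \<le> (step q \<xi> ^^ n) (\<lambda>_. B) x" "(step q \<xi> ^^ n) (\<lambda>_. - B) x \<le> (step q \<xi> ^^ n) f x"
    by (intro step_pow_mono; simp)+
  then show ?thesis by (simp add: step_pow_const)
qed

lemma generator_step: "walk_generator \<xi> f x = q * (step q \<xi> f x - f x)"
  using q_pos by (simp add: step_def)

lemma generator_bounded:
  assumes "\<And>x. \<bar>f x\<bar> \<le> B"
  shows "\<bar>walk_generator \<xi> f x\<bar> \<le> 2 * q * B"
proof -
  have "\<bar>step q \<xi> f x - f x\<bar> \<le> 2 * B"
  proof -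
    have "\<bar>step q \<xi> f x\<bar> \<le> B" using step_pow_bounded[of f B 1 x] assms by simp
    then show ?thesis using assms[of x] by linarith
  qed
  then show ?thesis using q_pos by (simp add: generator_step abs_mult)
qed

text \<open>The explicit semigroup exp(t L) = exp(-q t) exp(q t K), obtained by
  uniformization.\<close>

definition sg :: "(int ^ 'd \<Rightarrow> real) \<Rightarrow> real \<Rightarrow> int ^ 'd \<Rightarrow> real" where
  "sg f t x = mix (q * t) (\<lambda>n. (step q \<xi> ^^ n) f x)"

lemma summable_sg:
  assumes "t \<ge> 0" "\<And>x. \<bar>f x\<bar> \<le> B"
  shows "summable (\<lambda>n. pois (q * t) n * (step q \<xi> ^^ n) f x)"
  using summable_pois[of "q * t" "\<lambda>n. (step q \<xi> ^^ n) f x" B 1] step_pow_bounded[where f = f, OF assms(2)] assms(1) q_pos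
  by simp

lemma sg_bounded:
  assumes "t \<ge> 0" "\<And>x. \<bar>f x\<bar> \<le> B"
  shows "\<bar>sg f t x\<bar> \<le> B"
proof -
  have "\<bar>mix (q * t) (\<lambda>n. (step q \<xi> ^^ n) f x) - q * t * 0\<bar> \<le> q * t * 0 + B"
    using assms(1) q_pos step_pow_bounded[where f = f, OF assms(2)] by (intro mix_linear_growth) auto
  then show ?thesis by (simp add: sg_def)
qed

lemma step_sums:
  assumes "\<And>y. (\<lambda>n. f n y) sums g y"
  shows "(\<lambda>n. step q \<xi> (f n) x) sums step q \<xi> g x"
  unfolding step_def walk_generator_def
  by (intro sums_add sums_divide sums_sum sums_mult sums_diff assms)

lemma step_sg:
  assumes "t \<ge> 0" "\<And>x. \<bar>f x\<bar> \<le> B"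
  shows "step q \<xi> (sg f t) x = mix (q * t) (\<lambda>n. (step q \<xi> ^^ Suc n) f x)"
proof -
  have s: "(\<lambda>n. pois (q * t) n * (step q \<xi> ^^ n) f y) sums sg f t y" for y
    using summable_sg[of t f B y] assms by (simp add: sg_def mix_def summable_sums)
  have "(\<lambda>n. step q \<xi> (\<lambda>y. pois (q * t) n * (step q \<xi> ^^ n) f y) x) sums step q \<xi> (sg f t) x"
    by (rule step_sums[OF s])
  then show ?thesis
    unfolding step_cmult by (simp add: mix_def sums_iff)
qed

lemma sg_deriv:
  assumes "t \<ge> 0" "\<And>x. \<bar>f x\<bar> \<le> B"
  shows "((\<lambda>t. sg f t x) has_real_derivative walk_generator \<xi> (sg f t) x) (at t)"
proof -
  have "((\<lambda>s. mix s (\<lambda>n. (step q \<xi> ^^ n) f x)) has_real_derivative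
      mix (q * t) (\<lambda>n. (step q \<xi> ^^ Suc n) f x) - mix (q * t) (\<lambda>n. (step q \<xi> ^^ n) f x)) (at (q * t))"
    using assms(1) q_pos by (intro mix_deriv[OF step_pow_bounded[where f = f, OF assms(2)]]) auto
  from DERIV_chain2[OF this DERIV_cmult[OF DERIV_ident]]
  show ?thesis
    unfolding generator_step step_sg[OF assms] unfolding sg_def
    by (rule DERIV_cong) simp
qed

section \<open>Uniqueness of the transition semigroup\<close>

context
  fixes P assumes P: "transition_semigroup \<xi> P"
begin

definition T :: "real \<Rightarrow> (int ^ 'd \<Rightarrow> real) \<Rightarrow> int ^ 'd \<Rightarrow> real" where
  "T t f x = measure_pmf.expectation (P t x) f"

lemma integrable_bounded:
  fixes p :: "'x pmf" and f :: "'x \<Rightarrow> real"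
  assumes "\<And>x. \<bar>f x\<bar> \<le> B"
  shows "integrable (measure_pmf p) f"
  by (rule measure_pmf.integrable_const_bound[where B = B]) (use assms in auto)

lemma T_bounded:
  assumes "\<And>x. \<bar>f x\<bar> \<le> B"
  shows "\<bar>T t f x\<bar> \<le> B"
proof -
  have "\<bar>T t f x\<bar> \<le> measure_pmf.expectation (P t x) (\<lambda>y. \<bar>f y\<bar>)"
    unfolding T_def by (rule integral_abs_bound)
  also have "\<dots> \<le> measure_pmf.expectation (P t x) (\<lambda>_. B)"
    using assms by (intro integral_mono integrable_bounded[where B = B] integrable_bounded[where B = "\<bar>B\<bar>"]) auto
  finally show ?thesis by simp
qed

lemma T_0: "T 0 f x = f x"
  using P by (simp add: T_def transition_semigroup_def)

lemma T_add:
  assumes "s \<ge> 0" "t \<ge> 0" "\<And>x. \<bar>f x\<bar> \<le> B"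
  shows "T (s + t) f x = T s (T t f) x"
proof -
  have "P (s + t) x = bind_pmf (P s x) (P t)"
    using P assms(1,2) by (simp add: transition_semigroup_def)
  then show ?thesis
    unfolding T_def
    by (simp add: measure_pmf_bind, subst integral_bind[where K = "count_space UNIV" and B = B and B' = 1])
       (use assms(3) in \<open>auto simp: measure_pmf_in_subprob_space measure_pmf.emeasure_space_1 intro: measure_pmf.finite_measure\<close>)
qed

text \<open>The backward equation: the generator is prescribed only at time 0, and the semigroup law
  transports it to time \<open>t\<close>, with \<open>T t f\<close> as the new bounded
  function.\<close>

lemma T_right_deriv:
  assumes "t \<ge> 0" "\<And>x. \<bar>f x\<bar> \<le> B"
  shows "((\<lambda>h. (T (t + h) f x - T t f x) / h) \<longlongrightarrow> walk_generator \<xi> (T t f) x) (at_right 0)"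
proof -
  have "bounded (range (T t f))"
    using T_bounded[where f = f, OF assms(2)] by (auto simp: bounded_iff)
  then have "((\<lambda>h. (T h (T t f) x - T t f x) / h) \<longlongrightarrow> walk_generator \<xi> (T t f) x) (at_right 0)"
    using P unfolding transition_semigroup_def T_def[symmetric] by blast
  moreover have "\<forall>\<^sub>F h in at_right 0. (T h (T t f) x - T t f x) / h = (T (t + h) f x - T t f x) / h"
    unfolding eventually_at_right_field
    by (rule exI[of _ 1]) (use T_add[where f = f, OF _ assms(1,2)] in \<open>auto simp: add.commute[of t]\<close>)
  ultimately show ?thesis by (rule tendsto_cong[THEN iffD1, rotated])
qed

text \<open>The return probability is supermultiplicative in \<open>t\<close>, so its derivative at \<open>0\<close> controls it for all times.\<close>

lemma return_prob_ge:
  assumes t: "t \<ge> 0"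
  shows "1 - q * t \<le> pmf (P t x) x"
proof -
  define a where "a t = pmf (P t x) x" for t
  have a_eq: "a t = T t (indicator {x}) x" for t
    by (simp add: a_def T_def pmf.rep_eq)
  have mult: "a (s + t) \<ge> a s * a t" if "s \<ge> 0" "t \<ge> 0" for s t
  proof -
    have "a s * a t = measure_pmf.expectation (P s x) (\<lambda>y. indicator {x} y * a t)"
      using a_eq[of s] by (simp add: T_def)
    also have "\<dots> \<le> measure_pmf.expectation (P s x) (\<lambda>y. T t (indicator {x}) y)"
    proof (rule integral_mono)
      show "integrable (measure_pmf (P s x)) (\<lambda>y. indicator {x} y * a t)"
        by (rule integrable_bounded[where B = 1]) (auto simp: a_def pmf_le_1 split: split_indicator)
      show "integrable (measure_pmf (P s x)) (T t (indicator {x}))"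
        by (rule integrable_bounded[where B = 1]) (rule T_bounded, simp split: split_indicator)
      fix y
      show "indicator {x} y * a t \<le> T t (indicator {x}) y"
        by (cases "y = x") (auto simp: a_eq T_def)
    qed
    also have "\<dots> = a (s + t)"
      unfolding a_eq by (subst T_add[where B = 1, OF that]) (auto simp: T_def split: split_indicator)
    finally show ?thesis .
  qed
  have pow: "a (real n * s) \<ge> a s ^ n" if "s \<ge> 0" for n s
  proof (induction n)
    case 0
    show ?case using a_eq[of 0] by (simp add: T_0)
  next
    case (Suc n)
    have "a s ^ Suc n = a (s) * a s ^ n" by simp
    also have "\<dots> \<le> a s * a (real n * s)" using Suc by (intro mult_left_mono) (auto simp: a_def)
    also have "\<dots> \<le> a (s + real n * s)" by (rule mult) (use that in auto)
    finally show ?case by (simp add: algebra_simps)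
  qed
  have "((\<lambda>h. (T (0 + h) (indicator {x}) x - T 0 (indicator {x}) x) / h) \<longlongrightarrow> walk_generator \<xi> (T 0 (indicator {x})) x) (at_right 0)"
    by (rule T_right_deriv[where B = 1]) (auto split: split_indicator)
  then have "((\<lambda>h. (a h - 1) / h) \<longlongrightarrow> walk_generator \<xi> (indicator {x}) x) (at_right 0)"
    by (simp add: a_eq T_0 T_0[abs_def, unfolded fun_eq_iff] ext[of "T 0 (indicator {x})" "indicator {x}"])
  moreover have "walk_generator \<xi> (indicator {x}) x > - q"
    using walk_generator_lower[OF c_ge_1 \<xi> q_ge, of "indicator {x}" x] q_pos by simp
  ultimately have "\<forall>\<^sub>F h in at_right 0. - q < (a h - 1) / h"
    by (rule order_tendstoD)
  then obtain b where b: "b > 0" "\<And>h. 0 < h \<Longrightarrow> h < b \<Longrightarrow> - q < (a h - 1) / h"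
    unfolding eventually_at_right_field by auto
  show ?thesis
  proof (cases "t = 0")
    case True
    then show ?thesis using a_eq[of 0] by (simp add: a_def T_0)
  next
    case False
    \<comment> \<open>The first summand brings \<open>t / n\<close> into the range where the
      derivative at 0 controls \<open>a\<close>; the second makes \<open>1 - q * h\<close>
      nonnegative for monotonicity of powers and for Bernoulli's inequality.\<close>
    obtain n :: nat where n: "real n > t / b + q * t" "n > 0"
    proof -
      obtain m :: nat where "real m > t / b + q * t" using reals_Archimedean2 by blast
      then show ?thesis by (intro that[of "Suc m"]) auto
    qed
    define h where "h = t / n"
    have h: "h > 0" "h < b" "q * h \<le> 1"
    proof -
      have tb: "t / b > 0" "q * t > 0" using False t b q_pos by auto
      then have "t / b < n" "q * t < n" using n by linarith+
      then show "h > 0" "h < b" "q * h \<le> 1"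
        using n(2) False t b by (auto simp: h_def field_simps)
    qed
    have "1 - q * h \<le> a h" using b(2)[OF h(1,2)] h(1) by (simp add: field_simps)
    then have "(1 - q * h) ^ n \<le> a h ^ n" using h by (intro power_mono) auto
    also have "\<dots> \<le> a (real n * h)" using h by (intro pow) auto
    also have "real n * h = t" using n by (simp add: h_def)
    finally have "(1 + - (q * h)) ^ n \<le> a t" by simp
    moreover have "1 + real n * (- (q * h)) \<le> (1 + - (q * h)) ^ n"
      using h by (intro Bernoulli_inequality) auto
    moreover have "real n * (q * h) = q * t" using n by (simp add: h_def)
    ultimately show ?thesis by (simp add: a_def)
  qed
qed

text \<open>The walk is found at its start with probability at least \<open>1 - q * h\<close>,
  uniformly in \<open>x\<close>. This supplies the continuity in time that the pointwise definition
  of the semigroup does not state.\<close>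

lemma T_near_identity:
  assumes h: "h \<ge> 0" and f: "\<And>x. \<bar>f x\<bar> \<le> B"
  shows "\<bar>T h f x - f x\<bar> \<le> 2 * B * (q * h)"
proof -
  have B: "B \<ge> 0" using f[of x] by linarith
  have "T h f x - f x = measure_pmf.expectation (P h x) (\<lambda>y. f y - f x)"
    unfolding T_def using integrable_bounded[where f = f, OF f] by simp
  also have "\<bar>\<dots>\<bar> \<le> measure_pmf.expectation (P h x) (\<lambda>y. \<bar>f y - f x\<bar>)"
    by (rule integral_abs_bound)
  also have "\<dots> \<le> measure_pmf.expectation (P h x) (\<lambda>y. 2 * B * (1 - indicator {x} y))"
  proof (rule integral_mono)
    show "integrable (measure_pmf (P h x)) (\<lambda>y. \<bar>f y - f x\<bar>)"
    proof (rule integrable_bounded[where B = "2 * B"])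
      fix y show "\<bar>\<bar>f y - f x\<bar>\<bar> \<le> 2 * B" using f[of y] f[of x] by linarith
    qed
    show "integrable (measure_pmf (P h x)) (\<lambda>y. 2 * B * (1 - indicator {x} y))"
      by (rule integrable_bounded[where B = "2 * B"]) (use B in \<open>auto split: split_indicator\<close>)
    fix y show "\<bar>f y - f x\<bar> \<le> 2 * B * (1 - indicator {x} y)"
      using f[of y] f[of x] by (auto split: split_indicator)
  qed
  also have "\<dots> = 2 * B * (1 - pmf (P h x) x)"
    by (subst integral_mult_right_zero, subst Bochner_Integration.integral_diff)
       (auto simp: pmf.rep_eq intro!: integrable_bounded[where B = 1] split: split_indicator)
  also have "\<dots> \<le> 2 * B * (q * h)"
    using return_prob_ge[OF h, of x] B by (intro mult_left_mono) auto
  finally show ?thesis .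
qed

lemma T_Lipschitz:
  assumes "s \<ge> 0" "h \<ge> 0" "\<And>x. \<bar>f x\<bar> \<le> B"
  shows "\<bar>T (s + h) f x - T s f x\<bar> \<le> 2 * B * q * h"
  using T_near_identity[where f = "T s f", OF assms(2) T_bounded[where f = f, OF assms(3)]] T_add[where f = f, OF assms(2,1,3)]
  by (simp add: add.commute mult.assoc)

lemma T_continuous:
  assumes f: "\<And>x. \<bar>f x\<bar> \<le> B"
  shows "continuous_on {0..} (\<lambda>t. T t f x)"
proof -
  have le: "\<bar>T t f x - T s f x\<bar> \<le> 2 * B * q * (t - s)" if "0 \<le> s" "s \<le> t" for s t
    using T_Lipschitz[where f = f, OF that(1) _ f, of "t - s"] that by simp
  have "B \<ge> 0" using f[of x] by linarith
  then have "(2 * B * q)-lipschitz_on {0..} (\<lambda>t. T t f x)"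
  proof (intro lipschitz_onI)
    fix s t :: real assume "s \<in> {0..}" "t \<in> {0..}"
    then show "dist (T s f x) (T t f x) \<le> 2 * B * q * dist s t"
      using le[of s t] le[of t s] by (cases "s \<le> t") (auto simp: dist_real_def abs_minus_commute)
  qed (use q_pos in auto)
  then show ?thesis by (rule lipschitz_on_continuous_on)
qed

text \<open>Uniqueness for an ODE with bounded generator, in the supremum norm over all sites: both
  semigroups solve the same equation from the same datum.\<close>

lemma T_eq_sg:
  assumes f: "\<And>x. \<bar>f x\<bar> \<le> B" and "t \<ge> 0"
  shows "T t f x = sg f t x"
proof -
  define d where "d t x = T t f x - sg f t x" for t x
  have B: "B \<ge> 0" using f[of x] by linarith
  have d_cont: "continuous_on {0..} (\<lambda>t. d t x)" for x
    unfolding d_def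
    by (intro continuous_on_diff T_continuous[where f = f, OF f] continuous_at_imp_continuous_on)
       (auto intro: DERIV_isCont sg_deriv[where f = f, OF _ f])
  have d_deriv: "((\<lambda>h. (d (t + h) x - d t x) / h) \<longlongrightarrow> walk_generator \<xi> (d t) x) (at_right 0)"
    if "t \<ge> 0" for t x
  proof -
    have "((\<lambda>h. (sg f (t + h) x - sg f t x) / h) \<longlongrightarrow> walk_generator \<xi> (sg f t) x) (at_right 0)"
      using sg_deriv[where f = f, OF that f, of x] unfolding DERIV_def by (rule tendsto_mono[rotated]) (simp add: at_le)
    from tendsto_diff[OF T_right_deriv[where f = f, OF that f, of x] this]
    have "((\<lambda>h. (d (t + h) x - d t x) / h) \<longlongrightarrow> walk_generator \<xi> (T t f) x - walk_generator \<xi> (sg f t) x) (at_right 0)"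
      unfolding diff_divide_distrib[symmetric] by (simp add: d_def algebra_simps)
    also have "walk_generator \<xi> (T t f) x - walk_generator \<xi> (sg f t) x = walk_generator \<xi> (d t) x"
      by (simp add: generator_step d_def[abs_def] step_diff algebra_simps)
    finally show ?thesis .
  qed
  \<comment> \<open>The generator has norm at most \<open>2 * q\<close>, so over a time span
    \<open>h\<close> each iteration halves the bound on \<open>d\<close>, which starts at
    \<open>2 * B\<close>.\<close>
  define h where "h = 1 / (4 * q)"
  have h: "h > 0" using q_pos by (simp add: h_def)
  have extend: "d t x = 0" if a: "a \<ge> 0" "\<And>x. d a x = 0" and t: "a \<le> t" "t \<le> a + h" for a t x
  proof -
    have "\<bar>d t x\<bar> \<le> 2 * B * (1 / 2) ^ n" if "a \<le> t" "t \<le> a + h" for n t x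
      using that
    proof (induction n arbitrary: t x)
      case 0
      have "\<bar>T t f x\<bar> \<le> B" "\<bar>sg f t x\<bar> \<le> B"
        using T_bounded[where f = f, OF f] sg_bounded[where f = f, OF _ f] 0 a by auto
      then show ?case by (simp add: d_def)
    next
      case (Suc n)
      have "\<bar>d t x - d a x\<bar> \<le> (2 * q * (2 * B * (1 / 2) ^ n)) * (t - a)"
      proof (rule right_derivative_bound[OF Suc.prems(1)])
        show "continuous_on {a..t} (\<lambda>t. d t x)"
          by (rule continuous_on_subset[OF d_cont]) (use a in auto)
        fix s assume s: "a \<le> s" "s < t"
        show "((\<lambda>h. (d (s + h) x - d s x) / h) \<longlongrightarrow> walk_generator \<xi> (d s) x) (at_right 0)"
          by (rule d_deriv) (use s a in auto)
        show "\<bar>walk_generator \<xi> (d s) x\<bar> \<le> 2 * q * (2 * B * (1 / 2) ^ n)"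
          by (intro generator_bounded Suc.IH) (use s Suc.prems in auto)
      qed
      also have "\<dots> \<le> (2 * q * (2 * B * (1 / 2) ^ n)) * h"
        using Suc.prems q_pos B by (intro mult_left_mono) auto
      also have "\<dots> = 2 * B * (1 / 2) ^ Suc n" using q_pos by (simp add: h_def)
      finally show ?case using a by simp
    qed
    then have "\<bar>d t x\<bar> \<le> 2 * B * (1 / 2) ^ n" for n using t by blast
    moreover have "(\<lambda>n. 2 * B * (1 / 2) ^ n) \<longlonglongrightarrow> 2 * B * 0"
      by (intro tendsto_intros LIMSEQ_power_zero) auto
    ultimately have "\<bar>d t x\<bar> \<le> 2 * B * 0" by (intro LIMSEQ_le_const) auto
    then show ?thesis by simp
  qed
  have "d t x = 0" if "0 \<le> t" "t \<le> real k * h" for k t x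
    using that
  proof (induction k arbitrary: t x)
    case 0
    then show ?case by (simp add: d_def T_0 sg_def)
  next
    case (Suc k)
    show ?case
    proof (cases "t \<le> real k * h")
      case True
      then show ?thesis using Suc by blast
    next
      case False
      have "real k * h \<ge> 0" using h by simp
      then show ?thesis
        using extend[of "real k * h" t x] Suc.IH[of "real k * h"] False Suc.prems by (auto simp: algebra_simps)
    qed
  qed
  moreover obtain k :: nat where "real k \<ge> t / h" using real_arch_simple by blast
  moreover from this have "t \<le> real k * h" using h by (simp add: field_simps)
  ultimately show ?thesis using \<open>t \<ge> 0\<close> by (simp add: d_def)
qed

end

text \<open>The Markov property is used at time 0 only: integrating the conditional expectation
  given the past at 0 leaves the semigroup at the almost surely fixed starting point.\<close>

lemma random_walk_expectation:
  fixes M :: "'w measure"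
  assumes rw: "random_walk \<xi> x M X" and t: "t \<ge> 0" and f: "\<And>x. \<bar>f x\<bar> \<le> B"
  shows "(\<integral>\<omega>. f (X t \<omega>) \<partial>M) = sg f t x"
proof -
  interpret M: prob_space M using rw by (simp add: random_walk_def)
  have X [measurable]: "X s \<in> measurable M (count_space UNIV)" if "s \<ge> 0" for s
    using rw that by (simp add: random_walk_def)
  have X0: "AE \<omega> in M. X 0 \<omega> = x" using rw by (simp add: random_walk_def)
  obtain P where P: "transition_semigroup \<xi> P"
    and "\<forall>s\<ge>0. \<forall>t\<ge>0. \<forall>f. bounded (range f) \<longrightarrow>
           (AE \<omega> in M. real_cond_exp M (past M X s) (\<lambda>\<omega>. f (X (s + t) \<omega>)) \<omega>
                        = measure_pmf.expectation (P t (X s \<omega>)) f)"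
    using rw unfolding random_walk_def by blast
  moreover have "bounded (range f)" using f by (auto simp: bounded_iff)
  ultimately have ce: "AE \<omega> in M. real_cond_exp M (past M X 0) (\<lambda>\<omega>. f (X (0 + t) \<omega>)) \<omega>
                        = measure_pmf.expectation (P t (X 0 \<omega>)) f"
    using t by blast
  let ?F = "past M X 0"
  have sub: "subalgebra M ?F"
    unfolding subalgebra_def past_def
  proof
    have gens: "{X u -` C \<inter> space M |u C. 0 \<le> u \<and> u \<le> 0} \<subseteq> sets M"
      using measurable_sets[OF X] by auto
    then have "{X u -` C \<inter> space M |u C. 0 \<le> u \<and> u \<le> 0} \<subseteq> Pow (space M)" by auto
    then show "sets (sigma (space M) {X u -` C \<inter> space M |u C. 0 \<le> u \<and> u \<le> 0}) \<subseteq> sets M"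
      using gens by (simp add: sets.sigma_sets_subset)
  qed (simp add: space_measure_of_conv)
  interpret F: finite_measure_subalgebra M ?F
    by unfold_locales (rule sub)
  have intf: "integrable M (\<lambda>\<omega>. f (X t \<omega>))"
    by (rule M.integrable_const_bound[where B = B]) (use f X[OF t] in auto)
  have "(\<integral>\<omega>. f (X t \<omega>) \<partial>M) = (\<integral>\<omega>. real_cond_exp M ?F (\<lambda>\<omega>. f (X t \<omega>)) \<omega> \<partial>M)"
    using F.real_cond_exp_int(2)[OF intf] by simp
  also have "\<dots> = (\<integral>\<omega>. measure_pmf.expectation (P t x) f \<partial>M)"
    by (rule integral_cong_AE) (use ce X0 in auto)
  also have "\<dots> = sg f t x"
    using T_eq_sg[where f = f, OF P f t] by (simp add: T_def[OF P] M.prob_space)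
  finally show ?thesis .
qed

section \<open>Second moments of the walk\<close>

definition moment_base :: "real ^ 'd \<Rightarrow> real" where
  "moment_base v = 1 + (\<Sum>i\<in>UNIV. 2 * c * (1 + 2 * (v $ i)\<^sup>2)) / q"

lemma moment_nonneg: "0 \<le> (step q \<xi> ^^ n) (\<lambda>x. (proj v x)\<^sup>2) x"
  using step_pow_mono[of "\<lambda>_. 0" "\<lambda>x. (proj v x)\<^sup>2" n x] by (simp add: step_pow_const)

text \<open>The Lyapunov function 1 + (x . v)^2 grows by at most the factor
  \<open>moment_base v\<close> per step, because the generator of it is bounded by a multiple of it.
  Geometric growth is harmless under Poisson weights.\<close>

lemma moment_le: "(step q \<xi> ^^ n) (\<lambda>x. (proj v x)\<^sup>2) x \<le> moment_base v ^ n * (1 + (proj v x)\<^sup>2)"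
proof -
  let ?g = "\<lambda>x. 1 + (proj v x)\<^sup>2"
  have le: "step q \<xi> ?g x \<le> moment_base v * ?g x" for x
  proof -
    have bd: "\<xi> b * ((1 + (proj v x + a)\<^sup>2) - ?g x) \<le> c * (1 + 2 * a\<^sup>2) * ?g x" for a b
    proof -
      have \<xi>b: "0 \<le> \<xi> b" "\<xi> b \<le> c" using env_space_bounds[OF \<xi> c_ge_1] by auto
      have "(proj v x + a)\<^sup>2 \<le> 2 * (proj v x)\<^sup>2 + 2 * a\<^sup>2"
        using zero_le_power2[of "proj v x - a"] by (simp add: power2_sum power2_diff)
      then have "(1 + (proj v x + a)\<^sup>2) - ?g x \<le> (proj v x)\<^sup>2 + 2 * a\<^sup>2" by simp
      also have "\<dots> \<le> (1 + 2 * a\<^sup>2) * ?g x"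
        by (simp add: algebra_simps)
      finally have "\<xi> b * ((1 + (proj v x + a)\<^sup>2) - ?g x) \<le> \<xi> b * ((1 + 2 * a\<^sup>2) * ?g x)"
        using \<xi>b(1) by (rule mult_left_mono)
      also have "\<dots> \<le> c * ((1 + 2 * a\<^sup>2) * ?g x)"
        using \<xi>b by (intro mult_right_mono) auto
      finally show ?thesis by (simp add: mult.assoc)
    qed
    have "walk_generator \<xi> ?g x \<le> (\<Sum>i\<in>UNIV. c * (1 + 2 * (v $ i)\<^sup>2) * ?g x + c * (1 + 2 * (v $ i)\<^sup>2) * ?g x)"
      unfolding walk_generator_def
    proof (intro sum_mono add_mono)
      fix i :: 'd
      show "\<xi> (x, i) * (1 + (proj v (x + unit_vec i))\<^sup>2 - ?g x) \<le> c * (1 + 2 * (v $ i)\<^sup>2) * ?g x"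
        using bd[of "(x, i)" "v $ i"] by (simp add: proj_add)
      show "\<xi> (x - unit_vec i, i) * (1 + (proj v (x - unit_vec i))\<^sup>2 - ?g x) \<le> c * (1 + 2 * (v $ i)\<^sup>2) * ?g x"
        using bd[of "(x - unit_vec i, i)" "- (v $ i)"] by (simp add: proj_diff)
    qed
    also have "\<dots> = (\<Sum>i\<in>UNIV. 2 * c * (1 + 2 * (v $ i)\<^sup>2)) * ?g x"
      by (simp only: sum_distrib_right) (simp add: algebra_simps)
    finally have "walk_generator \<xi> ?g x / q \<le> (\<Sum>i\<in>UNIV. 2 * c * (1 + 2 * (v $ i)\<^sup>2)) * ?g x / q"
      using q_pos by (intro divide_right_mono) auto
    then show ?thesis by (simp add: step_def moment_base_def distrib_right)
  qed
  have "(step q \<xi> ^^ n) ?g x \<le> moment_base v ^ n * ?g x"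
  proof (induction n arbitrary: x)
    case (Suc n)
    have "0 \<le> (\<Sum>i\<in>UNIV. 2 * c * (1 + 2 * (v $ i)\<^sup>2)) / q"
      using c_ge_1 q_pos by (intro divide_nonneg_nonneg sum_nonneg) auto
    then have mb: "0 \<le> moment_base v" by (simp add: moment_base_def)
    have "(step q \<xi> ^^ Suc n) ?g x \<le> step q \<xi> (\<lambda>x. moment_base v ^ n * ?g x) x"
      using Suc by (auto intro: step_mono)
    also have "\<dots> = moment_base v ^ n * step q \<xi> ?g x" by (simp only: step_cmult)
    also have "\<dots> \<le> moment_base v ^ n * (moment_base v * ?g x)"
      using le[of x] mb by (intro mult_left_mono) auto
    finally show ?case by (simp add: algebra_simps)
  qed simp
  moreover have "(step q \<xi> ^^ n) (\<lambda>x. (proj v x)\<^sup>2) x \<le> (step q \<xi> ^^ n) ?g x"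
    by (rule step_pow_mono) simp
  ultimately show ?thesis by linarith
qed

lemma step_tendsto:
  assumes "\<And>x. (\<lambda>k. f k x) \<longlonglongrightarrow> g x"
  shows "(\<lambda>k. step q \<xi> (f k) x) \<longlonglongrightarrow> step q \<xi> g x"
  unfolding step_def walk_generator_def using q_pos by (intro tendsto_intros assms) auto

lemma step_pow_tendsto:
  assumes "\<And>x. (\<lambda>k. f k x) \<longlonglongrightarrow> g x"
  shows "(\<lambda>k. (step q \<xi> ^^ n) (f k) x) \<longlonglongrightarrow> (step q \<xi> ^^ n) g x"
  by (induction n arbitrary: x) (auto intro: step_tendsto assms)

text \<open>The semigroup formula covers bounded functions, so (x . v)^2 is truncated at level
  \<open>k\<close>. The limit is taken by monotone convergence for the walk and by dominated
  convergence in the Poisson series.\<close>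

lemma random_walk_second_moment:
  fixes M :: "'w measure"
  assumes rw: "random_walk \<xi> 0 M X" and t: "t \<ge> 0"
  shows "(\<integral>\<omega>. (real_vec (X t \<omega>) \<bullet> v)\<^sup>2 \<partial>M) = mix (q * t) (\<lambda>n. moment q v n \<xi>)"
proof -
  interpret M: prob_space M using rw by (simp add: random_walk_def)
  have X [measurable]: "X t \<in> measurable M (count_space UNIV)"
    using rw t by (simp add: random_walk_def)
  let ?w = "\<lambda>x. (proj v x)\<^sup>2"
  define w where "w k x = min (?w x) (real k)" for k x
  have w: "\<bar>w k x\<bar> \<le> real k" for k x by (auto simp: w_def)
  have w_lim: "(\<lambda>k. w k x) \<longlonglongrightarrow> ?w x" for x
  proof (rule tendsto_eventually)
    obtain k0 :: nat where "real k0 \<ge> ?w x" using real_arch_simple by blast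
    then show "\<forall>\<^sub>F k in sequentially. w k x = ?w x"
      by (intro eventually_sequentiallyI[of k0]) (auto simp: w_def min_def intro: antisym order_trans)
  qed
  have "(\<lambda>k. mix (q * t) (\<lambda>n. (step q \<xi> ^^ n) (w k) 0)) \<longlonglongrightarrow> mix (q * t) (\<lambda>n. moment q v n \<xi>)"
    unfolding mix_def
  proof (rule tannerys_theorem[THEN conjunct2, THEN conjunct2])
    show "(\<lambda>k. pois (q * t) n * (step q \<xi> ^^ n) (w k) 0) \<longlonglongrightarrow> pois (q * t) n * moment q v n \<xi>" for n
      unfolding moment_def by (intro tendsto_intros step_pow_tendsto w_lim)
    show "summable (\<lambda>n. pois (q * t) n * (1 * moment_base v ^ n))"
      by (rule summable_pois_geometric)
    have "norm (pois (q * t) n * (step q \<xi> ^^ n) (w k) 0) \<le> pois (q * t) n * (1 * moment_base v ^ n)" for n k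
    proof -
      have "(step q \<xi> ^^ n) (w k) 0 \<le> (step q \<xi> ^^ n) ?w 0" "(step q \<xi> ^^ n) (\<lambda>_. 0) 0 \<le> (step q \<xi> ^^ n) (w k) 0"
        by (intro step_pow_mono; simp add: w_def)+
      then have "\<bar>(step q \<xi> ^^ n) (w k) 0\<bar> \<le> moment_base v ^ n"
        using moment_le[of n v 0] by (simp add: step_pow_const)
      then show ?thesis using t q_pos by (simp add: abs_mult mult_left_mono)
    qed
    then show "\<forall>\<^sub>F (n, k) in sequentially \<times>\<^sub>F sequentially.
        norm (pois (q * t) n * (step q \<xi> ^^ n) (w k) 0) \<le> pois (q * t) n * (1 * moment_base v ^ n)"
      by (intro always_eventually) auto
  qed simp
  then have "(\<lambda>k. \<integral>\<omega>. w k (X t \<omega>) \<partial>M) \<longlonglongrightarrow> mix (q * t) (\<lambda>n. moment q v n \<xi>)"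
    by (simp add: random_walk_expectation[OF rw t, where f = "w _", OF w] sg_def)
  then have "(\<integral>\<omega>. ?w (X t \<omega>) \<partial>M) = mix (q * t) (\<lambda>n. moment q v n \<xi>)"
  proof (rule integral_monotone_convergence[rotated 3])
    show "integrable M (\<lambda>\<omega>. w k (X t \<omega>))" for k
      by (rule M.integrable_const_bound[where B = "real k"]) (use w in auto)
    show "AE \<omega> in M. mono (\<lambda>k. w k (X t \<omega>))" by (auto simp: mono_def w_def)
    show "AE \<omega> in M. (\<lambda>k. w k (X t \<omega>)) \<longlonglongrightarrow> ?w (X t \<omega>)" using w_lim by auto
  qed auto
  then show ?thesis by (simp add: proj_def)
qed

end

section \<open>Stability of the effective form\<close>

lemma LIMSEQ_0_obtain_less:
  fixes x :: "nat \<Rightarrow> real"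
  assumes "x \<longlonglongrightarrow> 0" "e > 0"
  obtains m where "x m < e"
  using order_tendstoD(2)[OF assms] by (auto simp: eventually_sequentially)

context stationary_mean
begin

text \<open>Two fluxes differ by \<xi> times the gradient of a later block of the Neumann sum, whose
  energy is a tail. Hence the fluxes form a Cauchy sequence.\<close>

lemma nrm_flux_diff_le:
  "nrm (\<lambda>\<xi>. flux q v (n + m) i \<xi> - flux q v n i \<xi>) \<le> sqrt (c * (1 / q * tail v (2 * n)))"
proof -
  let ?\<psi> = "corrector q (drift v) n m"
  have sum: "corrector q (drift v) 0 (n + m) \<xi> = corrector q (drift v) 0 n \<xi> + ?\<psi> \<xi>" for \<xi>
    unfolding corrector_def by (simp only: sum_lessThan_add distrib_left add_0_left)
  have "flux q v (n + m) i \<xi> - flux q v n i \<xi> = \<xi> (0, i) * grad i ?\<psi> \<xi>" for \<xi>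
    unfolding flux_def grad_def sum by (simp add: algebra_simps)
  then have "E (\<lambda>\<xi>. (flux q v (n + m) i \<xi> - flux q v n i \<xi>)\<^sup>2) = E (\<lambda>\<xi>. (\<xi> (0, i) * grad i ?\<psi> \<xi>)\<^sup>2)"
    by simp
  also have "\<dots> \<le> E (\<lambda>\<xi>. c * (\<xi> (0, i) * grad i ?\<psi> \<xi> * grad i ?\<psi> \<xi>))"
  proof (rule E_mono)
    fix \<xi> :: "'d env" assume "\<xi> \<in> env_space c"
    then have "\<xi> (0, i) * (\<xi> (0, i) * (grad i ?\<psi> \<xi>)\<^sup>2) \<le> c * (\<xi> (0, i) * (grad i ?\<psi> \<xi>)\<^sup>2)"
      by (intro mult_right_mono) (auto simp: env_bounds)
    then show "(\<xi> (0, i) * grad i ?\<psi> \<xi>)\<^sup>2 \<le> c * (\<xi> (0, i) * grad i ?\<psi> \<xi> * grad i ?\<psi> \<xi>)"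
      by (simp add: power2_eq_square mult_ac)
  qed auto
  also have "\<dots> = c * E (\<lambda>\<xi>. \<xi> (0, i) * grad i ?\<psi> \<xi> * grad i ?\<psi> \<xi>)" by (rule E_cmult) auto
  also have "\<dots> \<le> c * Dir ?\<psi> ?\<psi>"
    unfolding Dir_def using c_ge_1
    by (intro mult_left_mono member_le_sum) (auto intro!: E_nonneg simp: mult.assoc env_bounds)
  also have "\<dots> \<le> c * (1 / q * tail v (2 * n))"
    using Dir_corrector_le_tail c_ge_1 by (intro mult_left_mono) auto
  finally show ?thesis unfolding nrm_def by (rule real_sqrt_le_mono)
qed

lemma mollify_diff: "mollify B (\<lambda>\<xi>. F \<xi> - G \<xi>) \<xi> = mollify B F \<xi> - mollify B G \<xi>"
  by (simp add: mollify_def sum_subtractf right_diff_distrib)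

lemma abs_E_le_nrm: "F \<in> env_poly \<Longrightarrow> \<bar>E F\<bar> \<le> nrm F"
  using E_mult_le_nrm[of F "\<lambda>_. 1"] by (simp add: nrm_def)

text \<open>Averaging does not increase the norm, so \<open>n\<close> may be replaced by a fixed
  smaller \<open>m\<close> at a cost independent of \<open>B\<close> and of
  \<open>n\<close>.\<close>

lemma nrm_mollify_flux_le:
  assumes B: "finite B" "B \<noteq> {}" and "m \<le> n"
  shows "nrm (\<lambda>\<xi>. mollify B (flux q v n i) \<xi> - E (flux q v n i))
    \<le> nrm (\<lambda>\<xi>. mollify B (flux q v m i) \<xi> - E (flux q v m i)) + 2 * sqrt (c * (1 / q * tail v (2 * m)))"
proof -
  define D where "D = (\<lambda>\<xi>. flux q v n i \<xi> - flux q v m i \<xi>)"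
  have [simp]: "D \<in> env_poly" by (simp add: D_def)
  have D: "nrm D \<le> sqrt (c * (1 / q * tail v (2 * m)))"
    using nrm_flux_diff_le[of v m "n - m" i] \<open>m \<le> n\<close> by (simp add: D_def)
  have "nrm (\<lambda>\<xi>. mollify B (flux q v n i) \<xi> - E (flux q v n i))
    = nrm (\<lambda>\<xi>. (mollify B (flux q v m i) \<xi> - E (flux q v m i)) + (mollify B D \<xi> + (- E D)))"
    by (simp add: D_def mollify_diff E_diff algebra_simps)
  also have "\<dots> \<le> nrm (\<lambda>\<xi>. mollify B (flux q v m i) \<xi> - E (flux q v m i)) + nrm (\<lambda>\<xi>. mollify B D \<xi> + (- E D))"
    by (rule nrm_add_le) auto
  also have "nrm (\<lambda>\<xi>. mollify B D \<xi> + (- E D)) \<le> nrm (mollify B D) + nrm (\<lambda>_. - E D)"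
    by (rule nrm_add_le) auto
  also have "nrm (mollify B D) \<le> nrm D" using B by (intro nrm_mollify_le) auto
  also have "nrm (\<lambda>_. - E D) = \<bar>E D\<bar>" by (simp add: nrm_def)
  also have "\<bar>E D\<bar> \<le> nrm D" by (rule abs_E_le_nrm) simp
  finally show ?thesis using D by simp
qed

definition tail_error :: "(int ^ 'd) set \<Rightarrow> real \<Rightarrow> real ^ 'd \<Rightarrow> nat \<Rightarrow> ('d \<Rightarrow> real) \<Rightarrow> real" where
  "tail_error B r v n p =
    (r * sqrt (drift_corr v (2 * n)) + (\<Sum>i\<in>UNIV. nrm (\<lambda>\<xi>. mollify B (flux q v n i) \<xi> - p i)))
    * sqrt (c * mean_energy v)"

text \<open>The choice n = R^2 balances the two terms: R times the root of the correlation at 2R^2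
  is at most the root of the tail at R^2, and in the flux term a fixed order \<open>m\<close> is
  averaged over growing cells.\<close>

lemma tail_error_tendsto_0:
  assumes B: "\<And>R. finite (B R)" "\<And>R. B R \<noteq> {}"
    and erg: "\<And>F. F \<in> env_poly \<Longrightarrow> (\<lambda>R. nrm (\<lambda>\<xi>. mollify (B R) F \<xi> - E F)) \<longlonglongrightarrow> 0"
  shows "(\<lambda>R. tail_error (B R) (a * real R) v (R\<^sup>2) (\<lambda>i. E (flux q v (R\<^sup>2) i))) \<longlonglongrightarrow> 0"
proof -
  have sq: "filterlim (\<lambda>R::nat. R\<^sup>2) sequentially sequentially"
    by (rule filterlim_at_top_mono[OF filterlim_ident]) (auto simp: power2_eq_square)
  have tail0: "(\<lambda>R. tail v (R\<^sup>2)) \<longlonglongrightarrow> 0"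
    by (rule filterlim_compose[OF tail_tendsto_0 sq])
  have "(\<lambda>R. real R * sqrt (drift_corr v (2 * R\<^sup>2))) \<longlonglongrightarrow> 0"
  proof (rule tendsto_sandwich[OF _ _ tendsto_const])
    show "\<forall>\<^sub>F R in sequentially. 0 \<le> real R * sqrt (drift_corr v (2 * R\<^sup>2))"
      by (simp add: drift_corr_nonneg)
    show "\<forall>\<^sub>F R in sequentially. real R * sqrt (drift_corr v (2 * R\<^sup>2)) \<le> sqrt (tail v (R\<^sup>2))"
    proof (rule always_eventually, rule allI)
      fix R
      have "real R * sqrt (drift_corr v (2 * R\<^sup>2)) = sqrt (real (R\<^sup>2) * drift_corr v (2 * R\<^sup>2))"
        by (simp add: real_sqrt_mult)
      also have "\<dots> \<le> sqrt (tail v (R\<^sup>2))"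
        by (rule real_sqrt_le_mono[OF n_drift_corr_le_tail])
      finally show "real R * sqrt (drift_corr v (2 * R\<^sup>2)) \<le> sqrt (tail v (R\<^sup>2))" .
    qed
    show "(\<lambda>R. sqrt (tail v (R\<^sup>2))) \<longlonglongrightarrow> 0"
      using tendsto_real_sqrt[OF tail0] by simp
  qed
  from tendsto_mult[OF tendsto_const[of a] this]
  have 1: "(\<lambda>R. (a * real R) * sqrt (drift_corr v (2 * R\<^sup>2))) \<longlonglongrightarrow> 0"
    by (simp add: mult.assoc)
  have 2: "(\<lambda>R. nrm (\<lambda>\<xi>. mollify (B R) (flux q v (R\<^sup>2) i) \<xi> - E (flux q v (R\<^sup>2) i))) \<longlonglongrightarrow> 0" for i
  proof (rule LIMSEQ_I)
    fix e :: real assume e: "e > 0"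
    have "(\<lambda>m. 2 * sqrt (c * (1 / q * tail v (2 * m)))) \<longlonglongrightarrow> 2 * sqrt (c * (1 / q * 0))"
      by (intro tendsto_intros filterlim_compose[OF tail_tendsto_0] filterlim_subseq) (simp add: strict_mono_def)
    then have "(\<lambda>m. 2 * sqrt (c * (1 / q * tail v (2 * m)))) \<longlonglongrightarrow> 0" by simp
    then obtain m where m: "2 * sqrt (c * (1 / q * tail v (2 * m))) < e / 2"
      by (rule LIMSEQ_0_obtain_less[of _ "e / 2"]) (use e in auto)
    obtain R0 where R0: "\<And>R. R \<ge> R0 \<Longrightarrow> nrm (\<lambda>\<xi>. mollify (B R) (flux q v m i) \<xi> - E (flux q v m i)) < e / 2"
      using order_tendstoD(2)[OF erg[of "flux q v m i"], of "e / 2"] e by (auto simp: eventually_sequentially)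
    show "\<exists>R0. \<forall>R\<ge>R0. norm (nrm (\<lambda>\<xi>. mollify (B R) (flux q v (R\<^sup>2) i) \<xi> - E (flux q v (R\<^sup>2) i)) - 0) < e"
    proof (intro exI allI impI)
      fix R assume R: "R \<ge> max R0 m"
      have "m \<le> R\<^sup>2" using R power2_nat_le_imp_le[of m R] by (simp add: power2_eq_square) (meson le_square order_trans)
      from nrm_mollify_flux_le[OF B this, of R v i]
      have "nrm (\<lambda>\<xi>. mollify (B R) (flux q v (R\<^sup>2) i) \<xi> - E (flux q v (R\<^sup>2) i)) < e"
        using m R0[of R] R by simp
      then show "norm (nrm (\<lambda>\<xi>. mollify (B R) (flux q v (R\<^sup>2) i) \<xi> - E (flux q v (R\<^sup>2) i)) - 0) < e"
        by simp
    qed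
  qed
  have "(\<lambda>R. ((a * real R) * sqrt (drift_corr v (2 * R\<^sup>2))
      + (\<Sum>i\<in>UNIV. nrm (\<lambda>\<xi>. mollify (B R) (flux q v (R\<^sup>2) i) \<xi> - E (flux q v (R\<^sup>2) i)))) * sqrt (c * mean_energy v))
      \<longlonglongrightarrow> (0 + (\<Sum>i\<in>(UNIV :: 'd set). 0)) * sqrt (c * mean_energy v)"
    by (intro tendsto_intros 1 2)
  then show ?thesis by (simp add: tail_error_def)
qed

text \<open>Both bounds involve finitely many means of local polynomials, whereas \<open>eff\<close>
  itself is an infinite series.\<close>

lemma eff_bounds:
  assumes "finite B" "B \<noteq> {}" "\<And>y. y \<in> B \<Longrightarrow> (\<Sum>i\<in>UNIV. real_of_int \<bar>y $ i\<bar>) \<le> r"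
  shows "eff v \<le> energy v n" "energy v n - tail_error B r v n p \<le> eff v"
  using tail_nonneg[of v "2 * n"] q_pos tail_bound[OF assms, of v n p]
  by (auto simp: energy_eff tail_error_def)

end

text \<open>A deterministic stability statement: convergence of countably many local means forces
  convergence of \<open>eff\<close>. Note that \<open>c3\<close> centres the torus fluxes at their
  mean under \<open>E\<close>; the constants therefore do not vary with \<open>N\<close>.\<close>

lemma eff_tendsto:
  fixes E :: "('d::finite env \<Rightarrow> real) \<Rightarrow> real" and EN :: "nat \<Rightarrow> ('d env \<Rightarrow> real) \<Rightarrow> real"
  assumes E: "stationary_mean c q E" and EN: "\<And>N. N > 0 \<Longrightarrow> stationary_mean c q (EN N)"
    and B: "\<And>R. finite (B R)" "\<And>R. B R \<noteq> {}"
    and Ba: "\<And>y R. y \<in> B R \<Longrightarrow> (\<Sum>i\<in>UNIV. real_of_int \<bar>y $ i\<bar>) \<le> a * real R"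
    and erg: "\<And>F. F \<in> env_poly \<Longrightarrow> (\<lambda>R. stationary_mean.nrm E (\<lambda>\<xi>. mollify (B R) F \<xi> - E F)) \<longlonglongrightarrow> 0"
    and c1: "\<And>i. (\<lambda>N. EN N (\<lambda>\<xi>. \<xi> (0, i))) \<longlonglongrightarrow> E (\<lambda>\<xi>. \<xi> (0, i))"
    and c2: "\<And>k. (\<lambda>N. EN N (\<lambda>\<xi>. drift v \<xi> * (lazy q ^^ k) (drift v) \<xi>)) \<longlonglongrightarrow> E (\<lambda>\<xi>. drift v \<xi> * (lazy q ^^ k) (drift v) \<xi>)"
    and c3: "\<And>R n i. (\<lambda>N. EN N (\<lambda>\<xi>. (mollify (B R) (flux q v n i) \<xi> - E (flux q v n i))\<^sup>2))
         \<longlonglongrightarrow> E (\<lambda>\<xi>. (mollify (B R) (flux q v n i) \<xi> - E (flux q v n i))\<^sup>2)"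
  shows "(\<lambda>N. stationary_mean.eff q (EN N) v) \<longlonglongrightarrow> stationary_mean.eff q E v"
proof -
  interpret E: stationary_mean c q E by fact
  note defs = stationary_mean.mean_energy_def[OF EN] stationary_mean.drift_corr_def[OF EN]
    stationary_mean.corr_def[OF EN] stationary_mean.energy_eq[OF EN] stationary_mean.nrm_def[OF EN]
    stationary_mean.tail_error_def[OF EN]
  have ev: "\<forall>\<^sub>F N in sequentially. N > (0 :: nat)" by (rule eventually_gt_at_top)
  have energy: "(\<lambda>N. stationary_mean.energy q (EN N) v n) \<longlonglongrightarrow> E.energy v n" for n
  proof -
    have "(\<lambda>N. (\<Sum>i\<in>UNIV. (v $ i)\<^sup>2 * EN N (\<lambda>\<xi>. \<xi> (0, i)))
        - 1 / q * (\<Sum>k<2 * n. EN N (\<lambda>\<xi>. drift v \<xi> * (lazy q ^^ k) (drift v) \<xi>))) \<longlonglongrightarrow> E.energy v n"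
      unfolding E.energy_eq E.mean_energy_def E.drift_corr_def E.corr_def
      by (intro tendsto_intros c1 c2)
    then show ?thesis
      by (rule Lim_transform_eventually) (use ev in eventually_elim, simp add: defs)
  qed
  have err: "(\<lambda>N. stationary_mean.tail_error c q (EN N) (B R) r v n (\<lambda>i. E (flux q v n i)))
      \<longlonglongrightarrow> E.tail_error (B R) r v n (\<lambda>i. E (flux q v n i))" for R r n
  proof -
    have "(\<lambda>N. (r * sqrt (EN N (\<lambda>\<xi>. drift v \<xi> * (lazy q ^^ (2 * n)) (drift v) \<xi>))
        + (\<Sum>i\<in>UNIV. sqrt (EN N (\<lambda>\<xi>. (mollify (B R) (flux q v n i) \<xi> - E (flux q v n i))\<^sup>2))))
        * sqrt (c * (\<Sum>i\<in>UNIV. (v $ i)\<^sup>2 * EN N (\<lambda>\<xi>. \<xi> (0, i)))))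
      \<longlonglongrightarrow> E.tail_error (B R) r v n (\<lambda>i. E (flux q v n i))"
      unfolding E.tail_error_def E.mean_energy_def E.drift_corr_def E.corr_def E.nrm_def
      by (intro tendsto_intros c1 c2 c3)
    then show ?thesis
      by (rule Lim_transform_eventually) (use ev in eventually_elim, simp add: defs)
  qed
  show ?thesis
  proof (rule tendstoI)
    fix e :: real assume e: "e > 0"
    \<comment> \<open>The cutoff is fixed from the limiting mean alone; afterwards \<open>N\<close>
      tends to infinity with \<open>R\<close> frozen.\<close>
    obtain R where R: "E.tail_error (B R) (a * real R) v (R\<^sup>2) (\<lambda>i. E (flux q v (R\<^sup>2) i)) < e / 2"
      by (rule LIMSEQ_0_obtain_less[OF E.tail_error_tendsto_0[where B = B, OF B erg], of "e / 2"]) (use e in auto)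
    let ?n = "R\<^sup>2" and ?p = "\<lambda>i. E (flux q v (R\<^sup>2) i)"
    have Eb: "E.eff v \<le> E.energy v ?n"
      "E.energy v ?n - E.tail_error (B R) (a * real R) v ?n ?p \<le> E.eff v"
      by (intro E.eff_bounds[where B = "B R" and r = "a * real R"] B Ba; assumption)+
    have a: "\<forall>\<^sub>F N in sequentially. stationary_mean.energy q (EN N) v ?n < E.energy v ?n + e / 2"
      using order_tendstoD(2)[OF energy[of ?n], of "E.energy v ?n + e / 2"] e by simp
    have lim: "(\<lambda>N. stationary_mean.energy q (EN N) v ?n - stationary_mean.tail_error c q (EN N) (B R) (a * real R) v ?n ?p)
       \<longlonglongrightarrow> E.energy v ?n - E.tail_error (B R) (a * real R) v ?n ?p"
      by (intro tendsto_intros energy err)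
    have b: "\<forall>\<^sub>F N in sequentially. stationary_mean.energy q (EN N) v ?n - stationary_mean.tail_error c q (EN N) (B R) (a * real R) v ?n ?p
       > E.energy v ?n - E.tail_error (B R) (a * real R) v ?n ?p - e / 2"
      by (rule order_tendstoD(1)[OF lim]) (use e in simp)
    show "\<forall>\<^sub>F N in sequentially. dist (stationary_mean.eff q (EN N) v) (E.eff v) < e"
      using ev a b
    proof eventually_elim
      case (elim N)
      have "stationary_mean.eff q (EN N) v \<le> stationary_mean.energy q (EN N) v ?n"
        and "stationary_mean.energy q (EN N) v ?n - stationary_mean.tail_error c q (EN N) (B R) (a * real R) v ?n ?p
           \<le> stationary_mean.eff q (EN N) v"
        by (intro stationary_mean.eff_bounds[OF EN[OF elim(1)], where B = "B R" and r = "a * real R"] B Ba; assumption)+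
      then show ?case
        using Eb elim R unfolding dist_real_def by linarith
    qed
  qed
qed

section \<open>Quadratic forms and their matrices\<close>

definition polarization :: "(real ^ 'd \<Rightarrow> real) \<Rightarrow> real ^ 'd ^ 'd::finite" where
  "polarization Q = (\<chi> i j. (Q (axis i 1 + axis j 1) - Q (axis i 1) - Q (axis j 1)) / 2)"

text \<open>Formulated through \<open>polarization\<close> so that the property is closed under
  pointwise limits and the matrix is read off from finitely many values.\<close>

definition quadratic_form :: "(real ^ 'd::finite \<Rightarrow> real) \<Rightarrow> bool" where
  "quadratic_form Q \<longleftrightarrow> (\<forall>v. Q v = (polarization Q *v v) \<bullet> v)"

lemma transpose_polarization: "transpose (polarization Q) = polarization Q"
  by (simp add: transpose_def polarization_def vec_eq_iff add.commute)

lemma matrix_form_eq: "((C :: real ^ 'd ^ 'd::finite) *v v) \<bullet> v = (\<Sum>i\<in>UNIV. \<Sum>j\<in>UNIV. C $ i $ j * v $ j * v $ i)"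
  by (simp add: inner_vec_def matrix_vector_mult_def sum_distrib_right)

lemma polarization_unique:
  assumes "transpose C = C" "\<And>v. Q v = (C *v v) \<bullet> v"
  shows "polarization Q = C"
proof -
  have sym: "(C *v a) \<bullet> b = (C *v b) \<bullet> a" for a b
    by (metis assms(1) dot_lmul_matrix inner_commute vector_transpose_matrix transpose_transpose)
  have "(Q (a + b) - Q a - Q b) / 2 = (C *v b) \<bullet> a" for a b
    using sym[of a b] by (simp add: assms(2) matrix_vector_right_distrib inner_add_left inner_add_right)
  moreover have "(C *v axis j 1) \<bullet> axis i 1 = C $ i $ j" for i j
    by (simp add: matrix_vector_mult_basis inner_axis column_def)
  ultimately show ?thesis by (simp add: polarization_def vec_eq_iff)
qed

lemma quadratic_formI:
  assumes "\<And>v. Q v = (\<Sum>i\<in>UNIV. \<Sum>j\<in>UNIV. C i j * v $ j * v $ i)" "\<And>i j. C i j = C j i"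
  shows "quadratic_form Q"
proof -
  define M where "M = (\<chi> i j. C i j)"
  have Q: "Q v = (M *v v) \<bullet> v" for v
    by (simp add: M_def assms(1) matrix_form_eq)
  moreover have "transpose M = M" using assms(2) by (simp add: transpose_def M_def vec_eq_iff)
  ultimately show ?thesis unfolding quadratic_form_def by (metis polarization_unique)
qed

lemma polarization_tendsto:
  assumes "\<And>i j. ((\<lambda>n. Q n (axis i 1 + axis j 1)) \<longlongrightarrow> Q' (axis i 1 + axis j 1)) F"
    "\<And>i. ((\<lambda>n. Q n (axis i 1)) \<longlongrightarrow> Q' (axis i 1)) F"
  shows "((\<lambda>n. polarization (Q n)) \<longlongrightarrow> polarization Q') F"
  unfolding polarization_def by (intro vec_tendstoI) (auto intro!: tendsto_intros assms)

lemma quadratic_form_limit: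
  assumes "\<And>n. quadratic_form (Q n)" "\<And>v. (\<lambda>n. Q n v) \<longlonglongrightarrow> Q' v"
  shows "quadratic_form Q'"
  unfolding quadratic_form_def
proof
  fix v
  have p: "(\<lambda>n. polarization (Q n)) \<longlonglongrightarrow> polarization Q'"
    by (intro polarization_tendsto assms(2))
  have "(\<lambda>n. (polarization (Q n) *v v) \<bullet> v) \<longlonglongrightarrow> (polarization Q' *v v) \<bullet> v"
    unfolding matrix_form_eq by (intro tendsto_intros tendsto_vec_nth p)
  moreover have "(\<lambda>n. (polarization (Q n) *v v) \<bullet> v) = (\<lambda>n. Q n v)"
    using assms(1) by (simp add: quadratic_form_def)
  ultimately show "Q' v = (polarization Q' *v v) \<bullet> v"
    using assms(2) LIMSEQ_unique by metis
qed

lemma quadratic_formD: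
  "quadratic_form Q \<Longrightarrow> Q v = (\<Sum>i\<in>UNIV. \<Sum>j\<in>UNIV. polarization Q $ i $ j * v $ j * v $ i)"
  unfolding quadratic_form_def matrix_form_eq by blast

lemma polarization_commute: "polarization Q $ i $ j = polarization Q $ j $ i"
  by (simp add: polarization_def add.commute)

lemma quadratic_form_cmult:
  assumes "quadratic_form Q"
  shows "quadratic_form (\<lambda>v. a * Q v)"
proof (rule quadratic_formI[of _ "\<lambda>i j. a * polarization Q $ i $ j"])
  fix v
  show "a * Q v = (\<Sum>i\<in>UNIV. \<Sum>j\<in>UNIV. a * polarization Q $ i $ j * v $ j * v $ i)"
    unfolding quadratic_formD[OF assms, of v] by (simp only: sum_distrib_left mult.assoc)
qed (simp add: polarization_commute)

text \<open>The description by \<open>THE\<close> is resolved: polarization provides a symmetric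
  matrix with the required limits, and a symmetric matrix is determined by its form.\<close>

lemma diffusion_matrix_eq:
  assumes "quadratic_form Q" "\<And>v. ((\<lambda>t. 1 / t * m t v) \<longlongrightarrow> Q v) at_top"
  shows "diffusion_matrix m = polarization Q"
  unfolding diffusion_matrix_def
proof (rule the_equality)
  show "transpose (polarization Q) = polarization Q \<and> (\<forall>v. ((\<lambda>t. 1 / t * m t v) \<longlongrightarrow> (polarization Q *v v) \<bullet> v) at_top)"
    using assms(2) quadratic_formD[OF assms(1)] unfolding matrix_form_eq
    by (metis (no_types, lifting) transpose_polarization)
  fix D assume D: "transpose D = D \<and> (\<forall>v. ((\<lambda>t. 1 / t * m t v) \<longlongrightarrow> (D *v v) \<bullet> v) at_top)"
  then have "Q v = (D *v v) \<bullet> v" for v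
    using tendsto_unique[OF trivial_limit_at_top_linorder assms(2)[of v]] by blast
  then show "D = polarization Q" using polarization_unique D by metis
qed

lemma quadratic_form_moment:
  fixes \<xi> :: "'d::finite env"
  shows "quadratic_form (\<lambda>v. moment q v n \<xi>)"
proof (rule quadratic_formI[of _ "\<lambda>i j. (step q \<xi> ^^ n) (\<lambda>x. of_int (x $ i) * of_int (x $ j)) 0"])
  fix v :: "real ^ 'd"
  have "(proj v x)\<^sup>2 = (\<Sum>i\<in>UNIV. \<Sum>j\<in>UNIV. (v $ j * v $ i) * (of_int (x $ i) * of_int (x $ j)))" for x
    by (simp add: proj_def inner_vec_def real_vec_def power2_eq_square sum_product mult_ac)
  then show "moment q v n \<xi> = (\<Sum>i\<in>UNIV. \<Sum>j\<in>UNIV. (step q \<xi> ^^ n) (\<lambda>x. of_int (x $ i) * of_int (x $ j)) 0 * v $ j * v $ i)"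
    unfolding moment_def by (simp add: step_pow_sum step_pow_cmult mult_ac)
qed (simp add: mult.commute)

lemma (in stationary_mean) quadratic_form_E_moment: "quadratic_form (\<lambda>v. E (moment q v n))"
proof (rule quadratic_formI)
  let ?P = "\<lambda>i j \<xi>. polarization (\<lambda>v. moment q v n \<xi>) $ i $ j"
  have P [simp]: "?P i j \<in> env_poly" for i j by (simp add: polarization_def)
  fix v :: "real ^ 'd"
  have "moment q v n = (\<lambda>\<xi>. \<Sum>i\<in>UNIV. \<Sum>j\<in>UNIV. (v $ j * v $ i) * ?P i j \<xi>)"
  proof
    fix \<xi>
    show "moment q v n \<xi> = (\<Sum>i\<in>UNIV. \<Sum>j\<in>UNIV. (v $ j * v $ i) * ?P i j \<xi>)"
      by (subst quadratic_formD[OF quadratic_form_moment]) (simp add: mult_ac)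
  qed
  then have "E (moment q v n) = E (\<lambda>\<xi>. \<Sum>i\<in>UNIV. \<Sum>j\<in>UNIV. (v $ j * v $ i) * ?P i j \<xi>)" by metis
  also have "\<dots> = (\<Sum>i\<in>UNIV. \<Sum>j\<in>UNIV. (v $ j * v $ i) * E (?P i j))"
    by (simp only: E_sum E_cmult env_poly_sum env_poly.mult env_poly.const P)
  finally show "E (moment q v n) = (\<Sum>i\<in>UNIV. \<Sum>j\<in>UNIV. E (?P i j) * v $ j * v $ i)"
    by (simp add: mult_ac)
qed (simp add: polarization_commute)

text \<open>Up to the factor q/2, \<open>eff\<close> is the limit of the mean second moments divided
  by the number of steps, each of which is a quadratic form.\<close>

lemma (in stationary_mean) quadratic_form_eff: "quadratic_form eff"
proof -
  have "quadratic_form (\<lambda>v. 1 / real n * E (moment q v n))" for n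
    by (intro quadratic_form_cmult quadratic_form_E_moment)
  then have "quadratic_form (\<lambda>v. 2 / q * eff v)"
    by (rule quadratic_form_limit) (use E_moment_tendsto in simp)
  from quadratic_form_cmult[OF this, of "q / 2"] show ?thesis using q_pos by simp
qed

section \<open>Cubes and periodization\<close>

definition cube :: "nat \<Rightarrow> (int ^ 'd::finite) set" where
  "cube N = {x. \<forall>i. - int N \<le> x $ i \<and> x $ i < int N}"

lemma vec_nth_image_cube: "vec_nth ` (cube N :: (int ^ 'd::finite) set) = Pi\<^sub>E UNIV (\<lambda>_. {- int N..<int N})"
proof
  show "Pi\<^sub>E UNIV (\<lambda>_. {- int N..<int N}) \<subseteq> vec_nth ` (cube N :: (int ^ 'd) set)"
  proof
    fix f :: "'d \<Rightarrow> int" assume "f \<in> Pi\<^sub>E UNIV (\<lambda>_. {- int N..<int N})"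
    then have "vec_lambda f \<in> cube N" by (auto simp: cube_def PiE_iff)
    then show "f \<in> vec_nth ` cube N" by (metis UNIV_I image_eqI vec_lambda_inverse)
  qed
qed (auto simp: cube_def)

lemma inj_vec_nth: "inj_on vec_nth A"
  by (auto simp: inj_on_def vec_eq_iff)

lemma finite_cube [simp, intro]: "finite (cube N)"
proof -
  have "finite (vec_nth ` (cube N :: (int ^ 'a) set))"
    unfolding vec_nth_image_cube by (intro finite_PiE) auto
  then show ?thesis by (rule finite_imageD[OF _ inj_vec_nth])
qed

lemma card_cube: "card (cube N :: (int ^ 'd::finite) set) = (2 * N) ^ CARD('d)"
proof -
  have "card (cube N :: (int ^ 'd) set) = card (vec_nth ` (cube N :: (int ^ 'd) set))"
    by (rule card_image[OF inj_vec_nth, symmetric])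
  also have "\<dots> = (2 * N) ^ CARD('d)"
    unfolding vec_nth_image_cube by (simp add: card_PiE nat_mult_distrib)
  finally show ?thesis .
qed

lemma cube_mono: "M \<le> N \<Longrightarrow> cube M \<subseteq> cube N"
  unfolding cube_def
proof (intro Collect_mono impI allI)
  fix x :: "int ^ 'a" and i
  assume "M \<le> N" "\<forall>i. - int M \<le> x $ i \<and> x $ i < int M"
  then show "- int N \<le> x $ i \<and> x $ i < int N" by (smt (verit) of_nat_mono)
qed

lemma zero_in_cube: "N > 0 \<Longrightarrow> 0 \<in> cube N"
  by (simp add: cube_def)

text \<open>A dimension-free lower bound; along squares it already gives summable variances.\<close>

lemma card_cube_ge: "N \<le> card (cube N :: (int ^ 'd::finite) set)"
proof (cases "N = 0")
  case False
  have "N \<le> (2 * N) ^ 1" by simp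
  also have "\<dots> \<le> (2 * N) ^ CARD('d)" using False by (intro power_increasing) (auto simp: Suc_le_eq)
  finally show ?thesis by (simp add: card_cube)
qed simp

lemma cube_l1_le:
  assumes "x \<in> (cube N :: (int ^ 'd::finite) set)"
  shows "(\<Sum>i\<in>UNIV. real_of_int \<bar>x $ i\<bar>) \<le> real CARD('d) * real N"
proof -
  have "\<bar>x $ i\<bar> \<le> int N" for i
    using spec[OF assms[unfolded cube_def mem_Collect_eq], of i] by linarith
  then have "real_of_int \<bar>x $ i\<bar> \<le> real N" for i by (metis of_int_le_iff of_int_of_nat_eq)
  then have "(\<Sum>i\<in>UNIV. real_of_int \<bar>x $ i\<bar>) \<le> (\<Sum>i\<in>(UNIV :: 'd set). real N)"
    by (rule sum_mono)
  then show ?thesis by simp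
qed

definition avg :: "'a set \<Rightarrow> ('a \<Rightarrow> real) \<Rightarrow> real" where
  "avg Q f = 1 / card Q * (\<Sum>x\<in>Q. f x)"

lemma avg_diff_le:
  assumes Q: "finite Q" "Q \<noteq> {}" "Q' \<subseteq> Q"
    and "\<And>x. x \<in> Q \<Longrightarrow> \<bar>f x\<bar> \<le> C" "\<And>x. x \<in> Q \<Longrightarrow> \<bar>g x\<bar> \<le> C" "\<And>x. x \<in> Q' \<Longrightarrow> f x = g x"
  shows "\<bar>avg Q f - avg Q g\<bar> \<le> 2 * C * (1 - card Q' / card Q)"
proof -
  have fQ': "finite Q'" using Q finite_subset by blast
  have cQ: "card Q > 0" using Q by (simp add: card_gt_0_iff)
  have "avg Q f - avg Q g = 1 / card Q * (\<Sum>x\<in>Q. f x - g x)"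
    by (simp add: avg_def sum_subtractf right_diff_distrib)
  also have "(\<Sum>x\<in>Q. f x - g x) = (\<Sum>x\<in>Q - Q'. f x - g x)"
    using Q assms(6) by (intro sum.mono_neutral_right) auto
  finally have "\<bar>avg Q f - avg Q g\<bar> = 1 / card Q * \<bar>\<Sum>x\<in>Q - Q'. f x - g x\<bar>"
    by (simp add: abs_mult)
  also have "\<bar>\<Sum>x\<in>Q - Q'. f x - g x\<bar> \<le> (\<Sum>x\<in>Q - Q'. 2 * C)"
  proof (rule order_trans[OF sum_abs], rule sum_mono)
    fix x assume "x \<in> Q - Q'"
    then show "\<bar>f x - g x\<bar> \<le> 2 * C" using assms(4)[of x] assms(5)[of x] by auto
  qed
  also have "(\<Sum>x\<in>Q - Q'. 2 * C) = (card Q - card Q') * (2 * C)"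
    using Q fQ' by (simp add: card_Diff_subset)
  finally have "\<bar>avg Q f - avg Q g\<bar> \<le> 1 / card Q * ((card Q - card Q') * (2 * C))"
    by (simp add: divide_right_mono)
  also have "\<dots> = 2 * C * (1 - card Q' / card Q)"
    using cQ card_mono[OF Q(1,3)] by (simp add: of_nat_diff field_simps)
  finally show ?thesis .
qed

lemma avg_subset_le:
  assumes Q: "finite Q" "Q' \<noteq> {}" "Q' \<subseteq> Q" and f: "\<And>x. x \<in> Q \<Longrightarrow> \<bar>f x\<bar> \<le> C"
  shows "\<bar>avg Q f - avg Q' f\<bar> \<le> 2 * C * (1 - card Q' / card Q)"
proof -
  have fQ': "finite Q'" using Q finite_subset by blast
  have c: "card Q' > 0" "card Q' \<le> card Q" using Q fQ' card_mono by (auto simp: card_gt_0_iff)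
  define a b where "a = (\<Sum>x\<in>Q'. f x)" and "b = (\<Sum>x\<in>Q - Q'. f x)"
  have C: "0 \<le> C" using Q f by (meson abs_ge_zero all_not_in_conv order_trans subset_iff)
  have "\<bar>a\<bar> \<le> (\<Sum>x\<in>Q'. C)"
    unfolding a_def by (rule order_trans[OF sum_abs], rule sum_mono) (use f Q in auto)
  then have a: "\<bar>a\<bar> \<le> card Q' * C" by simp
  have "\<bar>b\<bar> \<le> (\<Sum>x\<in>Q - Q'. C)"
    unfolding b_def by (rule order_trans[OF sum_abs], rule sum_mono) (use f Q in auto)
  then have b: "\<bar>b\<bar> \<le> (real (card Q) - real (card Q')) * C"
    using Q fQ' c by (simp add: card_Diff_subset of_nat_diff)
  have "(\<Sum>x\<in>Q. f x) = a + b"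
    unfolding a_def b_def using sum.subset_diff[OF Q(3,1), of f] by simp
  then have "avg Q f - avg Q' f = b / card Q - (real (card Q) - real (card Q')) / (card Q * card Q') * a"
    using c by (simp add: avg_def a_def[symmetric] field_simps)
  also have "\<bar>\<dots>\<bar> \<le> \<bar>b\<bar> / card Q + (real (card Q) - real (card Q')) / (card Q * card Q') * \<bar>a\<bar>"
    using c by (intro order_trans[OF abs_triangle_ineq4]) (simp add: abs_mult)
  also have "\<dots> \<le> ((real (card Q) - real (card Q')) * C) / card Q
      + (real (card Q) - real (card Q')) / (card Q * card Q') * (card Q' * C)"
    using a b c by (intro add_mono divide_right_mono mult_left_mono) auto
  also have "\<dots> = 2 * C * (1 - card Q' / card Q)"
    using c by (simp add: field_simps)
  finally show ?thesis .
qed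

lemma card_cube_ratio:
  "card (cube M :: (int ^ 'd::finite) set) / card (cube N :: (int ^ 'd) set) = (real M / real N) ^ CARD('d)"
  by (simp add: card_cube power_divide power_mult_distrib)

lemma torus_rep_in_cube: "N > 0 \<Longrightarrow> torus_rep N x \<in> cube N"
proof -
  assume N: "N > 0"
  have "0 \<le> (a + int N) mod (2 * int N) \<and> (a + int N) mod (2 * int N) < 2 * int N" for a :: int
    using N by simp
  then show ?thesis by (simp add: torus_rep_def cube_def)
qed

lemma torus_rep_cube: "x \<in> cube N \<Longrightarrow> torus_rep N x = x"
  unfolding torus_rep_def vec_eq_iff
proof
  fix i assume "x \<in> cube N"
  then have "- int N \<le> x $ i" "x $ i < int N" by (auto simp: cube_def)
  then have "(x $ i + int N) mod (2 * int N) = x $ i + int N" by (intro mod_pos_pos_trivial) auto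
  then show "(\<chi> i. (x $ i + int N) mod (2 * int N) - int N) $ i = x $ i" by simp
qed

lemma torus_rep_add_torus_rep: "torus_rep N (x + torus_rep N y) = torus_rep N (x + y)"
proof -
  have "(a + ((b + int N) mod (2 * int N) - int N) + int N) mod (2 * int N) = (a + b + int N) mod (2 * int N)" for a b :: int
    by (simp add: mod_simps add.assoc)
  then show ?thesis by (simp add: torus_rep_def vec_eq_iff)
qed

lemma shift_periodize_torus_rep: "shift (torus_rep N x) (periodize N \<xi>) = shift x (periodize N \<xi>)"
  by (simp add: shift_def periodize_def fun_eq_iff torus_rep_add_torus_rep)

text \<open>Reduction modulo 2N after a translation permutes the cube, being injective on a finite
  set that it maps into itself.\<close>

lemma sum_cube_translate:
  fixes f :: "int ^ 'd::finite \<Rightarrow> real"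
  assumes N: "N > 0" and f: "\<And>x. f (torus_rep N x) = f x"
  shows "(\<Sum>x\<in>cube N. f (x + y)) = (\<Sum>x\<in>cube N. f x)"
proof -
  let ?h = "\<lambda>x. torus_rep N (x + y)"
  have "?h x = ?h x' \<Longrightarrow> x = x'" if "x \<in> cube N" "x' \<in> cube N" for x x'
  proof -
    assume "?h x = ?h x'"
    then have "torus_rep N (- y + ?h x) = torus_rep N (- y + ?h x')" by simp
    then show ?thesis using that by (simp only: torus_rep_add_torus_rep add.commute[of x] add.commute[of x'] minus_add_cancel torus_rep_cube)
  qed
  then have inj: "inj_on ?h (cube N)" by (auto simp: inj_on_def)
  have "?h ` cube N \<subseteq> cube N" using torus_rep_in_cube[OF N] by auto
  then have img: "?h ` cube N = cube N" using endo_inj_surj[OF finite_cube _ inj] by simp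
  have "(\<Sum>x\<in>cube N. f (x + y)) = (\<Sum>x\<in>cube N. f (?h x))" by (simp add: f)
  also have "\<dots> = (\<Sum>x\<in>?h ` cube N. f x)" by (simp add: sum.reindex[OF inj])
  finally show ?thesis by (simp add: img)
qed

lemma periodize_env_space: "\<xi> \<in> env_space c \<Longrightarrow> periodize N \<xi> \<in> env_space c"
  by (auto simp: env_space_def periodize_def)

lemma periodic_mean_torus:
  fixes \<xi> :: "'d::finite env"
  assumes "c \<ge> 1" "q \<ge> 4 * real CARD('d) * c" "\<xi> \<in> env_space c" "N > 0"
  shows "periodic_mean c q (\<lambda>F. mollify (cube N) F (periodize N \<xi>)) (periodize N \<xi>) (cube N)"
proof -
  have tr: "mollify (cube N) F (shift y (periodize N \<xi>)) = mollify (cube N) F (periodize N \<xi>)" for F :: "'d env \<Rightarrow> real" and y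
    using sum_cube_translate[OF \<open>N > 0\<close>, of "\<lambda>x. F (shift x (periodize N \<xi>))" y]
    by (simp add: mollify_def shift_periodize_torus_rep)
  have c0: "card (cube N :: (int ^ 'd) set) > 0"
    using card_cube_ge[of N] assms(4) by (metis gr0I le_zero_eq not_gr_zero)
  show ?thesis
  proof
    fix F G :: "'d env \<Rightarrow> real" and a y x
    show "mollify (cube N) (\<lambda>\<xi>. F \<xi> + G \<xi>) (periodize N \<xi>) = mollify (cube N) F (periodize N \<xi>) + mollify (cube N) G (periodize N \<xi>)"
      by (simp add: mollify_def sum.distrib distrib_left)
    show "mollify (cube N) (\<lambda>\<xi>. a * F \<xi>) (periodize N \<xi>) = a * mollify (cube N) F (periodize N \<xi>)"
      by (simp add: mollify_def sum_distrib_left mult.left_commute)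
    show "mollify (cube N) (\<lambda>_. 1) (periodize N \<xi>) = 1" using c0 by (auto simp: mollify_def)
    show "0 \<le> mollify (cube N) F (periodize N \<xi>)" if "\<And>\<xi>. \<xi> \<in> env_space c \<Longrightarrow> 0 \<le> F \<xi>"
      unfolding mollify_def using assms(3)
      by (intro mult_nonneg_nonneg sum_nonneg that shift_env_space periodize_env_space) auto
    show "mollify (cube N) (\<lambda>\<xi>. F (shift y \<xi>)) (periodize N \<xi>) = mollify (cube N) F (periodize N \<xi>)"
      using tr[of F y] by (simp add: mollify_def add.commute)
    show "mollify (cube N) F (periodize N \<xi>) = mollify (cube N) F (shift x (periodize N \<xi>))"
      by (simp add: tr)
  qed (use assms zero_in_cube[of N] in auto)
qed

section \<open>Locality and the effect of periodization\<close>

definition depends_on :: "('d::finite env \<Rightarrow> real) \<Rightarrow> ((int ^ 'd) \<times> 'd) set \<Rightarrow> bool" where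
  "depends_on F A \<longleftrightarrow> (\<forall>\<xi> \<eta>. (\<forall>b\<in>A. \<xi> b = \<eta> b) \<longrightarrow> F \<xi> = F \<eta>)"

lemma depends_on_mono: "depends_on F A \<Longrightarrow> A \<subseteq> B \<Longrightarrow> depends_on F B"
  unfolding depends_on_def by blast

lemma env_poly_local:
  assumes "F \<in> env_poly"
  shows "\<exists>A. finite A \<and> depends_on F A"
  using assms
proof induction
  case (const a)
  then show ?case by (intro exI[of _ "{}"]) (simp add: depends_on_def)
next
  case (coord b)
  then show ?case by (intro exI[of _ "{b}"]) (simp add: depends_on_def)
next
  case (add F G)
  then obtain A B where AB: "finite A" "depends_on F A" "finite B" "depends_on G B" by blast
  then have "depends_on F (A \<union> B)" "depends_on G (A \<union> B)" by (auto elim: depends_on_mono)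
  then have "depends_on (\<lambda>\<xi>. F \<xi> + G \<xi>) (A \<union> B)" unfolding depends_on_def by metis
  then show ?case using AB by blast
next
  case (mult F G)
  then obtain A B where AB: "finite A" "depends_on F A" "finite B" "depends_on G B" by blast
  then have "depends_on F (A \<union> B)" "depends_on G (A \<union> B)" by (auto elim: depends_on_mono)
  then have "depends_on (\<lambda>\<xi>. F \<xi> * G \<xi>) (A \<union> B)" unfolding depends_on_def by metis
  then show ?case using AB by blast
qed

lemma depends_on_shift:
  assumes "depends_on F A"
  shows "depends_on (\<lambda>\<xi>. F (shift y \<xi>)) ((\<lambda>(x, i). (x + y, i)) ` A)"
  unfolding depends_on_def
proof (intro allI impI)
  fix \<xi> \<eta> :: "'a env" assume "\<forall>b\<in>(\<lambda>(x, i). (x + y, i)) ` A. \<xi> b = \<eta> b"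
  then have "\<forall>b\<in>A. shift y \<xi> b = shift y \<eta> b" by (auto simp: shift_def)
  then show "F (shift y \<xi>) = F (shift y \<eta>)" using assms unfolding depends_on_def by blast
qed

lemma env_poly_bounded:
  assumes "F \<in> env_poly" "c \<ge> 1"
  shows "\<exists>C. \<forall>\<xi>\<in>env_space c. \<bar>F \<xi>\<bar> \<le> C"
  using assms(1)
proof induction
  case (coord b)
  have "\<bar>\<xi> b\<bar> \<le> c" if "\<xi> \<in> env_space c" for \<xi>
    using env_space_bounds[OF that assms(2), of b] by linarith
  then show ?case by blast
next
  case (add F G)
  then obtain A B where "\<forall>\<xi>\<in>env_space c. \<bar>F \<xi>\<bar> \<le> A" "\<forall>\<xi>\<in>env_space c. \<bar>G \<xi>\<bar> \<le> B" by blast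
  then have "\<forall>\<xi>\<in>env_space c. \<bar>F \<xi> + G \<xi>\<bar> \<le> A + B"
    by (intro ballI order_trans[OF abs_triangle_ineq] add_mono) auto
  then show ?case by blast
next
  case (mult F G)
  then obtain A B where "\<forall>\<xi>\<in>env_space c. \<bar>F \<xi>\<bar> \<le> A" "\<forall>\<xi>\<in>env_space c. \<bar>G \<xi>\<bar> \<le> B" by blast
  then have "\<forall>\<xi>\<in>env_space c. \<bar>F \<xi> * G \<xi>\<bar> \<le> A * B"
    by (auto simp: abs_mult intro!: mult_mono order_trans[OF abs_ge_zero])
  then show ?case by blast
qed auto

text \<open>A local function sees the periodization only from sites within a fixed distance of the
  boundary, and these have vanishing density in the cube.\<close>

lemma periodized_average_diff_tendsto:
  fixes \<xi> :: "'d::finite env"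
  assumes "F \<in> env_poly" "c \<ge> 1" "\<xi> \<in> env_space c"
  shows "(\<lambda>N. mollify (cube N) F (periodize N \<xi>) - mollify (cube N) F \<xi>) \<longlonglongrightarrow> 0"
proof -
  obtain A where A: "finite A" "depends_on F A" using env_poly_local[OF assms(1)] by blast
  obtain C where C: "\<And>\<xi>. \<xi> \<in> env_space c \<Longrightarrow> \<bar>F \<xi>\<bar> \<le> C" using env_poly_bounded[OF assms(1,2)] by blast
  \<comment> \<open>A common bound for all coordinates of the sites in \<open>A\<close>. For
    \<open>N \<le> r\<close> the truncated \<open>N - r\<close> makes the inner cube empty and the
    estimate trivial.\<close>
  define r where "r = (\<Sum>b\<in>A. \<Sum>i\<in>UNIV. nat \<bar>fst b $ i\<bar>)"
  have r: "\<bar>x $ i\<bar> \<le> int r" if "(x, k) \<in> A" for x k i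
  proof -
    have "nat \<bar>x $ i\<bar> \<le> (\<Sum>i\<in>UNIV. nat \<bar>x $ i\<bar>)" by (rule member_le_sum) auto
    also have "\<dots> \<le> r" unfolding r_def using member_le_sum[OF that, of "\<lambda>b. \<Sum>i\<in>UNIV. nat \<bar>fst b $ i\<bar>"] A by auto
    finally show ?thesis by linarith
  qed
  have bound: "\<bar>mollify (cube N) F (periodize N \<xi>) - mollify (cube N) F \<xi>\<bar> \<le> 2 * C * (1 - (real (N - r) / real N) ^ CARD('d))"
    if N: "N > 0" for N
  proof -
    have "\<bar>avg (cube N) (\<lambda>x. F (shift x (periodize N \<xi>))) - avg (cube N) (\<lambda>x. F (shift x \<xi>))\<bar>
      \<le> 2 * C * (1 - card (cube (N - r) :: (int ^ 'd) set) / card (cube N :: (int ^ 'd) set))"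
    proof (rule avg_diff_le)
      show "cube (N - r) \<subseteq> (cube N :: (int ^ 'd) set)" by (rule cube_mono) simp
      show "cube N \<noteq> ({} :: (int ^ 'd) set)" using zero_in_cube[OF N] by blast
      fix x :: "int ^ 'd"
      show "\<bar>F (shift x (periodize N \<xi>))\<bar> \<le> C" "\<bar>F (shift x \<xi>)\<bar> \<le> C"
        using assms(3) by (auto intro!: C simp: periodize_env_space)
      assume x: "x \<in> cube (N - r)"
      have "shift x (periodize N \<xi>) b = shift x \<xi> b" if "b \<in> A" for b
      proof -
        obtain z k where b: "b = (z, k)" by (cases b)
        have "z + x \<in> cube N"
          unfolding cube_def
        proof (intro CollectI allI)
          fix i
          show "- int N \<le> (z + x) $ i \<and> (z + x) $ i < int N"
            using r[of z k i] that x by (cases "r \<le> N") (auto simp: b cube_def abs_le_iff of_nat_diff dest!: spec[of _ i])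
        qed
        then show ?thesis by (simp add: b shift_def periodize_def torus_rep_cube)
      qed
      then show "F (shift x (periodize N \<xi>)) = F (shift x \<xi>)"
        using A(2) unfolding depends_on_def by blast
    qed auto
    then show ?thesis by (simp add: avg_def mollify_def card_cube_ratio)
  qed
  have "(\<lambda>N. real (N - r) / real N) \<longlonglongrightarrow> 1"
  proof -
    have "(\<lambda>N. 1 - real r / real N) \<longlonglongrightarrow> 1 - 0" by (intro tendsto_intros lim_const_over_n)
    then have "(\<lambda>N. 1 - real r / real N) \<longlonglongrightarrow> 1" by simp
    moreover have "\<forall>\<^sub>F N in sequentially. 1 - real r / real N = real (N - r) / real N"
      using eventually_gt_at_top[of r] by eventually_elim (simp add: of_nat_diff field_simps)
    ultimately show ?thesis by (rule Lim_transform_eventually)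
  qed
  then have "(\<lambda>N. 2 * C * (1 - (real (N - r) / real N) ^ CARD('d))) \<longlonglongrightarrow> 2 * C * (1 - 1 ^ CARD('d))"
    by (intro tendsto_intros)
  then have lim: "(\<lambda>N. 2 * C * (1 - (real (N - r) / real N) ^ CARD('d))) \<longlonglongrightarrow> 0" by simp
  show ?thesis
    by (rule Lim_null_comparison[OF eventually_mono[OF eventually_gt_at_top[of 0]] lim]) (use bound in simp)
qed

text \<open>With \<open>k\<close> the integer part of the root of \<open>N\<close>, the cubes for
  \<open>k\<^sup>2\<close> and \<open>N\<close> differ by a vanishing fraction of their sites, so
  for a bounded function the averages differ by little.\<close>

lemma average_along_squares:
  fixes \<xi> :: "'d::finite env"
  assumes F: "F \<in> env_poly" "c \<ge> 1" "\<xi> \<in> env_space c"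
    and lim: "(\<lambda>k. mollify (cube (k\<^sup>2)) F \<xi>) \<longlonglongrightarrow> L"
  shows "(\<lambda>N. mollify (cube N) F \<xi>) \<longlonglongrightarrow> L"
proof -
  obtain C where C: "\<And>\<xi>. \<xi> \<in> env_space c \<Longrightarrow> \<bar>F \<xi>\<bar> \<le> C" using env_poly_bounded[OF F(1,2)] by blast
  define k where "k N = nat \<lfloor>sqrt (real N)\<rfloor>" for N
  have k: "real (k N) \<le> sqrt N" "sqrt N - 1 < real (k N)" for N
    unfolding k_def using floor_correct[of "sqrt (real N)"] by (auto simp: of_nat_nat)
  have k2: "(k N)\<^sup>2 \<le> N" for N
  proof -
    have "(real (k N))\<^sup>2 \<le> (sqrt N)\<^sup>2" using k(1) by (intro power_mono) auto
    then show ?thesis by (simp flip: of_nat_power)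
  qed
  have sqrt_top: "filterlim (\<lambda>N. sqrt (real N)) at_top sequentially"
    by (intro filterlim_compose[OF sqrt_at_top] filterlim_real_sequentially)
  have ktop: "filterlim k sequentially sequentially"
  proof -
    have "filterlim (\<lambda>N. sqrt (real N) + (- 1)) at_top sequentially"
      by (intro filterlim_tendsto_add_at_top[OF tendsto_const sqrt_top, of "- 1", THEN filterlim_cong[THEN iffD1, rotated -1]]) auto
    then have "filterlim (\<lambda>N. real (k N)) at_top sequentially"
      by (rule filterlim_at_top_mono) (use k(2) in \<open>auto intro!: always_eventually simp: less_imp_le algebra_simps\<close>)
    then show ?thesis by (simp add: filterlim_sequentially_iff_filterlim_real)
  qed
  have ratio: "(\<lambda>N. real (k N) / sqrt N) \<longlonglongrightarrow> 1"
  proof (rule tendsto_sandwich[OF _ _ _ tendsto_const])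
    show "\<forall>\<^sub>F N in sequentially. 1 - 1 / sqrt (real N) \<le> real (k N) / sqrt N"
      using eventually_gt_at_top[of 0]
    proof eventually_elim
      case (elim N)
      have "(sqrt N - 1) / sqrt N \<le> real (k N) / sqrt N"
        using k(2)[of N] by (intro divide_right_mono) auto
      then show ?case using elim by (simp add: diff_divide_distrib)
    qed
    show "\<forall>\<^sub>F N in sequentially. real (k N) / sqrt N \<le> 1"
      using eventually_gt_at_top[of 0] by eventually_elim (use k(1) in \<open>simp add: divide_le_eq\<close>)
    have "(\<lambda>N. 1 - 1 / sqrt (real N)) \<longlonglongrightarrow> 1 - 0"
      by (intro tendsto_intros tendsto_divide_0[OF tendsto_const] filterlim_at_top_imp_at_infinity sqrt_top)
    then show "(\<lambda>N. 1 - 1 / sqrt (real N)) \<longlonglongrightarrow> 1" by simp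
  qed
  have "(\<lambda>N. 2 * C * (1 - ((real (k N) / sqrt N)\<^sup>2) ^ CARD('d))) \<longlonglongrightarrow> 2 * C * (1 - (1\<^sup>2) ^ CARD('d))"
    by (intro tendsto_intros ratio)
  then have lim0: "(\<lambda>N. 2 * C * (1 - ((real (k N) / sqrt N)\<^sup>2) ^ CARD('d))) \<longlonglongrightarrow> 0" by simp
  have "\<forall>\<^sub>F N in sequentially. norm (mollify (cube N) F \<xi> - mollify (cube ((k N)\<^sup>2)) F \<xi>)
      \<le> 2 * C * (1 - ((real (k N) / sqrt N)\<^sup>2) ^ CARD('d))"
    using eventually_compose_filterlim[OF eventually_gt_at_top[of 0] ktop]
  proof eventually_elim
    case (elim N)
    have "\<bar>avg (cube N) (\<lambda>x. F (shift x \<xi>)) - avg (cube ((k N)\<^sup>2)) (\<lambda>x. F (shift x \<xi>))\<bar>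
        \<le> 2 * C * (1 - card (cube ((k N)\<^sup>2) :: (int ^ 'd) set) / card (cube N :: (int ^ 'd) set))"
    proof (rule avg_subset_le)
      show "cube ((k N)\<^sup>2) \<noteq> ({} :: (int ^ 'd) set)" using zero_in_cube[of "(k N)\<^sup>2"] elim by auto
      show "cube ((k N)\<^sup>2) \<subseteq> (cube N :: (int ^ 'd) set)" by (rule cube_mono[OF k2])
    qed (use F in \<open>auto intro!: C\<close>)
    then show ?case unfolding card_cube_ratio by (simp add: avg_def mollify_def power_divide)
  qed
  then have "(\<lambda>N. mollify (cube N) F \<xi> - mollify (cube ((k N)\<^sup>2)) F \<xi>) \<longlonglongrightarrow> 0"
    by (rule Lim_null_comparison[OF _ lim0])
  moreover have "(\<lambda>N. mollify (cube ((k N)\<^sup>2)) F \<xi>) \<longlonglongrightarrow> L"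
    by (rule filterlim_compose[OF lim ktop])
  ultimately show ?thesis by (rule Lim_transform[rotated])
qed

section \<open>Independent environments\<close>

text \<open>The series of the \<open>X k\<close> has finite integral, hence converges almost
  everywhere, so its terms tend to 0.\<close>

lemma nn_summable_imp_AE_tendsto_0:
  fixes X :: "nat \<Rightarrow> 'a \<Rightarrow> real"
  assumes "\<And>k. integrable M (X k)" "\<And>k. AE x in M. 0 \<le> X k x" "summable (\<lambda>k. \<integral>x. X k x \<partial>M)"
  shows "AE x in M. (\<lambda>k. X k x) \<longlonglongrightarrow> 0"
proof -
  have nonneg: "0 \<le> (\<integral>x. X k x \<partial>M)" for k by (rule integral_nonneg_AE[OF assms(2)])
  have "(\<integral>\<^sup>+ x. (\<Sum>k. ennreal (X k x)) \<partial>M) = (\<Sum>k. \<integral>\<^sup>+ x. ennreal (X k x) \<partial>M)"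
    using assms(1) by (intro nn_integral_suminf) auto
  also have "\<dots> = (\<Sum>k. ennreal (\<integral>x. X k x \<partial>M))"
    by (intro suminf_cong nn_integral_eq_integral assms)
  also have "\<dots> \<noteq> \<infinity>"
    using suminf_ennreal2[OF nonneg assms(3)] by simp
  finally have "AE x in M. (\<Sum>k. ennreal (X k x)) \<noteq> \<infinity>"
    using assms(1) by (intro nn_integral_PInf_AE) auto
  moreover have "AE x in M. \<forall>k. 0 \<le> X k x" using assms(2) by (simp add: AE_all_countable)
  ultimately show ?thesis
  proof eventually_elim
    case (elim x)
    then have "summable (\<lambda>k. X k x)" by (intro summable_suminf_not_top) auto
    then show ?case by (rule summable_LIMSEQ_zero)
  qed
qed

text \<open>The parameter \<open>dim_type\<close> pins down the dimension, which the types of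
  \<open>c\<close>, \<open>q\<close> and \<open>\<mu>0\<close> do not mention.\<close>

locale iid_env =
  fixes c q :: real and \<mu>0 :: "real measure" and dim_type :: "'d::finite itself"
  assumes c_ge_1: "c \<ge> 1" and q_ge: "q \<ge> 4 * real CARD('d) * c" and prob: "prob_space \<mu>0"
    and sets_\<mu>0: "sets \<mu>0 = sets (restrict_space borel {1/c..c})"
begin

abbreviation \<mu> :: "'d env measure" where "\<mu> \<equiv> env_measure \<mu>0"

abbreviation mean :: "('d env \<Rightarrow> real) \<Rightarrow> real" where "mean F \<equiv> \<integral>\<xi>. F \<xi> \<partial>\<mu>"

lemma space_\<mu>0: "space \<mu>0 = {1/c..c}"
  using sets_eq_imp_space_eq[OF sets_\<mu>0] by (simp add: space_restrict_space)

lemma space_\<mu>: "space \<mu> = env_space c"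
  by (auto simp: env_measure_def space_PiM space_\<mu>0 env_space_def PiE_iff)

sublocale P: prob_space \<mu>
  unfolding env_measure_def by (intro prob_space_PiM prob)

lemma measurable_id_\<mu>0: "(\<lambda>x. x) \<in> borel_measurable \<mu>0"
proof -
  have "(\<lambda>x. x) \<in> borel_measurable (restrict_space borel {1/c..c})"
    by (rule measurable_restrict_space1) simp
  then show ?thesis using measurable_cong_sets[OF sets_\<mu>0 refl] by blast
qed

lemma measurable_coord_PiM: "b \<in> A \<Longrightarrow> (\<lambda>\<omega>. \<omega> b) \<in> borel_measurable (Pi\<^sub>M A (\<lambda>_. \<mu>0))"
proof -
  assume "b \<in> A"
  then have "(\<lambda>\<omega>. \<omega> b) \<in> measurable (Pi\<^sub>M A (\<lambda>_. \<mu>0)) \<mu>0" by (rule measurable_component_singleton)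
  from measurable_compose[OF this measurable_id_\<mu>0] show ?thesis .
qed

lemma env_poly_measurable: "F \<in> env_poly \<Longrightarrow> F \<in> borel_measurable \<mu>"
  by (induction rule: env_poly.induct) (auto simp: env_measure_def intro: measurable_coord_PiM)

lemma env_poly_integrable: "F \<in> env_poly \<Longrightarrow> integrable \<mu> F"
proof -
  assume F: "F \<in> env_poly"
  obtain C where "\<And>\<xi>. \<xi> \<in> env_space c \<Longrightarrow> \<bar>F \<xi>\<bar> \<le> C" using env_poly_bounded[OF F c_ge_1] by blast
  then show ?thesis
    by (intro P.integrable_const_bound[where B = C] env_poly_measurable F AE_I2) (auto simp: space_\<mu>)
qed

lemma distr_shift: "distr \<mu> \<mu> (shift y) = \<mu>"
proof -
  let ?f = "\<lambda>(x, i). (x + y, i)"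
  have "distr (Pi\<^sub>M UNIV (\<lambda>_. \<mu>0)) (Pi\<^sub>M UNIV (\<lambda>_. \<mu>0)) (\<lambda>\<omega>. \<lambda>n\<in>UNIV. \<omega> (?f n)) = Pi\<^sub>M UNIV (\<lambda>_ :: (int ^ 'd) \<times> 'd. \<mu>0)"
    by (rule distr_PiM_reindex) (auto simp: prob inj_on_def)
  moreover have "(\<lambda>\<omega>. \<lambda>n\<in>UNIV. \<omega> (?f n)) = (shift y :: 'd env \<Rightarrow> 'd env)"
    by (auto simp: shift_def fun_eq_iff)
  ultimately show ?thesis by (simp add: env_measure_def)
qed

lemma measurable_shift: "shift y \<in> measurable \<mu> \<mu>"
  unfolding env_measure_def
  by (rule measurable_PiM_single') (auto simp: shift_def space_PiM split: prod.split)

sublocale stationary_mean c q mean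
proof
  fix F G :: "'d env \<Rightarrow> real" and a y
  show "mean (\<lambda>\<xi>. F \<xi> + G \<xi>) = mean F + mean G" if "F \<in> env_poly" "G \<in> env_poly"
    using that by (simp add: env_poly_integrable)
  show "mean (\<lambda>\<xi>. F (shift y \<xi>)) = mean F" if "F \<in> env_poly"
  proof -
    have "mean F = (\<integral>\<xi>. F \<xi> \<partial>distr \<mu> \<mu> (shift y))" by (simp add: distr_shift)
    also have "\<dots> = mean (\<lambda>\<xi>. F (shift y \<xi>))"
      by (rule integral_distr[OF measurable_shift env_poly_measurable[OF that]])
    finally show ?thesis by simp
  qed
  show "0 \<le> mean F" if "\<And>\<xi>. \<xi> \<in> env_space c \<Longrightarrow> 0 \<le> F \<xi>"
    using that by (intro integral_nonneg_AE AE_I2) (simp add: space_\<mu>)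
qed (use c_ge_1 q_ge in \<open>auto simp: P.prob_space\<close>)

section \<open>Independence and variance bounds\<close>

lemma indep_coordinates: "P.indep_vars (\<lambda>_. \<mu>0) (\<lambda>b \<xi>. \<xi> b) UNIV"
proof (rule P.indep_vars_iff_distr_eq_PiM'[THEN iffD2])
  show "P.random_variable \<mu>0 (\<lambda>\<xi>. \<xi> b)" for b
    by (simp add: env_measure_def)
  have "distr \<mu> \<mu>0 (\<lambda>\<xi>. \<xi> b) = \<mu>0" for b
    unfolding env_measure_def by (rule distr_PiM_component) (auto intro: prob)
  then show "distr \<mu> (Pi\<^sub>M UNIV (\<lambda>_. \<mu>0)) (\<lambda>\<xi>. \<lambda>b\<in>UNIV. \<xi> b) = Pi\<^sub>M UNIV (\<lambda>b. distr \<mu> \<mu>0 (\<lambda>\<xi>. \<xi> b))"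
    by (simp add: env_measure_def restrict_def distr_id2)
qed simp

lemma env_poly_factor_measurable:
  assumes "F \<in> env_poly"
  shows "(\<lambda>\<omega>. F (\<lambda>b. if b \<in> A then \<omega> b else 0)) \<in> borel_measurable (Pi\<^sub>M A (\<lambda>_. \<mu>0))"
  using assms
proof (induction rule: env_poly.induct)
  case (coord b)
  then show ?case by (cases "b \<in> A") (auto intro: measurable_coord_PiM)
qed auto

text \<open>Each function is factored through the restriction to its own bonds, extended by the
  default 0; on disjoint sets of bonds the restrictions are independent.\<close>

lemma mean_mult_indep:
  assumes FG: "F \<in> env_poly" "G \<in> env_poly"
    and dep: "depends_on F A" "depends_on G B" "A \<inter> B = {}"
  shows "mean (\<lambda>\<xi>. F \<xi> * G \<xi>) = mean F * mean G"
proof -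
  let ?ext = "\<lambda>A \<omega> b. if b \<in> A then \<omega> b else (0 :: real)"
  have "P.indep_var (Pi\<^sub>M A (\<lambda>_. \<mu>0)) (\<lambda>\<xi>. restrict (\<lambda>b. \<xi> b) A) (Pi\<^sub>M B (\<lambda>_. \<mu>0)) (\<lambda>\<xi>. restrict (\<lambda>b. \<xi> b) B)"
    by (rule P.indep_var_restrict[OF indep_coordinates dep(3)]) auto
  then have "P.indep_var borel ((\<lambda>\<omega>. F (?ext A \<omega>)) \<circ> (\<lambda>\<xi>. restrict (\<lambda>b. \<xi> b) A)) borel ((\<lambda>\<omega>. G (?ext B \<omega>)) \<circ> (\<lambda>\<xi>. restrict (\<lambda>b. \<xi> b) B))"
    by (rule P.indep_var_compose[OF _ env_poly_factor_measurable[OF FG(1)] env_poly_factor_measurable[OF FG(2)]])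
  moreover have "(\<lambda>\<omega>. F (?ext A \<omega>)) \<circ> (\<lambda>\<xi>. restrict (\<lambda>b. \<xi> b) A) = F"
    using dep(1) unfolding depends_on_def by (auto simp: fun_eq_iff)
  moreover have "(\<lambda>\<omega>. G (?ext B \<omega>)) \<circ> (\<lambda>\<xi>. restrict (\<lambda>b. \<xi> b) B) = G"
    using dep(2) unfolding depends_on_def by (auto simp: fun_eq_iff)
  ultimately have "P.indep_var borel F borel G" by simp
  then show ?thesis
    by (rule P.indep_var_lebesgue_integral) (use FG in \<open>auto intro: env_poly_integrable\<close>)
qed

text \<open>Covariances have finite range, so each site correlates with a bounded number of others
  and the variance grows only linearly in the number of sites.\<close>

lemma variance_sum_le:
  assumes F: "F \<in> env_poly"
  shows "\<exists>K\<ge>0::real. \<forall>Q. finite Q \<longrightarrow> mean (\<lambda>\<xi>. (\<Sum>x\<in>Q. F (shift x \<xi>) - mean F)\<^sup>2) \<le> K * card Q"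
proof -
  define Y where "Y = (\<lambda>\<xi>. F \<xi> - mean F)"
  have [simp]: "Y \<in> env_poly" using F by (simp add: Y_def)
  have Y0: "mean Y = 0" using F by (simp add: Y_def E_diff P.prob_space env_poly_integrable)
  obtain A where A: "finite A" "depends_on Y A" using env_poly_local[of Y] by auto
  obtain C where C: "\<And>\<xi>. \<xi> \<in> env_space c \<Longrightarrow> \<bar>Y \<xi>\<bar> \<le> C"
    using env_poly_bounded[of Y c] c_ge_1 by auto
  \<comment> \<open>The translates of \<open>A\<close> by \<open>x\<close> and \<open>y\<close>
    share a bond only if \<open>y - x\<close> is such a difference of sites.\<close>
  define D where "D = (\<lambda>(a, b). fst a - fst b) ` (A \<times> A)"
  have "finite D" using A by (simp add: D_def)
  define cov where "cov x y = mean (\<lambda>\<xi>. Y (shift x \<xi>) * Y (shift y \<xi>))" for x y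
  have cov_le: "cov x y \<le> C\<^sup>2" for x y
  proof -
    have "cov x y \<le> mean (\<lambda>_. C\<^sup>2)"
      unfolding cov_def
    proof (rule E_mono)
      fix \<xi> :: "'d env" assume \<xi>: "\<xi> \<in> env_space c"
      have "Y (shift x \<xi>) * Y (shift y \<xi>) \<le> \<bar>Y (shift x \<xi>)\<bar> * \<bar>Y (shift y \<xi>)\<bar>"
        by (metis abs_ge_self abs_mult)
      also have "\<dots> \<le> C * C"
        using C[OF shift_env_space[OF \<xi>]] by (intro mult_mono) (auto intro: order_trans[OF abs_ge_zero])
      finally show "Y (shift x \<xi>) * Y (shift y \<xi>) \<le> C\<^sup>2" by (simp add: power2_eq_square)
    qed auto
    then show ?thesis by (simp add: P.prob_space)
  qed
  have cov_0: "cov x y = 0" if "y - x \<notin> D" for x y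
  proof -
    have "cov x y = mean (\<lambda>\<xi>. Y (shift x \<xi>)) * mean (\<lambda>\<xi>. Y (shift y \<xi>))"
      unfolding cov_def
    proof (rule mean_mult_indep[OF _ _ depends_on_shift[OF A(2)] depends_on_shift[OF A(2)]])
      show "(\<lambda>(z, i). (z + x, i)) ` A \<inter> (\<lambda>(z, i). (z + y, i)) ` A = {}"
      proof (rule ccontr)
        assume "(\<lambda>(z, i). (z + x, i)) ` A \<inter> (\<lambda>(z, i). (z + y, i)) ` A \<noteq> {}"
        then obtain z z' i where z: "(z, i) \<in> A" "(z', i) \<in> A" "z + x = z' + y" by auto
        then have "y - x = z - z'" by (simp add: algebra_simps)
        then have "y - x \<in> D" using z unfolding D_def by force
        then show False using that by simp
      qed
    qed auto
    then show ?thesis using Y0 by (simp add: E_shift)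
  qed
  have "mean (\<lambda>\<xi>. (\<Sum>x\<in>Q. F (shift x \<xi>) - mean F)\<^sup>2) \<le> (card D * C\<^sup>2) * card Q" if Q: "finite Q" for Q
  proof -
    have "mean (\<lambda>\<xi>. (\<Sum>x\<in>Q. F (shift x \<xi>) - mean F)\<^sup>2) = mean (\<lambda>\<xi>. \<Sum>x\<in>Q. \<Sum>y\<in>Q. Y (shift x \<xi>) * Y (shift y \<xi>))"
      by (simp add: power2_eq_square sum_product Y_def)
    also have "\<dots> = (\<Sum>x\<in>Q. \<Sum>y\<in>Q. cov x y)"
      by (subst E_sum, simp, subst E_sum) (auto simp: cov_def)
    also have "\<dots> \<le> (\<Sum>x\<in>Q. card D * C\<^sup>2)"
    proof (rule sum_mono)
      fix x
      have "(\<Sum>y\<in>Q. cov x y) = (\<Sum>y\<in>{y \<in> Q. y - x \<in> D}. cov x y)"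
        using Q cov_0 by (intro sum.mono_neutral_right) auto
      also have "\<dots> \<le> (\<Sum>y\<in>{y \<in> Q. y - x \<in> D}. C\<^sup>2)" by (intro sum_mono cov_le)
      also have "\<dots> = card {y \<in> Q. y - x \<in> D} * C\<^sup>2" by simp
      also have "\<dots> \<le> card D * C\<^sup>2"
      proof (intro mult_right_mono of_nat_mono)
        have "{y \<in> Q. y - x \<in> D} \<subseteq> (\<lambda>d. d + x) ` D" by (auto simp: image_iff intro!: bexI[of _ "_ - x"])
        then have "card {y \<in> Q. y - x \<in> D} \<le> card ((\<lambda>d. d + x) ` D)" using \<open>finite D\<close> by (intro card_mono) auto
        also have "\<dots> \<le> card D" by (rule card_image_le[OF \<open>finite D\<close>])
        finally show "card {y \<in> Q. y - x \<in> D} \<le> card D" .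
      qed simp
      finally show "(\<Sum>y\<in>Q. cov x y) \<le> card D * C\<^sup>2" .
    qed
    finally show ?thesis by (simp add: mult_ac)
  qed
  then show ?thesis by (intro exI[of _ "card D * C\<^sup>2"]) auto
qed

lemma mollify_variance_le:
  assumes F: "F \<in> env_poly"
  shows "\<exists>K\<ge>0::real. \<forall>Q. finite Q \<longrightarrow> Q \<noteq> {} \<longrightarrow> mean (\<lambda>\<xi>. (mollify Q F \<xi> - mean F)\<^sup>2) \<le> K / card Q"
proof -
  obtain K :: real where K: "K \<ge> 0" "\<forall>Q. finite Q \<longrightarrow> mean (\<lambda>\<xi>. (\<Sum>x\<in>Q. F (shift x \<xi>) - mean F)\<^sup>2) \<le> K * card Q"
    using variance_sum_le[OF F] by (elim exE conjE)
  have "mean (\<lambda>\<xi>. (mollify Q F \<xi> - mean F)\<^sup>2) \<le> K / card Q" if Q: "finite Q" "Q \<noteq> {}" for Q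
  proof -
    have cQ: "real (card Q) > 0" using Q by (simp add: card_gt_0_iff)
    have "mollify Q F \<xi> - mean F = 1 / card Q * (\<Sum>x\<in>Q. F (shift x \<xi>) - mean F)" for \<xi>
      using cQ by (simp add: mollify_def sum_subtractf field_simps)
    then have "mean (\<lambda>\<xi>. (mollify Q F \<xi> - mean F)\<^sup>2) = mean (\<lambda>\<xi>. (1 / card Q)\<^sup>2 * (\<Sum>x\<in>Q. F (shift x \<xi>) - mean F)\<^sup>2)"
      by (simp only: power_mult_distrib)
    also have "\<dots> = (1 / card Q)\<^sup>2 * mean (\<lambda>\<xi>. (\<Sum>x\<in>Q. F (shift x \<xi>) - mean F)\<^sup>2)"
      by (rule integral_mult_right_zero)
    also have "\<dots> \<le> (1 / card Q)\<^sup>2 * (K * card Q)"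
      using K(2)[rule_format, OF Q(1)] by (intro mult_left_mono) auto
    also have "\<dots> = K / card Q" using cQ by (simp add: power2_eq_square)
    finally show ?thesis .
  qed
  then show ?thesis using K(1) by (intro exI[of _ K]) simp
qed

text \<open>At size k^2 the variance is at most K/k^2, which is summable in every dimension; 1/N at
  size N would not be. The remaining sizes follow by comparison with squares, and periodization is
  negligible.\<close>

lemma spatial_average_AE:
  assumes F: "F \<in> env_poly"
  shows "AE \<xi> in \<mu>. (\<lambda>N. mollify (cube N) F (periodize N \<xi>)) \<longlonglongrightarrow> mean F"
proof -
  obtain K :: real where K: "K \<ge> 0" "\<forall>Q. finite Q \<longrightarrow> Q \<noteq> {} \<longrightarrow> mean (\<lambda>\<xi>. (mollify Q F \<xi> - mean F)\<^sup>2) \<le> K / card Q"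
    using mollify_variance_le[OF F] by (elim exE conjE)
  let ?X = "\<lambda>k \<xi>. (mollify (cube (k\<^sup>2)) F \<xi> - mean F)\<^sup>2"
  have "AE \<xi> in \<mu>. (\<lambda>k. ?X k \<xi>) \<longlonglongrightarrow> 0"
  proof (rule nn_summable_imp_AE_tendsto_0)
    show "integrable \<mu> (?X k)" for k using F by (intro env_poly_integrable) auto
    show "summable (\<lambda>k. mean (?X k))"
    proof (rule summable_comparison_test'[of "\<lambda>k. K * (1 / (real k)\<^sup>2)" 1])
      show "summable (\<lambda>k. K * (1 / (real k)\<^sup>2))"
        using inverse_power_summable[of 2, where 'a = real] by (intro summable_mult) (simp add: field_simps)
      fix k :: nat assume k: "1 \<le> k"
      have "norm (mean (?X k)) = mean (?X k)"
        using F by (simp add: E_square_nonneg)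
      also have "\<dots> \<le> K / card (cube (k\<^sup>2) :: (int ^ 'd) set)"
        using zero_in_cube[of "k\<^sup>2"] k by (intro K(2)[rule_format]) auto
      also have "\<dots> \<le> K / real (k\<^sup>2)"
      proof (rule divide_left_mono)
        show le: "real (k\<^sup>2) \<le> card (cube (k\<^sup>2) :: (int ^ 'd) set)"
          by (simp only: of_nat_le_iff card_cube_ge)
        have "0 < real (k\<^sup>2)" using k by simp
        then show "0 < card (cube (k\<^sup>2) :: (int ^ 'd) set) * real (k\<^sup>2)"
          using le by (intro mult_pos_pos) linarith+
      qed (rule K(1))
      finally show "norm (mean (?X k)) \<le> K * (1 / (real k)\<^sup>2)" by simp
    qed
  qed auto
  then show ?thesis
  proof (rule AE_mp, intro AE_I2 impI)
    fix \<xi> assume \<xi>: "\<xi> \<in> space \<mu>" and lim: "(\<lambda>k. ?X k \<xi>) \<longlonglongrightarrow> 0"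
    have \<xi>c: "\<xi> \<in> env_space c" using \<xi> by (simp add: space_\<mu>)
    have "(\<lambda>k. sqrt (?X k \<xi>)) \<longlonglongrightarrow> 0" using tendsto_real_sqrt[OF lim] by simp
    then have "(\<lambda>k. mollify (cube (k\<^sup>2)) F \<xi> - mean F) \<longlonglongrightarrow> 0"
      by (simp add: tendsto_rabs_zero_iff)
    then have "(\<lambda>k. mollify (cube (k\<^sup>2)) F \<xi>) \<longlonglongrightarrow> mean F" by (simp add: LIM_zero_iff)
    then have "(\<lambda>N. mollify (cube N) F \<xi>) \<longlonglongrightarrow> mean F"
      by (rule average_along_squares[OF F c_ge_1 \<xi>c])
    from tendsto_add[OF periodized_average_diff_tendsto[OF F c_ge_1 \<xi>c] this]
    show "(\<lambda>N. mollify (cube N) F (periodize N \<xi>)) \<longlonglongrightarrow> mean F" by simp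
  qed
qed

text \<open>Unlike \<^term>\<open>cube 0\<close>, the set \<open>cell 0\<close> is not empty.\<close>

definition cell :: "nat \<Rightarrow> (int ^ 'd) set" where
  "cell R = insert 0 (cube R)"

lemma nrm_mollify_tendsto_0:
  assumes F: "F \<in> env_poly"
  shows "(\<lambda>R. nrm (\<lambda>\<xi>. mollify (cell R) F \<xi> - mean F)) \<longlonglongrightarrow> 0"
proof -
  obtain K :: real where K: "K \<ge> 0" "\<forall>Q. finite Q \<longrightarrow> Q \<noteq> {} \<longrightarrow> mean (\<lambda>\<xi>. (mollify Q F \<xi> - mean F)\<^sup>2) \<le> K / card Q"
    using mollify_variance_le[OF F] by (elim exE conjE)
  have bound: "norm (nrm (\<lambda>\<xi>. mollify (cell R) F \<xi> - mean F)) \<le> sqrt (K / real R)" if "R > 0" for R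
  proof -
    have "R \<le> card (cube R :: (int ^ 'd) set)" by (rule card_cube_ge)
    also have "\<dots> \<le> card (cell R)" unfolding cell_def by (intro card_mono) auto
    finally have "K / card (cell R) \<le> K / real R" using K(1) that by (intro divide_left_mono) auto
    then have "mean (\<lambda>\<xi>. (mollify (cell R) F \<xi> - mean F)\<^sup>2) \<le> K / real R"
      using K(2)[rule_format, of "cell R"] by (simp add: cell_def)
    then have "nrm (\<lambda>\<xi>. mollify (cell R) F \<xi> - mean F) \<le> sqrt (K / real R)"
      unfolding nrm_def by (rule real_sqrt_le_mono)
    then show ?thesis using F by simp
  qed
  have "(\<lambda>R. sqrt (K / real R)) \<longlonglongrightarrow> sqrt 0"
    by (intro tendsto_real_sqrt lim_const_over_n)
  then have lim: "(\<lambda>R. sqrt (K / real R)) \<longlonglongrightarrow> 0" by simp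
  show ?thesis
    by (rule Lim_null_comparison[OF eventually_mono[OF eventually_gt_at_top[of 0]] lim]) (use bound in simp)
qed

abbreviation torus_eff :: "nat \<Rightarrow> 'd env \<Rightarrow> real ^ 'd \<Rightarrow> real" where
  "torus_eff N \<xi> \<equiv> stationary_mean.eff q (\<lambda>F. mollify (cube N) F (periodize N \<xi>))"

text \<open>For fixed \<open>v\<close> the stability lemma uses countably many local means, so a
  single null set suffices.\<close>

lemma torus_eff_tendsto_AE: "AE \<xi> in \<mu>. (\<lambda>N. torus_eff N \<xi> v) \<longlonglongrightarrow> eff v"
proof -
  let ?conv = "\<lambda>F \<xi>. (\<lambda>N. mollify (cube N) F (periodize N \<xi>)) \<longlonglongrightarrow> mean F"
  have "AE \<xi> in \<mu>. \<forall>i\<in>UNIV. ?conv (\<lambda>\<xi>. \<xi> (0, i)) \<xi>"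
    by (intro AE_finite_allI spatial_average_AE) auto
  moreover have "AE \<xi> in \<mu>. \<forall>k. ?conv (\<lambda>\<xi>. drift v \<xi> * (lazy q ^^ k) (drift v) \<xi>) \<xi>"
    unfolding AE_all_countable by (intro allI spatial_average_AE) auto
  moreover have "AE \<xi> in \<mu>. \<forall>R n. \<forall>i\<in>UNIV. ?conv (\<lambda>\<xi>. (mollify (cell R) (flux q v n i) \<xi> - mean (flux q v n i))\<^sup>2) \<xi>"
    unfolding AE_all_countable by (intro allI AE_finite_allI spatial_average_AE) auto
  moreover have "AE \<xi> in \<mu>. \<xi> \<in> env_space c" by (rule AE_I2) (simp add: space_\<mu>)
  ultimately show ?thesis
  proof eventually_elim
    case (elim \<xi>)
    show ?case
    proof (rule eff_tendsto[where B = cell and a = "real CARD('d)" and c = c])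
      show "stationary_mean c q mean" by unfold_locales
      show "stationary_mean c q (\<lambda>F. mollify (cube N) F (periodize N \<xi>))" if "N > 0" for N
        using periodic_mean_torus[OF c_ge_1 q_ge elim(4) that] by (simp add: periodic_mean_def)
      show "(\<Sum>i\<in>UNIV. real_of_int \<bar>y $ i\<bar>) \<le> real CARD('d) * real R" if "y \<in> cell R" for y R
        using that cube_l1_le[of y R] by (auto simp: cell_def)
    qed (use elim nrm_mollify_tendsto_0 in \<open>auto simp: cell_def\<close>)
  qed
qed

section \<open>Both diffusion matrices expressed by effective forms\<close>

context
  fixes W :: "'d env \<Rightarrow> 'w measure" and X :: "'d env \<Rightarrow> real \<Rightarrow> 'w \<Rightarrow> int ^ 'd"
  assumes walk: "\<And>\<xi>. \<xi> \<in> env_space c \<Longrightarrow> random_walk \<xi> 0 (W \<xi>) (X \<xi>)"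
begin

lemma second_moment_eq:
  assumes "\<xi> \<in> env_space c" "t \<ge> 0"
  shows "second_moment W X \<xi> t v = mix (q * t) (\<lambda>n. moment q v n \<xi>)"
proof -
  interpret walk_env c q \<xi> using c_ge_1 q_ge assms(1) by unfold_locales
  show ?thesis
    unfolding second_moment_def by (rule random_walk_second_moment[OF walk[OF assms(1)] assms(2)])
qed

text \<open>The lazy chain gains \<open>2 / q * torus_eff N \<xi> v\<close> per step on average, and
  the Poisson clock makes \<open>q\<close> steps per unit time.\<close>

lemma eff_diffusion_fin_eq:
  assumes \<xi>: "\<xi> \<in> env_space c" and N: "N > 0"
  shows "eff_diffusion_fin W X N \<xi> = polarization (\<lambda>v. 2 * torus_eff N \<xi> v)"
proof -
  interpret T: periodic_mean c q "\<lambda>F. mollify (cube N) F (periodize N \<xi>)" "periodize N \<xi>" "cube N"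
    by (rule periodic_mean_torus[OF c_ge_1 q_ge \<xi> N])
  show ?thesis
    unfolding eff_diffusion_fin_def
  proof (rule diffusion_matrix_eq)
    show "quadratic_form (\<lambda>v. 2 * torus_eff N \<xi> v)"
      by (intro quadratic_form_cmult T.quadratic_form_eff)
    fix v
    have "((\<lambda>t. 1 / t * mix (q * t) (\<lambda>n. moment q v n (periodize N \<xi>))) \<longlongrightarrow> q * (2 / q * torus_eff N \<xi> v)) at_top"
      by (rule mix_tendsto[OF T.moment_periodic_tendsto q_pos])
    then have "((\<lambda>t. 1 / t * mix (q * t) (\<lambda>n. moment q v n (periodize N \<xi>))) \<longlongrightarrow> 2 * torus_eff N \<xi> v) at_top"
      using q_pos by simp
    then show "((\<lambda>t. 1 / t * second_moment W X (periodize N \<xi>) t v) \<longlongrightarrow> 2 * torus_eff N \<xi> v) at_top"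
      by (rule Lim_transform_eventually)
         (use eventually_ge_at_top[of 0] in eventually_elim, simp add: second_moment_eq periodize_env_space \<xi>)
  qed
qed

text \<open>On \<open>env_space c\<close> the quenched second moment is a Poisson series of
  polynomials in \<xi>, so expectation and series may be exchanged under a summable bound.\<close>

lemma mean_second_moment:
  assumes t: "t \<ge> 0"
  shows "mean (\<lambda>\<xi>. second_moment W X \<xi> t v) = mix (q * t) (\<lambda>n. mean (moment q v n))"
proof -
  \<comment> \<open>The growth factor \<open>moment_base\<close> depends on \<open>c\<close>,
    \<open>q\<close> and \<open>v\<close> only, so one bound serves all environments.\<close>
  obtain A where A: "\<And>n \<xi>. \<xi> \<in> env_space c \<Longrightarrow> \<bar>moment q v n \<xi>\<bar> \<le> 1 * A ^ n"
  proof
    fix n and \<xi> :: "'d env" assume "\<xi> \<in> env_space c"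
    then interpret walk_env c q \<xi> using c_ge_1 q_ge by unfold_locales
    show "\<bar>moment q v n \<xi>\<bar> \<le> 1 * walk_env.moment_base c q v ^ n"
      using moment_nonneg[of n v 0] moment_le[of n v 0] by (simp add: moment_def)
  qed
  have qt: "q * t \<ge> 0" using q_pos t by simp
  have "mean (\<lambda>\<xi>. second_moment W X \<xi> t v) = mean (\<lambda>\<xi>. \<Sum>n. pois (q * t) n * moment q v n \<xi>)"
    by (rule Bochner_Integration.integral_cong) (auto simp: space_\<mu> second_moment_eq[OF _ t] mix_def)
  also have "\<dots> = (\<Sum>n. mean (\<lambda>\<xi>. pois (q * t) n * moment q v n \<xi>))"
  proof (rule integral_suminf)
    show "integrable \<mu> (\<lambda>\<xi>. pois (q * t) n * moment q v n \<xi>)" for n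
      by (intro env_poly_integrable) auto
    show "AE \<xi> in \<mu>. summable (\<lambda>n. norm (pois (q * t) n * moment q v n \<xi>))"
    proof (rule AE_I2)
      fix \<xi> assume "\<xi> \<in> space \<mu>"
      then have "\<bar>\<bar>moment q v n \<xi>\<bar>\<bar> \<le> 1 * A ^ n" for n using A by (simp add: space_\<mu>)
      from summable_pois[OF qt this]
      show "summable (\<lambda>n. norm (pois (q * t) n * moment q v n \<xi>))" using qt by (simp add: abs_mult)
    qed
    have "mean (\<lambda>\<xi>. norm (pois (q * t) n * moment q v n \<xi>)) \<le> pois (q * t) n * (1 * A ^ n)" for n
    proof -
      have "mean (\<lambda>\<xi>. norm (pois (q * t) n * moment q v n \<xi>)) \<le> mean (\<lambda>\<xi>. pois (q * t) n * (1 * A ^ n))"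
        by (intro integral_mono integrable_norm env_poly_integrable)
           (use A qt in \<open>auto simp: abs_mult space_\<mu> intro!: mult_left_mono\<close>)
      then show ?thesis by (simp add: P.prob_space)
    qed
    then show "summable (\<lambda>n. mean (\<lambda>\<xi>. norm (pois (q * t) n * moment q v n \<xi>)))"
      by (intro summable_comparison_test'[OF summable_pois_geometric[of "q * t" 1 A], of 0]) auto
  qed
  finally show ?thesis by (simp add: mix_def)
qed

lemma eff_diffusion_eq: "eff_diffusion W X \<mu> = polarization (\<lambda>v. 2 * eff v)"
  unfolding eff_diffusion_def
proof (rule diffusion_matrix_eq)
  show "quadratic_form (\<lambda>v. 2 * eff v)"
    by (intro quadratic_form_cmult quadratic_form_eff)
  fix v
  have "((\<lambda>t. 1 / t * mix (q * t) (\<lambda>n. mean (moment q v n))) \<longlongrightarrow> q * (2 / q * eff v)) at_top"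
    by (rule mix_tendsto[OF E_moment_tendsto q_pos])
  then have "((\<lambda>t. 1 / t * mix (q * t) (\<lambda>n. mean (moment q v n))) \<longlongrightarrow> 2 * eff v) at_top"
    using q_pos by simp
  then show "((\<lambda>t. 1 / t * mean (\<lambda>\<xi>. second_moment W X \<xi> t v)) \<longlongrightarrow> 2 * eff v) at_top"
    by (rule Lim_transform_eventually)
       (use eventually_ge_at_top[of 0] in eventually_elim, simp add: mean_second_moment)
qed

text \<open>A matrix is recovered from its form at e_i and e_i + e_j, so finitely many directions,
  hence finitely many null sets, are involved.\<close>

lemma eff_diffusion_fin_tendsto:
  "AE \<xi> in \<mu>. (\<lambda>N. eff_diffusion_fin W X N \<xi>) \<longlonglongrightarrow> eff_diffusion W X \<mu>"
proof -
  have "AE \<xi> in \<mu>. \<forall>i\<in>UNIV. \<forall>j\<in>UNIV. (\<lambda>N. torus_eff N \<xi> (axis i 1 + axis j 1)) \<longlonglongrightarrow> eff (axis i 1 + axis j 1)"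
    by (intro AE_finite_allI torus_eff_tendsto_AE) auto
  moreover have "AE \<xi> in \<mu>. \<forall>i\<in>UNIV. (\<lambda>N. torus_eff N \<xi> (axis i 1)) \<longlonglongrightarrow> eff (axis i 1)"
    by (intro AE_finite_allI torus_eff_tendsto_AE) auto
  moreover have "AE \<xi> in \<mu>. \<xi> \<in> env_space c" by (rule AE_I2) (simp add: space_\<mu>)
  ultimately show ?thesis
  proof eventually_elim
    case (elim \<xi>)
    have "(\<lambda>N. polarization (\<lambda>v. 2 * torus_eff N \<xi> v)) \<longlonglongrightarrow> polarization (\<lambda>v. 2 * eff v)"
      using elim(1,2) by (intro polarization_tendsto tendsto_intros) auto
    then have "(\<lambda>N. eff_diffusion_fin W X N \<xi>) \<longlonglongrightarrow> polarization (\<lambda>v. 2 * eff v)"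
      by (rule Lim_transform_eventually)
         (use eventually_gt_at_top[of 0] in eventually_elim, simp add: eff_diffusion_fin_eq elim(3))
    then show ?case by (simp add: eff_diffusion_eq)
  qed
qed

end

end

theorem mainTheorem2:
  fixes c :: real and \<mu>0 :: "real measure"
    and W :: "'d::finite env \<Rightarrow> 'w measure"
    and X :: "'d env \<Rightarrow> real \<Rightarrow> 'w \<Rightarrow> int ^ 'd"
  assumes "c \<ge> 1"
    and "prob_space \<mu>0"
    and "sets \<mu>0 = sets (restrict_space borel {1/c..c})"
    and "\<And>\<xi>. \<xi> \<in> env_space c \<Longrightarrow> random_walk \<xi> 0 (W \<xi>) (X \<xi>)"
  shows "AE \<xi> in env_measure \<mu>0.
           (\<lambda>N. eff_diffusion_fin W X N \<xi>) \<longlonglongrightarrow> eff_diffusion W X (env_measure \<mu>0)"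
proof -
  interpret iid_env c "4 * real CARD('d) * c" \<mu>0 "TYPE('d)"
    by (intro iid_env.intro assms(1-3) order_refl)
  show ?thesis by (rule eff_diffusion_fin_tendsto[OF assms(4)])
qed

end
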